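(* Let $k$ be an algebraically closed field and let $R$ be a prime affine $k$-algebra which is generated as a module over its center $Z(R)$ by a finite set of $r$ elements. Let $\chi:\mathrm{Irrep}(R)\to \mathrm{Hom}_{k\text{-Alg}}(Z(R),k)$, $\rho\mapsto\chi_\rho$, be the central character map. (a) The map $\chi$ is surjective. (b) There exists a Zariski open and dense subset $V$ of $\mathrm{Hom}_{k\text{-Alg}}(Z(R),k)$ such that if $\tau\in V$ then $\chi^{-1}(\tau)$ has exactly one element, i.e. $\tau$ is the central character of a unique (up to equivalence) irreducible representation $\rho_\tau$. Moreover all representations $\rho_\tau$ with $\tau\in V$ have the same dimension $N$, equal to the square root of the rank of $R$ over $Z(R)$. On the other hand, if $\tau\in \mathrm{Hom}_{k\text{-Alg}}(Z(R),k)$ is not in $V$, then $\tau$ is the central character of at most $r$ non-equivalent irreducible representations, and each of them has dimension $\le N$.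
   Context: Rings are associative with unit and ring homomorphisms preserve the unit. A ring $R$ is prime if for all $a,b\in R$, $arb=0$ for all $r\in R$ implies $a=0$ or $b=0$. An affine $k$-algebra is a $k$-algebra (with $k$ mapping into the center) that is finitely generated as an algebra over $k$. A representation of $R$ is a $k$-algebra homomorphism $\rho:R\to M_n(k)$, $n>0$ ($n$ is its dimension); it is irreducible if $k^n$ has no nontrivial invariant subspaces, equivalently $\rho$ is onto; $\rho_1,\rho_2:R\to M_n(k)$ are equivalent if $\rho_1=x\rho_2x^{-1}$ for some invertible $x\in M_n(k)$. $\mathrm{Irrep}(R)$ is the set of equivalence classes of finite-dimensional irreducible representations of $R$. The central character $\chi_\rho:Z(R)\to k$ of an irreducible $\rho$ is the $k$-algebra homomorphism with $\rho(z)=\chi_\rho(z)\,\mathrm{Id}$ for all $z\in Z(R)$. Since $R$ is prime, $Z(R)$ is an integral domain; the rank of $R$ over $Z(R)$ is the dimension of the $Q$-vector space $R\otimes_{Z(R)}Q$, where $Q$ is the field of fractions of $Z(R)$. Under the hypotheses $Z(R)$ is an affine $k$-algebra, so $\mathrm{Hom}_{k\text{-Alg}}(Z(R),k)$ (the set of $k$-algebra homomorphisms) is identified with the set of maximal ideals of $Z(R)$ via $\phi\mapsto\ker\phi$; it carries the Zariski topology, generated by the sets $\{f : f(c)\neq 0\}$, $c\in Z(R)$. *)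

theory Defs
  imports
    "HOL-Analysis.Function_Topology"
    "HOL-Library.Poly_Mapping"
    "HOL-Computational_Algebra.Fraction_Field"
    "Jordan_Normal_Form.VS_Connect"
begin

section \<open>The center of a ring, prime rings\<close>

typedef (overloaded) 'r center = "{z :: 'r::ring_1. \<forall>x. z * x = x * z}"
  morphisms of_center Abs_center
  by (rule exI[of _ 0]) simp

setup_lifting type_definition_center

lemma of_center_commute: "of_center z * x = x * of_center z"
  using of_center[of z] by blast

instantiation center :: (ring_1) comm_ring_1
begin

lift_definition zero_center :: "'a center" is 0 by simp
lift_definition one_center :: "'a center" is 1 by simp
lift_definition plus_center :: "'a center \<Rightarrow> 'a center \<Rightarrow> 'a center" is "(+)"
  by (simp add: distrib_left distrib_right)
lift_definition minus_center :: "'a center \<Rightarrow> 'a center \<Rightarrow> 'a center" is "(-)"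
  by (simp add: left_diff_distrib right_diff_distrib)
lift_definition uminus_center :: "'a center \<Rightarrow> 'a center" is uminus by simp
lift_definition times_center :: "'a center \<Rightarrow> 'a center \<Rightarrow> 'a center" is "(*)"
proof -
  fix a b x :: 'a
  assume a: "\<And>x. a * x = x * a" and b: "\<And>x. b * x = x * b"
  have "a * b * x = a * (x * b)"
    by (simp only: mult.assoc b[of x])
  also have "\<dots> = x * (a * b)"
    by (simp only: mult.assoc[symmetric] a[of x])
  finally show "a * b * x = x * (a * b)" .
qed

instance
proof
  fix a b c :: "'a center"
  show "a * b * c = a * (b * c)" by transfer (rule mult.assoc)
  show "a * b = b * a" by transfer (erule spec)
  show "1 * a = a" by transfer (rule mult_1_left)
  show "a + b + c = a + (b + c)" by transfer (rule add.assoc)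
  show "a + b = b + a" by transfer (rule add.commute)
  show "0 + a = a" by transfer (rule add_0_left)
  show "- a + a = 0" by transfer (rule left_minus)
  show "a - b = a + - b" by transfer (rule diff_conv_add_uminus)
  show "(a + b) * c = a * c + b * c" by transfer (rule distrib_right)
  show "(0 :: 'a center) \<noteq> 1" by transfer (rule zero_neq_one)
qed

end

text \<open>The trivial ring is excluded, since \<^class>\<open>ring_1\<close> includes \<open>0 \<noteq> 1\<close>.\<close>

class prime_ring = ring_1 +
  assumes prime_ring: "(\<And>r. a * r * b = 0) \<Longrightarrow> a = 0 \<or> b = 0"

instance center :: (prime_ring) idom
proof
  show "a * b \<noteq> 0" if "a \<noteq> 0" "b \<noteq> 0" for a b :: "'a center"
    using that
  proof (transfer, intro notI)
    fix a b :: 'a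
    assume a: "\<forall>x. a * x = x * a" and nz: "a \<noteq> 0" "b \<noteq> 0" and ab: "a * b = 0"
    have "a * r * b = 0" for r
    proof -
      have "a * r * b = r * (a * b)"
        by (metis a mult.assoc)
      then show ?thesis by (simp add: ab)
    qed
    from prime_ring[OF this] nz show False by simp
  qed
qed

definition center_scale :: "'r::ring_1 center \<Rightarrow> 'r \<Rightarrow> 'r" where
  "center_scale z x = of_center z * x"

interpretation center_module: Modules.module center_scale
  unfolding center_scale_def
  by unfold_locales
    (simp_all add: algebra_simps plus_center.rep_eq times_center.rep_eq one_center.rep_eq)


section \<open>Rank over the center\<close>

text \<open>
  The tensor product \<open>R \<otimes>\<^bsub>Z(R)\<^esub> Q\<close> with \<open>Q = 'r center fract\<close>: the free abelian
  group on \<open>R \<times> Q\<close> modulo the subgroup generated by the bilinearity and balancing relations.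
\<close>

inductive_set tensor_null :: "('r::prime_ring \<times> 'r center fract \<Rightarrow>\<^sub>0 int) set" where
  zero: "0 \<in> tensor_null"
| diff: "x \<in> tensor_null \<Longrightarrow> y \<in> tensor_null \<Longrightarrow> x - y \<in> tensor_null"
| add_left: "frag_of (a + b, q) - frag_of (a, q) - frag_of (b, q) \<in> tensor_null"
| add_right: "frag_of (a, p + q) - frag_of (a, p) - frag_of (a, q) \<in> tensor_null"
| balanced: "frag_of (center_scale z a, q) - frag_of (a, Fract z 1 * q) \<in> tensor_null"

lemma tensor_null_uminus: "x \<in> tensor_null \<Longrightarrow> - x \<in> tensor_null"
  by (drule tensor_null.diff[OF tensor_null.zero]) simp

lemma tensor_null_add: "x \<in> tensor_null \<Longrightarrow> y \<in> tensor_null \<Longrightarrow> x + y \<in> tensor_null"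
  by (drule tensor_null_uminus, drule (1) tensor_null.diff) simp

definition tensor_rel ::
    "('r::prime_ring \<times> 'r center fract \<Rightarrow>\<^sub>0 int) \<Rightarrow> ('r \<times> 'r center fract \<Rightarrow>\<^sub>0 int) \<Rightarrow> bool" where
  "tensor_rel x y \<longleftrightarrow> x - y \<in> tensor_null"

quotient_type (overloaded) 'r center_tensor =
  "'r::prime_ring \<times> 'r center fract \<Rightarrow>\<^sub>0 int" / tensor_rel
proof (rule equivpI)
  show "reflp tensor_rel"
    by (simp add: reflp_def tensor_rel_def tensor_null.zero)
  show "symp tensor_rel"
    unfolding symp_def tensor_rel_def by (auto dest: tensor_null_uminus)
  show "transp tensor_rel"
    unfolding transp_def tensor_rel_def by (auto dest: tensor_null_add)
qed

instantiation center_tensor :: (prime_ring) ab_group_add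
begin

lift_definition zero_center_tensor :: "'a center_tensor" is 0 .
lift_definition plus_center_tensor :: "'a center_tensor \<Rightarrow> 'a center_tensor \<Rightarrow> 'a center_tensor"
  is "(+)"
proof (unfold tensor_rel_def)
  fix x y u v :: "'a \<times> 'a center fract \<Rightarrow>\<^sub>0 int"
  assume "x - y \<in> tensor_null" "u - v \<in> tensor_null"
  from tensor_null_add[OF this] show "x + u - (y + v) \<in> tensor_null"
    by (simp add: algebra_simps)
qed
lift_definition minus_center_tensor :: "'a center_tensor \<Rightarrow> 'a center_tensor \<Rightarrow> 'a center_tensor"
  is "(-)"
proof (unfold tensor_rel_def)
  fix x y u v :: "'a \<times> 'a center fract \<Rightarrow>\<^sub>0 int"
  assume "x - y \<in> tensor_null" "u - v \<in> tensor_null"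
  from tensor_null.diff[OF this] show "x - u - (y - v) \<in> tensor_null"
    by (simp add: algebra_simps)
qed
lift_definition uminus_center_tensor :: "'a center_tensor \<Rightarrow> 'a center_tensor" is uminus
proof (unfold tensor_rel_def)
  fix x y :: "'a \<times> 'a center fract \<Rightarrow>\<^sub>0 int"
  assume "x - y \<in> tensor_null"
  from tensor_null_uminus[OF this] show "- x - - y \<in> tensor_null"
    by (simp add: algebra_simps)
qed

instance
  by (standard; transfer) (simp_all add: tensor_rel_def tensor_null.zero algebra_simps)

end

definition tensor_scale_raw :: "'r::prime_ring center fract \<Rightarrow>
    ('r \<times> 'r center fract \<Rightarrow>\<^sub>0 int) \<Rightarrow> ('r \<times> 'r center fract \<Rightarrow>\<^sub>0 int)" where
  "tensor_scale_raw p = frag_extend (\<lambda>(a, q). frag_of (a, p * q))"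

lemma tensor_scale_raw_simps:
  "tensor_scale_raw p (frag_of (a, q)) = frag_of (a, p * q)"
  "tensor_scale_raw p 0 = 0"
  "tensor_scale_raw p (x + y) = tensor_scale_raw p x + tensor_scale_raw p y"
  "tensor_scale_raw p (x - y) = tensor_scale_raw p x - tensor_scale_raw p y"
  by (simp_all add: tensor_scale_raw_def frag_extend_add frag_extend_diff)

lemma tensor_scale_raw_null: "x \<in> tensor_null \<Longrightarrow> tensor_scale_raw p x \<in> tensor_null"
proof (induction rule: tensor_null.induct)
  case (balanced z a q)
  then show ?case
    using tensor_null.balanced[of z a "p * q"]
    by (simp add: tensor_scale_raw_simps algebra_simps)
qed (simp_all add: tensor_scale_raw_simps distrib_left tensor_null.intros)

lift_definition tensor_scale ::
    "'r::prime_ring center fract \<Rightarrow> 'r center_tensor \<Rightarrow> 'r center_tensor"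
  is tensor_scale_raw
  unfolding tensor_rel_def tensor_scale_raw_simps(4)[symmetric]
  by (rule tensor_scale_raw_null)

lemma tensor_scale_raw_add_scalar:
  "tensor_scale_raw (p + q) x - (tensor_scale_raw p x + tensor_scale_raw q x) \<in> tensor_null"
proof -
  have "Poly_Mapping.keys x \<subseteq> UNIV" by simp
  then show ?thesis
  proof (induction rule: frag_induction)
    case zero
    show ?case by (simp add: tensor_scale_raw_simps tensor_null.zero)
  next
    case (one i)
    obtain a r where i: "i = (a, r)" by (cases i)
    show ?case
      using tensor_null.add_right[of a "p * r" "q * r"]
      by (simp add: i tensor_scale_raw_simps algebra_simps)
  next
    case (diff a b)
    from tensor_null.diff[OF diff] show ?case
      by (simp add: tensor_scale_raw_simps algebra_simps)
  qed
qed

lemma tensor_scale_raw_mult: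
  "tensor_scale_raw p (tensor_scale_raw q x) = tensor_scale_raw (p * q) x"
proof -
  have "Poly_Mapping.keys x \<subseteq> UNIV" by simp
  then show ?thesis
    by (induction rule: frag_induction) (auto simp: tensor_scale_raw_simps mult.assoc)
qed

lemma tensor_scale_raw_1: "tensor_scale_raw 1 x = x"
proof -
  have "Poly_Mapping.keys x \<subseteq> UNIV" by simp
  then show ?thesis
    by (induction rule: frag_induction) (auto simp: tensor_scale_raw_simps)
qed

interpretation center_tensor: vector_space tensor_scale
proof
  fix p q :: "'r::prime_ring center fract" and x y :: "'r center_tensor"
  obtain a b where x: "x = abs_center_tensor a" and y: "y = abs_center_tensor b"
    by (metis Quotient_abs_rep[OF Quotient_center_tensor])
  note abs = x y tensor_scale.abs_eq plus_center_tensor.abs_eq center_tensor.abs_eq_iff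
    tensor_rel_def
  show "tensor_scale p (x + y) = tensor_scale p x + tensor_scale p y"
    by (simp add: abs tensor_scale_raw_simps tensor_null.zero)
  show "tensor_scale (p + q) x = tensor_scale p x + tensor_scale q x"
    unfolding abs by (rule tensor_scale_raw_add_scalar)
  show "tensor_scale p (tensor_scale q x) = tensor_scale (p * q) x"
    by (simp add: abs tensor_scale_raw_mult tensor_null.zero)
  show "tensor_scale 1 x = x"
    by (simp add: abs tensor_scale_raw_1 tensor_null.zero)
qed

definition center_rank :: "'r::prime_ring itself \<Rightarrow> nat" where
  "center_rank _ = center_tensor.dim (UNIV :: 'r center_tensor set)"


section \<open>Affine algebras\<close>

text \<open>
  A \<open>'k\<close>-algebra structure on \<open>'r\<close> is a ring homomorphism \<open>\<iota> :: 'k \<Rightarrow> 'r center\<close>.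
\<close>

definition subalgebra :: "('k \<Rightarrow> 'r::ring_1 center) \<Rightarrow> 'r set \<Rightarrow> bool" where
  "subalgebra \<iota> A \<longleftrightarrow>
     (\<forall>c. of_center (\<iota> c) \<in> A) \<and> (\<forall>x\<in>A. \<forall>y\<in>A. x + y \<in> A \<and> x * y \<in> A)"

definition affine_algebra :: "('k::field \<Rightarrow> 'r::ring_1 center) \<Rightarrow> bool" where
  "affine_algebra \<iota> \<longleftrightarrow> comm_ring_hom \<iota> \<and> (\<exists>S. finite S \<and> subalgebra \<iota> hull S = UNIV)"


section \<open>Representations\<close>

definition representation :: "('k::field \<Rightarrow> 'r::ring_1 center) \<Rightarrow> nat \<Rightarrow> ('r \<Rightarrow> 'k mat) \<Rightarrow> bool" where
  "representation \<iota> n \<rho> \<longleftrightarrow> 0 < n \<and> (\<forall>x. \<rho> x \<in> carrier_mat n n) \<and>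
     \<rho> 1 = 1\<^sub>m n \<and> (\<forall>x y. \<rho> (x + y) = \<rho> x + \<rho> y) \<and> (\<forall>x y. \<rho> (x * y) = \<rho> x * \<rho> y) \<and>
     (\<forall>c. \<rho> (of_center (\<iota> c)) = c \<cdot>\<^sub>m 1\<^sub>m n)"

definition rep_dim :: "('r::ring_1 \<Rightarrow> 'k mat) \<Rightarrow> nat" where
  "rep_dim \<rho> = dim_row (\<rho> 1)"

lemma rep_dim_eq: "representation \<iota> n \<rho> \<Longrightarrow> rep_dim \<rho> = n"
  by (simp add: representation_def rep_dim_def)

definition irreducible_rep :: "('k::field \<Rightarrow> 'r::ring_1 center) \<Rightarrow> ('r \<Rightarrow> 'k mat) \<Rightarrow> bool" where
  "irreducible_rep \<iota> \<rho> \<longleftrightarrow> (\<exists>n. representation \<iota> n \<rho> \<and>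
     (\<forall>W. VectorSpace.subspace class_ring W (module_vec TYPE('k) n) \<and>
          (\<forall>x. \<forall>v\<in>W. \<rho> x *\<^sub>v v \<in> W) \<longrightarrow> W = {0\<^sub>v n} \<or> W = carrier_vec n))"

definition rep_equiv ::
    "('k::field \<Rightarrow> 'r::ring_1 center) \<Rightarrow> (('r \<Rightarrow> 'k mat) \<times> ('r \<Rightarrow> 'k mat)) set" where
  "rep_equiv \<iota> = {(\<rho>\<^sub>1, \<rho>\<^sub>2). irreducible_rep \<iota> \<rho>\<^sub>1 \<and> irreducible_rep \<iota> \<rho>\<^sub>2 \<and>
     (\<exists>X Y. \<forall>a. similar_mat_wit (\<rho>\<^sub>1 a) (\<rho>\<^sub>2 a) X Y)}"

lemma equiv_rep_equiv: "equiv {\<rho>. irreducible_rep \<iota> \<rho>} (rep_equiv \<iota>)"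
proof (rule equivI)
  show "rep_equiv \<iota> \<subseteq> {\<rho>. irreducible_rep \<iota> \<rho>} \<times> {\<rho>. irreducible_rep \<iota> \<rho>}"
    by (auto simp: rep_equiv_def)
  show "refl_on {\<rho>. irreducible_rep \<iota> \<rho>} (rep_equiv \<iota>)"
  proof (rule refl_onI)
    fix \<rho> assume "\<rho> \<in> {\<rho>. irreducible_rep \<iota> \<rho>}"
    then have irr: "irreducible_rep \<iota> \<rho>" by simp
    then obtain n where "\<forall>x. \<rho> x \<in> carrier_mat n n"
      unfolding irreducible_rep_def representation_def by blast
    then have "\<forall>a. similar_mat_wit (\<rho> a) (\<rho> a) (1\<^sub>m n) (1\<^sub>m n)"
      using similar_mat_wit_refl by blast
    with irr show "(\<rho>, \<rho>) \<in> rep_equiv \<iota>"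
      unfolding rep_equiv_def by blast
  qed
  show "sym (rep_equiv \<iota>)"
    unfolding sym_def rep_equiv_def using similar_mat_wit_sym by blast
  show "trans (rep_equiv \<iota>)"
    unfolding trans_def rep_equiv_def using similar_mat_wit_trans by blast
qed

definition Irrep :: "('k::field \<Rightarrow> 'r::ring_1 center) \<Rightarrow> ('r \<Rightarrow> 'k mat) set set" where
  "Irrep \<iota> = {\<rho>. irreducible_rep \<iota> \<rho>} // rep_equiv \<iota>"


section \<open>Central characters\<close>

definition center_homs :: "('k::field \<Rightarrow> 'r::ring_1 center) \<Rightarrow> ('r center \<Rightarrow> 'k) set" where
  "center_homs \<iota> = {\<phi>. comm_ring_hom \<phi> \<and> (\<forall>c. \<phi> (\<iota> c) = c)}"

definition zariski :: "('k::field \<Rightarrow> 'r::ring_1 center) \<Rightarrow> ('r center \<Rightarrow> 'k) topology" where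
  "zariski \<iota> = topology_generated_by {{\<phi> \<in> center_homs \<iota>. \<phi> c \<noteq> 0} |c. True}"

lemma topspace_zariski: "topspace (zariski \<iota>) = center_homs \<iota>"
proof -
  have "\<phi> 1 \<noteq> 0" if "\<phi> \<in> center_homs \<iota>" for \<phi>
  proof -
    from that interpret comm_ring_hom \<phi> by (simp add: center_homs_def)
    show ?thesis by simp
  qed
  then show ?thesis
    by (auto simp: zariski_def)
qed

definition central_character ::
    "('k::field \<Rightarrow> 'r::ring_1 center) \<Rightarrow> ('r \<Rightarrow> 'k mat) \<Rightarrow> 'r center \<Rightarrow> 'k" where
  "central_character \<iota> \<rho> = (THE \<phi>. \<phi> \<in> center_homs \<iota> \<and>
     (\<forall>z. \<rho> (of_center z) = \<phi> z \<cdot>\<^sub>m 1\<^sub>m (rep_dim \<rho>)))"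

lemma central_character_cong:
  assumes "(\<rho>\<^sub>1, \<rho>\<^sub>2) \<in> rep_equiv \<iota>"
  shows "rep_dim \<rho>\<^sub>1 = rep_dim \<rho>\<^sub>2" "central_character \<iota> \<rho>\<^sub>1 = central_character \<iota> \<rho>\<^sub>2"
proof -
  have *: "rep_dim \<rho> = rep_dim \<rho>' \<and>
      (\<forall>z \<phi>. \<rho>' (of_center z) = \<phi> z \<cdot>\<^sub>m 1\<^sub>m (rep_dim \<rho>') \<longrightarrow>
             \<rho> (of_center z) = \<phi> z \<cdot>\<^sub>m 1\<^sub>m (rep_dim \<rho>))"
    if equ: "(\<rho>, \<rho>') \<in> rep_equiv \<iota>" for \<rho> \<rho>'
  proof -
    from equ obtain X Y where sim: "\<And>a. similar_mat_wit (\<rho> a) (\<rho>' a) X Y"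
      unfolding rep_equiv_def by blast
    from equ obtain n where n: "representation \<iota> n \<rho>"
      unfolding rep_equiv_def irreducible_rep_def by blast
    from equ obtain m where m: "representation \<iota> m \<rho>'"
      unfolding rep_equiv_def irreducible_rep_def by blast
    have car: "\<rho> a \<in> carrier_mat n n" for a
      using n by (simp add: representation_def)
    note w = similar_mat_witD2[OF car sim]
    have "\<rho>' 1 \<in> carrier_mat m m"
      using m by (simp add: representation_def)
    with w(5)[of 1] have [simp]: "m = n" by auto
    note [simp] = rep_dim_eq[OF n] rep_dim_eq[OF m]
    have "\<rho> (of_center z) = c \<cdot>\<^sub>m 1\<^sub>m n" if "\<rho>' (of_center z) = c \<cdot>\<^sub>m 1\<^sub>m n" for z c
    proof -
      have "\<rho> (of_center z) = X * (c \<cdot>\<^sub>m 1\<^sub>m n) * Y"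
        using w(3)[of "of_center z"] that by simp
      also have "\<dots> = c \<cdot>\<^sub>m (X * Y)"
        using w(6,7) by (simp add: mult_smult_distrib[of _ n n _ n] mult_smult_assoc_mat[of _ n n _ n])
      finally show ?thesis using w(1) by simp
    qed
    then show ?thesis by simp
  qed
  have sym: "(\<rho>\<^sub>2, \<rho>\<^sub>1) \<in> rep_equiv \<iota>"
    using assms equiv_rep_equiv[of \<iota>] by (meson equivE symD)
  show "rep_dim \<rho>\<^sub>1 = rep_dim \<rho>\<^sub>2"
    using *[OF assms] by blast
  show "central_character \<iota> \<rho>\<^sub>1 = central_character \<iota> \<rho>\<^sub>2"
    unfolding central_character_def
    by (rule arg_cong[where f = The], rule ext) (use *[OF assms] *[OF sym] in blast)
qed

definition central_character_map ::
    "('k::field \<Rightarrow> 'r::ring_1 center) \<Rightarrow> ('r \<Rightarrow> 'k mat) set \<Rightarrow> 'r center \<Rightarrow> 'k" where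
  "central_character_map \<iota> C = the_elem (central_character \<iota> ` C)"

lemma central_character_map_eq:
  assumes "C \<in> Irrep \<iota>" "\<rho> \<in> C"
  shows "central_character_map \<iota> C = central_character \<iota> \<rho>"
proof -
  have "(\<rho>, \<rho>') \<in> rep_equiv \<iota>" if "\<rho>' \<in> C" for \<rho>'
    using quotient_eq_iff[OF equiv_rep_equiv] assms that unfolding Irrep_def by blast
  then have "central_character \<iota> ` C = {central_character \<iota> \<rho>}"
    using central_character_cong(2) assms(2) by fastforce
  then show ?thesis
    by (simp add: central_character_map_def)
qed

end

theory Submission
  imports Defs "Jordan_Normal_Form.Char_Poly"
begin

text \<open>
  Write \<open>Z\<close> for the center. If \<open>m\<close> is the kernel of a character of \<open>Z\<close>, then \<open>m R \<noteq> R\<close> by Nakayama, and the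
  left action on a simple quotient of \<open>R / m R\<close> is an irreducible representation over that character.
  The same construction over a finitely generated subring of \<open>Z\<close> over which \<open>R\<close> is still finite, with the
  weak Nullstellensatz for that subring, shows that the characters of \<open>Z\<close> separate its elements; this gives
  density of principal open sets without finite generation of \<open>Z\<close>.

  Let \<open>X\<close> be a maximal \<open>Z\<close>-independent set of generators, so that \<open>card X\<close> is the rank and \<open>c R\<close> lies in the
  span of \<open>X\<close> for some nonzero \<open>c\<close>. Since nonzero ideals of \<open>R\<close> meet \<open>Z\<close>, Jacobson density for the
  bimodule \<open>R\<close> gives maps \<open>f\<^sub>x(y) = \<Sum>\<^sub>l a\<^sub>l y b\<^sub>l\<close> with \<open>f\<^sub>x(x) = w\<^sub>x\<close> central and nonzero and
  \<open>f\<^sub>x(x') = 0\<close> for the other \<open>x'\<close> in \<open>X\<close>. The set \<open>V\<close> is where \<open>d = c \<Prod>\<^sub>x w\<^sub>x\<close> does not vanish: for a character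
  in \<open>V\<close> the \<open>f\<^sub>x\<close> show that the images of \<open>X\<close> under an irreducible \<open>\<rho>\<close> are a basis of the matrix algebra
  and that the kernel of \<open>\<rho>\<close> depends only on the character. Over an arbitrary character, lifts of the matrix
  units remain \<open>Z\<close>-independent, so the square of the dimension is at most the rank.
\<close>

section \<open>Linear systems\<close>

text \<open>Classically R is localized at the nonzero central elements to a central simple algebra
  over the fraction field Q, whose dimension is a square by passage to a splitting field. Here the
  argument stays in R with denominators cleared: equality of subspaces over Q becomes equality up to
  a nonzero central factor, an idempotent becomes an element with
  \<open>e * e = of_center z * e\<close>, and a basis over Q becomes a set \<open>X\<close> with a
  common denominator \<open>c\<close>. That the rank is a square is then read off from a
  representation: where \<open>d\<close> does not vanish, the independent images of \<open>X\<close>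
  fill the matrix algebra, and density supplies such a character. The bound for arbitrary characters
  rests on the same determinant trick as Nakayama: a square matrix congruent to 1 modulo an ideal
  has no kernel among suitable vectors. For Nakayama the entries are central, for the lifted matrix
  units the unknowns are; \<open>unipotent_system_trivial\<close> covers both by asking that entries
  commute with unknowns.\<close>

lemma homogeneous_system_nontrivial:
  fixes f :: "'i \<Rightarrow> 'j \<Rightarrow> 'a::idom"
  assumes "finite I" "finite J" "card I < card J"
  shows "\<exists>l. (\<exists>j\<in>J. l j \<noteq> 0) \<and> (\<forall>i\<in>I. (\<Sum>j\<in>J. f i j * l j) = 0)"
  using assms
proof (induction I arbitrary: J f rule: finite_induct)
  case empty
  then obtain j where "j \<in> J" by fastforce
  then show ?case by (intro exI[of _ "\<lambda>_. 1"]) auto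
next
  case (insert a I)
  show ?case
  proof (cases "\<forall>j\<in>J. f a j = 0")
    case True
    have "card I < card J" using insert by auto
    from insert.IH[OF insert.prems(1) this, of f] True show ?thesis by auto
  next
    case False
    then obtain b where b: "b \<in> J" "f a b \<noteq> 0" by blast
    \<comment> \<open>Fraction-free elimination of column \<open>b\<close>: the entries stay in the
      domain, so the lemma serves the center of R as well as k.\<close>
    let ?g = "\<lambda>i j. f a b * f i j - f i b * f a j"
    have "card I < card (J - {b})" using insert b by auto
    from insert.IH[OF _ this, of ?g] insert.prems obtain l where
      l: "\<exists>j\<in>J - {b}. l j \<noteq> 0" "\<forall>i\<in>I. (\<Sum>j\<in>J - {b}. ?g i j * l j) = 0" by auto
    \<comment> \<open>Back-substitution without division: the reduced solution is scaled by the
      pivot \<open>f a b\<close>, and in a domain it stays nonzero.\<close>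
    define l' where "l' j = (if j = b then - (\<Sum>j\<in>J - {b}. f a j * l j) else f a b * l j)" for j
    have sum: "(\<Sum>j\<in>J. f i j * l' j)
        = (\<Sum>j\<in>J - {b}. f i j * (f a b * l j)) - f i b * (\<Sum>j\<in>J - {b}. f a j * l j)" for i
      using insert.prems b by (simp add: sum.remove[of J b] l'_def)
    have "(\<Sum>j\<in>J. f i j * l' j) = 0" if "i \<in> insert a I" for i
    proof (cases "i = a")
      case True
      show ?thesis unfolding True sum by (simp add: sum_distrib_left algebra_simps)
    next
      case False
      then have "(\<Sum>j\<in>J - {b}. ?g i j * l j) = 0" using l that by auto
      moreover have "(\<Sum>j\<in>J. f i j * l' j) = (\<Sum>j\<in>J - {b}. ?g i j * l j)"
        unfolding sum sum_distrib_left sum_subtractf[symmetric]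
        by (rule sum.cong) (simp_all add: algebra_simps)
      ultimately show ?thesis by simp
    qed
    moreover have "\<exists>j\<in>J. l' j \<noteq> 0" using l b by (auto simp: l'_def)
    ultimately show ?thesis by blast
  qed
qed

text \<open>
  A substitute for determinants over the noncommutative ring \<open>S\<close>: the matrix \<open>m\<close> is congruent
  to the identity modulo the ideal \<open>P\<close>. Eliminating \<open>z a\<close> replaces \<open>m i j\<close> by
  \<open>m i j * m a a - m i a * m a j\<close>, which is again congruent to the identity.
\<close>

lemma unipotent_system_trivial:
  fixes m :: "'i \<Rightarrow> 'i \<Rightarrow> 'r::ring_1"
  assumes "finite I"
    and S: "1 \<in> S" "\<And>a b. a \<in> S \<Longrightarrow> b \<in> S \<Longrightarrow> a - b \<in> S" "\<And>a b. a \<in> S \<Longrightarrow> b \<in> S \<Longrightarrow> a * b \<in> S"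
    and P: "\<And>a b. a \<in> P \<Longrightarrow> b \<in> P \<Longrightarrow> a + b \<in> P" "\<And>a b. a \<in> S \<Longrightarrow> b \<in> P \<Longrightarrow> a * b \<in> P"
      "\<And>a b. a \<in> P \<Longrightarrow> b \<in> S \<Longrightarrow> a * b \<in> P"
    and comm: "\<And>s t. s \<in> S \<Longrightarrow> t \<in> T \<Longrightarrow> s * t = t * s"
    and cancel: "\<And>s t. s \<in> S \<Longrightarrow> 1 - s \<in> P \<Longrightarrow> t \<in> T \<Longrightarrow> s * t = 0 \<Longrightarrow> t = 0"
    and z: "\<And>i. i \<in> I \<Longrightarrow> z i \<in> T"
    and m: "\<And>i j. i \<in> I \<Longrightarrow> j \<in> I \<Longrightarrow> m i j \<in> S"
      "\<And>i j. i \<in> I \<Longrightarrow> j \<in> I \<Longrightarrow> (if i = j then 1 else 0) - m i j \<in> P"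
    and eq: "\<And>i. i \<in> I \<Longrightarrow> (\<Sum>j\<in>I. m i j * z j) = 0"
    and i: "i \<in> I"
  shows "z i = 0"
  using \<open>finite I\<close> z m eq i
proof (induction I arbitrary: m i rule: finite_induct)
  case empty
  then show ?case by simp
next
  case (insert a I)
  note z = insert.prems(1) and mS = insert.prems(2) and mP = insert.prems(3) and eq = insert.prems(4)
  have neg: "- x \<in> P" if "x \<in> P" for x
  proof -
    have "1 - 1 - 1 \<in> S" using S(1,2) by blast
    with P(2)[OF this that] show ?thesis by simp
  qed
  define m' where "m' i j = m i j * m a a - m i a * m a j" for i j
  have offdiag: "m i j \<in> P" if "i \<noteq> j" "i \<in> insert a I" "j \<in> insert a I" for i j
    using mP[of i j] neg[of "- m i j"] that by auto
  have z0: "z i = 0" if i: "i \<in> I" for i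
  proof (rule insert.IH[of m'])
    fix i j assume ij: "i \<in> I" "j \<in> I"
    show "m' i j \<in> S" unfolding m'_def using ij by (intro S mS) auto
    have 1: "m i a * m a j \<in> P"
      using ij insert.hyps by (intro P(3) offdiag mS) auto
    show "(if i = j then 1 else 0) - m' i j \<in> P"
    proof (cases "i = j")
      case True
      have "(1 - m i i) + m i i * (1 - m a a) + m i a * m a j \<in> P"
        by (rule P(1)[OF P(1)[OF _ P(2)] 1]) (use ij mP[of i i] mP[of a a] mS in auto)
      then show ?thesis using True by (simp add: m'_def algebra_simps)
    next
      case False
      have "- (m i j * m a a) + m i a * m a j \<in> P"
        using False ij insert.hyps by (intro P(1) P(3) neg offdiag mS) auto
      then show ?thesis using False by (simp add: m'_def)
    qed
  next
    fix i assume "i \<in> I"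
    then have 1: "(\<Sum>j\<in>I. m i j * z j) = - (m i a * z a)"
      using eq[of i] insert.hyps by (simp add: add_eq_0_iff2)
    have 2: "(\<Sum>j\<in>I. m a j * z j) = - (m a a * z a)"
      using eq[of a] insert.hyps by (simp add: add_eq_0_iff2)
    \<comment> \<open>Entries need not commute with each other, so \<open>m a a\<close> stands to
      the right of \<open>m i j\<close> in \<open>m'\<close>; it is moved across the unknowns
      only.\<close>
    have c: "z j * m a a = m a a * z j" if "j \<in> insert a I" for j
      using comm[OF mS[of a a] z[OF that]] by simp
    have "(\<Sum>j\<in>I. m' i j * z j)
        = (\<Sum>j\<in>I. m i j * (m a a * z j)) - (\<Sum>j\<in>I. m i a * (m a j * z j))"
      by (simp add: m'_def left_diff_distrib sum_subtractf mult.assoc)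
    also have "(\<Sum>j\<in>I. m i j * (m a a * z j)) = (\<Sum>j\<in>I. m i j * z j) * m a a"
      unfolding sum_distrib_right
    proof (rule sum.cong[OF refl])
      fix j assume "j \<in> I"
      then show "m i j * (m a a * z j) = m i j * z j * m a a"
        using c[of j] by (simp add: mult.assoc)
    qed
    also have "(\<Sum>j\<in>I. m i a * (m a j * z j)) = m i a * (\<Sum>j\<in>I. m a j * z j)"
      by (rule sum_distrib_left[symmetric])
    also have "(\<Sum>j\<in>I. m i j * z j) * m a a - m i a * (\<Sum>j\<in>I. m a j * z j) = 0"
      unfolding 1 2 using c[of a] by (simp add: mult.assoc)
    finally show "(\<Sum>j\<in>I. m' i j * z j) = 0" .
  qed (use i z in auto)
  have "m a a * z a = 0"
    using eq[of a] insert.hyps z0 by simp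
  then have "z a = 0" using cancel[of "m a a" "z a"] mS mP[of a a] z by simp
  with z0 insert.prems(5) show ?case by auto
qed


section \<open>Homomorphisms from finitely generated domains\<close>

definition polys_over :: "'a::comm_ring_1 set \<Rightarrow> 'a poly set" where
  "polys_over A = {q. \<forall>i. coeff q i \<in> A}"

text \<open>Subrings are kept as sets, because they grow by one element at a time; a character of
  \<open>A\<close> is then a total function whose values off \<open>A\<close> carry no
  information.\<close>

definition hom_on :: "('k \<Rightarrow> 'a::comm_ring_1) \<Rightarrow> 'a set \<Rightarrow> ('a \<Rightarrow> 'k::comm_ring_1) \<Rightarrow> bool" where
  "hom_on \<iota> A \<phi> \<longleftrightarrow> (\<forall>c. \<phi> (\<iota> c) = c) \<and>
     (\<forall>x\<in>A. \<forall>y\<in>A. \<phi> (x + y) = \<phi> x + \<phi> y \<and> \<phi> (x * y) = \<phi> x * \<phi> y)"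

locale subring_over = comm_ring_hom \<iota> for \<iota> :: "'k::field \<Rightarrow> 'a::comm_ring_1" +
  fixes A :: "'a set"
  assumes scalar: "\<iota> c \<in> A"
    and add: "x \<in> A \<Longrightarrow> y \<in> A \<Longrightarrow> x + y \<in> A"
    and mult: "x \<in> A \<Longrightarrow> y \<in> A \<Longrightarrow> x * y \<in> A"
begin

lemma zero: "0 \<in> A" using scalar[of 0] by simp
lemma one: "1 \<in> A" using scalar[of 1] by simp
lemma uminus: "x \<in> A \<Longrightarrow> - x \<in> A"
  using mult[OF scalar[of "- 1"]] by (simp add: hom_uminus)
lemma diff: "x \<in> A \<Longrightarrow> y \<in> A \<Longrightarrow> x - y \<in> A"
  using add[OF _ uminus, of x y] by simp
lemma sum: "(\<And>i. i \<in> I \<Longrightarrow> f i \<in> A) \<Longrightarrow> sum f I \<in> A"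
  by (induction I rule: infinite_finite_induct) (auto intro: zero add)
lemma power: "x \<in> A \<Longrightarrow> x ^ n \<in> A"
  by (induction n) (auto intro: one mult)

lemma polys_zero: "0 \<in> polys_over A" by (simp add: polys_over_def zero)
lemma polys_add: "p \<in> polys_over A \<Longrightarrow> q \<in> polys_over A \<Longrightarrow> p + q \<in> polys_over A"
  by (simp add: polys_over_def add)
lemma polys_diff: "p \<in> polys_over A \<Longrightarrow> q \<in> polys_over A \<Longrightarrow> p - q \<in> polys_over A"
  by (simp add: polys_over_def diff)
lemma polys_mult: "p \<in> polys_over A \<Longrightarrow> q \<in> polys_over A \<Longrightarrow> p * q \<in> polys_over A"
  by (auto simp: polys_over_def coeff_mult intro!: sum mult)
lemma polys_smult: "c \<in> A \<Longrightarrow> q \<in> polys_over A \<Longrightarrow> Polynomial.smult c q \<in> polys_over A"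
  by (simp add: polys_over_def mult)
lemma polys_monom: "c \<in> A \<Longrightarrow> monom c n \<in> polys_over A"
  by (simp add: polys_over_def zero)
lemma polys_const: "c \<in> A \<Longrightarrow> [:c:] \<in> polys_over A"
  using polys_monom[of c 0] by (simp add: monom_0)
lemma polys_coeff: "q \<in> polys_over A \<Longrightarrow> coeff q i \<in> A"
  by (simp add: polys_over_def)

lemma hom_on_zero: "hom_on \<iota> A \<phi> \<Longrightarrow> \<phi> 0 = 0"
  unfolding hom_on_def by (metis hom_zero)
lemma hom_on_add: "hom_on \<iota> A \<phi> \<Longrightarrow> x \<in> A \<Longrightarrow> y \<in> A \<Longrightarrow> \<phi> (x + y) = \<phi> x + \<phi> y"
  by (simp add: hom_on_def)
lemma hom_on_mult: "hom_on \<iota> A \<phi> \<Longrightarrow> x \<in> A \<Longrightarrow> y \<in> A \<Longrightarrow> \<phi> (x * y) = \<phi> x * \<phi> y"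
  by (simp add: hom_on_def)
lemma hom_on_scalar: "hom_on \<iota> A \<phi> \<Longrightarrow> \<phi> (\<iota> c) = c"
  by (simp add: hom_on_def)
lemma hom_on_one: "hom_on \<iota> A \<phi> \<Longrightarrow> \<phi> 1 = 1"
  unfolding hom_on_def by (metis hom_one)
lemma hom_on_uminus: "hom_on \<iota> A \<phi> \<Longrightarrow> x \<in> A \<Longrightarrow> \<phi> (- x) = - \<phi> x"
  using hom_on_add[of \<phi> x "- x"] hom_on_zero[of \<phi>]
  by (simp add: uminus eq_neg_iff_add_eq_0 add.commute)
lemma hom_on_diff: "hom_on \<iota> A \<phi> \<Longrightarrow> x \<in> A \<Longrightarrow> y \<in> A \<Longrightarrow> \<phi> (x - y) = \<phi> x - \<phi> y"
  using hom_on_add[of \<phi> x "- y"] hom_on_uminus by (simp add: uminus)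
lemma hom_on_power: "hom_on \<iota> A \<phi> \<Longrightarrow> x \<in> A \<Longrightarrow> \<phi> (x ^ n) = \<phi> x ^ n"
  by (induction n) (simp_all add: hom_on_one hom_on_mult power)
lemma hom_on_sum:
  "hom_on \<iota> A \<phi> \<Longrightarrow> (\<And>i. i \<in> I \<Longrightarrow> f i \<in> A) \<Longrightarrow> \<phi> (sum f I) = (\<Sum>i\<in>I. \<phi> (f i))"
  by (induction I rule: infinite_finite_induct) (simp_all add: hom_on_zero hom_on_add sum)

lemma map_poly_add:
  "hom_on \<iota> A \<phi> \<Longrightarrow> p \<in> polys_over A \<Longrightarrow> q \<in> polys_over A \<Longrightarrow>
    map_poly \<phi> (p + q) = map_poly \<phi> p + map_poly \<phi> q"
  by (rule poly_eqI) (simp add: coeff_map_poly hom_on_zero hom_on_add polys_coeff)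
lemma map_poly_mult:
  "hom_on \<iota> A \<phi> \<Longrightarrow> p \<in> polys_over A \<Longrightarrow> q \<in> polys_over A \<Longrightarrow>
    map_poly \<phi> (p * q) = map_poly \<phi> p * map_poly \<phi> q"
  by (rule poly_eqI)
    (simp add: coeff_map_poly hom_on_zero hom_on_mult hom_on_sum coeff_mult polys_coeff mult)
lemma map_poly_smult:
  "hom_on \<iota> A \<phi> \<Longrightarrow> c \<in> A \<Longrightarrow> q \<in> polys_over A \<Longrightarrow>
    map_poly \<phi> (Polynomial.smult c q) = Polynomial.smult (\<phi> c) (map_poly \<phi> q)"
  by (rule poly_eqI) (simp add: coeff_map_poly hom_on_zero hom_on_mult polys_coeff)

section \<open>Adjoining one element\<close>

definition adjoin :: "'a \<Rightarrow> 'a set" where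
  "adjoin y = {poly q y | q. q \<in> polys_over A}"

lemma adjoin_self: "y \<in> adjoin y"
  unfolding adjoin_def using polys_monom[OF one, of 1]
  by (intro CollectI exI[of _ "monom 1 1"]) (simp add: poly_monom)

lemma adjoin_base: "x \<in> A \<Longrightarrow> x \<in> adjoin y"
  unfolding adjoin_def using polys_const[of x] by force

lemma subring_adjoin: "subring_over \<iota> (adjoin y)"
proof
  fix x x' assume "x \<in> adjoin y" "x' \<in> adjoin y"
  then obtain p q where "x = poly p y" "x' = poly q y" "p \<in> polys_over A" "q \<in> polys_over A"
    by (auto simp: adjoin_def)
  moreover from this have "poly (p + q) y \<in> adjoin y" "poly (p * q) y \<in> adjoin y"
    unfolding adjoin_def using polys_add polys_mult by blast+
  ultimately show "x + x' \<in> adjoin y" "x * x' \<in> adjoin y" by simp_all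
qed (rule adjoin_base[OF scalar])

text \<open>\<open>A[y]\<close> is the quotient of the polynomials over \<open>A\<close> by the
  relations of \<open>y\<close>; applying \<open>\<phi>\<close> to the coefficients and evaluating
  at \<open>\<xi>\<close> descends to it once these relations are killed.\<close>

lemma hom_on_adjoin:
  assumes \<phi>: "hom_on \<iota> A \<phi>"
    and \<xi>: "\<And>q. q \<in> polys_over A \<Longrightarrow> poly q y = 0 \<Longrightarrow> poly (map_poly \<phi> q) \<xi> = 0"
  shows "\<exists>\<psi>. hom_on \<iota> (adjoin y) \<psi> \<and> (\<forall>q\<in>polys_over A. \<psi> (poly q y) = poly (map_poly \<phi> q) \<xi>)"
proof -
  define \<psi> where "\<psi> x = poly (map_poly \<phi> (SOME q. q \<in> polys_over A \<and> x = poly q y)) \<xi>" for x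
  have \<psi>: "\<psi> (poly q y) = poly (map_poly \<phi> q) \<xi>" if q: "q \<in> polys_over A" for q
  proof -
    let ?p = "SOME p. p \<in> polys_over A \<and> poly q y = poly p y"
    have p: "?p \<in> polys_over A \<and> poly q y = poly ?p y"
      by (rule someI) (use q in auto)
    then have "poly (map_poly \<phi> (?p - q)) \<xi> = 0"
      using q by (intro \<xi> polys_diff) auto
    moreover have "map_poly \<phi> ?p = map_poly \<phi> (?p - q) + map_poly \<phi> q"
      using map_poly_add[OF \<phi>, of "?p - q" q] p q polys_diff by simp
    ultimately show ?thesis by (simp add: \<psi>_def)
  qed
  have "hom_on \<iota> (adjoin y) \<psi>"
    unfolding hom_on_def
  proof (intro conjI allI ballI)
    fix c show "\<psi> (\<iota> c) = c"
      using \<psi>[OF polys_const[OF scalar[of c]]] hom_on_scalar[OF \<phi>] hom_on_zero[OF \<phi>]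
      by (simp add: Polynomial.map_poly_pCons)
  next
    fix x x' assume "x \<in> adjoin y" "x' \<in> adjoin y"
    then obtain p q where pq: "x = poly p y" "x' = poly q y" "p \<in> polys_over A" "q \<in> polys_over A"
      by (auto simp: adjoin_def)
    show "\<psi> (x + x') = \<psi> x + \<psi> x'"
      using \<psi>[OF polys_add[OF pq(3,4)]] \<psi>[OF pq(3)] \<psi>[OF pq(4)] map_poly_add[OF \<phi> pq(3,4)] pq by simp
    show "\<psi> (x * x') = \<psi> x * \<psi> x'"
      using \<psi>[OF polys_mult[OF pq(3,4)]] \<psi>[OF pq(3)] \<psi>[OF pq(4)] map_poly_mult[OF \<phi> pq(3,4)] pq by simp
  qed
  with \<psi> show ?thesis by blast
qed

text \<open>Each reduction step multiplies by the leading coefficient of \<open>p\<close> instead of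
  dividing by it, so quotient and remainder keep their coefficients in \<open>A\<close>.\<close>

lemma pseudo_division:
  assumes p: "p \<in> polys_over A" "p \<noteq> 0" and q: "q \<in> polys_over A"
  shows "\<exists>e s t. s \<in> polys_over A \<and> t \<in> polys_over A \<and>
     Polynomial.smult (lead_coeff p ^ e) q = p * s + t \<and> (t = 0 \<or> degree t < degree p)"
proof -
  have "\<exists>e s t. s \<in> polys_over A \<and> t \<in> polys_over A \<and>
     Polynomial.smult (lead_coeff p ^ e) q = p * s + t \<and> (t = 0 \<or> degree t < degree p)"
    if "q = 0 \<or> degree q < n" for n
    using that q
  proof (induction n arbitrary: q)
    case 0
    then show ?case by (intro exI[of _ 0]) (simp add: polys_zero)
  next
    case (Suc n)
    show ?case
    proof (cases "q = 0 \<or> degree q < degree p")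
      case True
      with Suc.prems show ?thesis
        by (intro exI[of _ 0] exI[of _ q] conjI) (auto simp: polys_zero)
    next
      case False
      let ?m = "monom (lead_coeff q) (degree q - degree p)"
      let ?q = "Polynomial.smult (lead_coeff p) q - p * ?m"
      have m: "?m \<in> polys_over A"
        using Suc.prems by (intro polys_monom polys_coeff)
      have q': "?q \<in> polys_over A"
        using Suc.prems p m by (intro polys_diff polys_mult polys_smult polys_coeff)
      have co: "coeff ?q i = 0" if "i \<ge> degree q" for i
      proof (cases "i = degree q")
        case True
        then show ?thesis using False
          by (simp add: mult.commute[of p] coeff_monom_mult)
      next
        case ne: False
        with that have "i > degree q" by simp
        moreover have "i - (degree q - degree p) > degree p" using False calculation by linarith
        ultimately show ?thesis
          by (simp add: mult.commute[of p] coeff_monom_mult coeff_eq_0)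
      qed
      have "?q = 0 \<or> degree ?q < n"
      proof (cases "?q = 0")
        case q0: False
        have "\<not> degree ?q \<ge> degree q" using co[of "degree ?q"] q0 leading_coeff_0_iff by blast
        then show ?thesis using Suc.prems(1) False by linarith
      qed simp
      from Suc.IH[OF this q'] obtain e s t where
        st: "s \<in> polys_over A" "t \<in> polys_over A" "Polynomial.smult (lead_coeff p ^ e) ?q = p * s + t"
          "t = 0 \<or> degree t < degree p" by blast
      have "Polynomial.smult (lead_coeff p ^ Suc e) q = Polynomial.smult (lead_coeff p ^ e) (?q + p * ?m)"
        by (simp add: mult.commute)
      also have "\<dots> = p * (s + Polynomial.smult (lead_coeff p ^ e) ?m) + t"
        unfolding smult_add_right st(3) by (simp add: algebra_simps)
      finally show ?thesis
        using st m p by (intro exI[of _ "Suc e"] exI[of _ "s + Polynomial.smult (lead_coeff p ^ e) ?m"] exI[of _ t])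
          (auto intro!: polys_add polys_smult power polys_coeff)
    qed
  qed
  from this[of "Suc (degree q)"] show ?thesis by simp
qed

end

section \<open>Weak Nullstellensatz for finitely generated domains\<close>

lemma alg_closed_non_root:
  fixes p :: "'k::alg_closed_field poly"
  assumes "p \<noteq> 0"
  shows "\<exists>x. poly p x \<noteq> 0"
proof (cases "degree p = 0")
  case True
  then obtain c where "p = [:c:]" by (rule degree_eq_zeroE)
  with assms show ?thesis by simp
next
  case False
  \<comment> \<open>A root of \<open>p + 1\<close> is a point where \<open>p\<close> has the value
    -1; this replaces the infinitude of k.\<close>
  then have "degree (p + 1) > 0"
    using degree_add_eq_left[of 1 p] by simp
  from alg_closed_imp_poly_has_root[OF this] obtain x where "poly (p + 1) x = 0" by blast
  then have "poly p x = - 1" by (simp add: add_eq_0_iff2)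
  then show ?thesis by (intro exI[of _ x]) simp
qed

text \<open>The form of the weak Nullstellensatz that survives adjoining an element: the induction
  has to prescribe an element at which the character is nonzero, the mere existence of a character
  being too weak.\<close>

definition separated_by_homs :: "('k::comm_ring_1 \<Rightarrow> 'a::comm_ring_1) \<Rightarrow> 'a set \<Rightarrow> bool" where
  "separated_by_homs \<iota> A \<longleftrightarrow> (\<forall>b\<in>A. b \<noteq> 0 \<longrightarrow> (\<exists>\<phi>. hom_on \<iota> A \<phi> \<and> \<phi> b \<noteq> 0))"

text \<open>If \<open>y\<close> is transcendental over \<open>A\<close>, a character that keeps the
  leading coefficient of \<open>B\<close> leaves a nonzero polynomial, which has a non-root. If
  \<open>y\<close> is algebraic, some nonzero multiple \<open>b'\<close> of \<open>b\<close> lies in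
  \<open>A\<close>; a character that keeps \<open>b'\<close> and the leading coefficient of a
  relation \<open>p\<close> of least degree extends by sending \<open>y\<close> to a root of the
  image of \<open>p\<close>, and it cannot kill \<open>b\<close>.\<close>

lemma separated_adjoin:
  fixes \<iota> :: "'k::alg_closed_field \<Rightarrow> 'a::idom"
  assumes "subring_over \<iota> A" and sep: "separated_by_homs \<iota> A"
  shows "separated_by_homs \<iota> (subring_over.adjoin A y)"
proof -
  interpret subring_over \<iota> A by fact
  show ?thesis
    unfolding separated_by_homs_def
  proof (intro ballI impI)
    fix b assume bA: "b \<in> adjoin y" and b0: "b \<noteq> 0"
    then obtain B where B: "B \<in> polys_over A" "b = poly B y" by (auto simp: adjoin_def)
    let ?alg = "\<lambda>p. p \<in> polys_over A \<and> p \<noteq> 0 \<and> poly p y = 0"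
    show "\<exists>\<phi>. hom_on \<iota> (adjoin y) \<phi> \<and> \<phi> b \<noteq> 0"
    proof (cases "\<exists>p. ?alg p")
      case False
      have "B \<noteq> 0" using B b0 by auto
      then have "lead_coeff B \<noteq> 0" by simp
      with sep polys_coeff[OF B(1)] obtain \<phi> where
        \<phi>: "hom_on \<iota> A \<phi>" "\<phi> (lead_coeff B) \<noteq> 0" unfolding separated_by_homs_def by blast
      have "map_poly \<phi> B \<noteq> 0"
        using \<phi> coeff_map_poly[of \<phi> B "degree B"] hom_on_zero[OF \<phi>(1)] by auto
      from alg_closed_non_root[OF this] obtain \<xi> where \<xi>: "poly (map_poly \<phi> B) \<xi> \<noteq> 0" by blast
      have "poly (map_poly \<phi> q) \<xi> = 0" if "q \<in> polys_over A" "poly q y = 0" for q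
        using False that by fastforce
      from hom_on_adjoin[OF \<phi>(1) this] obtain \<psi> where
        "hom_on \<iota> (adjoin y) \<psi>" "\<forall>q\<in>polys_over A. \<psi> (poly q y) = poly (map_poly \<phi> q) \<xi>" by blast
      with B \<xi> show ?thesis by auto
    next
      case True
      then obtain p where p: "?alg p" and pmin: "\<And>q. ?alg q \<Longrightarrow> degree p \<le> degree q"
        using arg_min_nat_lemma[of ?alg _ degree] by blast
      have p0: "degree p > 0"
      proof (rule ccontr)
        assume "\<not> degree p > 0"
        then obtain c where "p = [:c:]" using degree_eq_zeroE by blast
        with p show False by simp
      qed
      \<comment> \<open>A candidate of least degree will turn out to be constant, which gives a
        nonzero multiple of \<open>b\<close> in \<open>A\<close> without norms or
        resultants.\<close>
      let ?mult = "\<lambda>s. s \<in> polys_over A \<and> poly s y \<noteq> 0 \<and> (\<exists>u\<in>adjoin y. poly s y = b * u)"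
      have "?mult B"
        using B b0 adjoin_base[OF one] by (auto intro: bexI[of _ 1])
      then obtain s where s: "?mult s" and smin: "\<And>q. ?mult q \<Longrightarrow> degree s \<le> degree q"
        using arg_min_nat_lemma[of ?mult _ degree] by blast
      obtain u where u: "u \<in> adjoin y" "poly s y = b * u" using s by blast
      interpret ad: subring_over \<iota> "adjoin y" by (rule subring_adjoin)
      have poly_ad: "poly q y \<in> adjoin y" if "q \<in> polys_over A" for q
        using that by (auto simp: adjoin_def)
      \<comment> \<open>The remainder of \<open>s\<close> modulo \<open>p\<close> has as value at
        \<open>y\<close> a power of the leading coefficient times that of \<open>s\<close>, again a
        nonzero multiple of \<open>b\<close>. So \<open>s\<close> has at most the degree of that
        remainder.\<close>
      have lt: "degree s < degree p"
      proof -
        from pseudo_division[of p s] p s obtain e q t where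
          t: "q \<in> polys_over A" "t \<in> polys_over A" "Polynomial.smult (lead_coeff p ^ e) s = p * q + t"
            "t = 0 \<or> degree t < degree p" by blast
        have ty: "poly t y = lead_coeff p ^ e * poly s y"
          using arg_cong[OF t(3), of "\<lambda>q. poly q y"] p by simp
        then have t0: "poly t y \<noteq> 0" using s p by simp
        have "poly t y = b * (lead_coeff p ^ e * u)"
          using ty u by simp
        moreover have "lead_coeff p ^ e * u \<in> adjoin y"
          using p u by (intro ad.mult ad.power) (auto intro: adjoin_base polys_coeff)
        ultimately have "?mult t"
          using t t0 by blast
        then have "degree s \<le> degree t" by (rule smin)
        with t t0 show ?thesis by auto
      qed
      \<comment> \<open>The remainder of \<open>p\<close> modulo \<open>s\<close> vanishes at
        \<open>y\<close> by minimality of \<open>s\<close>, and is then 0 by minimality of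
        \<open>p\<close>. If \<open>s\<close> were not constant, the cofactor \<open>q\<close> would
        be a relation of degree below that of \<open>p\<close>.\<close>
      have "degree s = 0"
      proof (rule ccontr)
        assume s0: "degree s \<noteq> 0"
        then have snz: "s \<noteq> 0" by auto
        from pseudo_division[of s p] p s snz obtain e q t where
          t: "q \<in> polys_over A" "t \<in> polys_over A" "Polynomial.smult (lead_coeff s ^ e) p = s * q + t"
            "t = 0 \<or> degree t < degree s" by blast
        have ty: "poly s y * poly q y + poly t y = 0"
          using arg_cong[OF t(3), of "\<lambda>q. poly q y"] p by simp
        have "poly t y = 0"
        proof (rule ccontr)
          assume t0: "poly t y \<noteq> 0"
          have "poly t y = - (poly s y * poly q y)" using ty by (simp add: eq_neg_iff_add_eq_0 add.commute)
          then have "poly t y = b * (- (u * poly q y))" using u by simp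
          moreover have "- (u * poly q y) \<in> adjoin y"
            using t u by (intro ad.uminus ad.mult poly_ad)
          ultimately have "?mult t"
            using t t0 by blast
          then have "degree s \<le> degree t" by (rule smin)
          with t t0 show False by auto
        qed
        moreover have "t = 0"
        proof (rule ccontr)
          assume "t \<noteq> 0"
          with \<open>poly t y = 0\<close> t have "degree p \<le> degree t" by (intro pmin) auto
          with \<open>t \<noteq> 0\<close> t lt show False by auto
        qed
        ultimately have "poly q y = 0" using ty s by simp
        have sm: "Polynomial.smult (lead_coeff s ^ e) p = s * q" using t \<open>t = 0\<close> by simp
        have "q \<noteq> 0" using sm p snz by auto
        then have "degree p \<le> degree q" using \<open>poly q y = 0\<close> t by (intro pmin) auto
        moreover have "degree p = degree s + degree q"
          using arg_cong[OF sm, of degree] snz \<open>q \<noteq> 0\<close> by (simp add: degree_mult_eq)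
        ultimately show False using s0 by simp
      qed
      then obtain b' where b': "s = [:b':]" using degree_eq_zeroE by blast
      have b'A: "b' \<in> A" "b' \<noteq> 0" "b' = b * u"
        using s u polys_coeff[of s 0] by (auto simp: b')
      \<comment> \<open>Keeping \<open>?l\<close> nonzero preserves the degree of \<open>p\<close>,
        hence provides a root, and lets powers of \<open>?l\<close> be cancelled when other
        relations are reduced modulo \<open>p\<close>.\<close>
      let ?l = "lead_coeff p"
      have lA: "?l \<in> A" using p polys_coeff by blast
      have "?l * b' \<noteq> 0" "?l * b' \<in> A" using p b'A lA mult by auto
      with sep obtain \<phi> where \<phi>: "hom_on \<iota> A \<phi>" "\<phi> (?l * b') \<noteq> 0"
        unfolding separated_by_homs_def by blast
      then have nz: "\<phi> ?l \<noteq> 0" "\<phi> b' \<noteq> 0" using hom_on_mult[OF \<phi>(1) lA b'A(1)] by auto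
      have "degree (map_poly \<phi> p) \<ge> degree p"
        using nz by (intro le_degree) (simp add: coeff_map_poly hom_on_zero[OF \<phi>(1)])
      then have "degree (map_poly \<phi> p) > 0" using p0 by simp
      from alg_closed_imp_poly_has_root[OF this] obtain \<xi> where \<xi>: "poly (map_poly \<phi> p) \<xi> = 0" by blast
      have "poly (map_poly \<phi> q) \<xi> = 0" if q: "q \<in> polys_over A" "poly q y = 0" for q
      proof -
        from pseudo_division[of p q] p q obtain e r t where
          t: "r \<in> polys_over A" "t \<in> polys_over A" "Polynomial.smult (?l ^ e) q = p * r + t"
            "t = 0 \<or> degree t < degree p" by blast
        have "poly t y = 0"
          using arg_cong[OF t(3), of "\<lambda>q. poly q y"] p q by simp
        have "t = 0"
        proof (rule ccontr)
          assume "t \<noteq> 0"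
          with \<open>poly t y = 0\<close> t have "degree p \<le> degree t" by (intro pmin) auto
          with \<open>t \<noteq> 0\<close> t show False by auto
        qed
        then have "map_poly \<phi> (Polynomial.smult (?l ^ e) q) = map_poly \<phi> (p * r)" using t by simp
        moreover have "map_poly \<phi> (p * r) = map_poly \<phi> p * map_poly \<phi> r"
          using p t by (intro map_poly_mult[OF \<phi>(1)]) auto
        moreover have "map_poly \<phi> (Polynomial.smult (?l ^ e) q) = Polynomial.smult (\<phi> ?l ^ e) (map_poly \<phi> q)"
          using map_poly_smult[OF \<phi>(1) power[OF lA] q(1)] hom_on_power[OF \<phi>(1) lA] by simp
        ultimately have "Polynomial.smult (\<phi> ?l ^ e) (map_poly \<phi> q) = map_poly \<phi> p * map_poly \<phi> r"
          by simp
        from arg_cong[OF this, of "\<lambda>q. poly q \<xi>"] \<xi> nz show ?thesis by simp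
      qed
      from hom_on_adjoin[OF \<phi>(1) this] obtain \<psi> where
        \<psi>: "hom_on \<iota> (adjoin y) \<psi>" "\<forall>q\<in>polys_over A. \<psi> (poly q y) = poly (map_poly \<phi> q) \<xi>" by blast
      have "\<psi> b' = \<phi> b'"
        using bspec[OF \<psi>(2) polys_const[OF b'A(1)]] hom_on_zero[OF \<phi>(1)]
        by (simp add: Polynomial.map_poly_pCons)
      moreover have "\<psi> b' = \<psi> b * \<psi> u"
        using ad.hom_on_mult[OF \<psi>(1) bA u(1)] b'A by simp
      ultimately have "\<psi> b \<noteq> 0" using nz by auto
      with \<psi> show ?thesis by blast
    qed
  qed
qed

text \<open>The induction starts from the image of k, where the inverse of \<open>\<iota>\<close> is
  the separating character, and adjoins the elements of \<open>F\<close> one by one.\<close>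

theorem finitely_generated_separated_by_homs:
  fixes \<iota> :: "'k::alg_closed_field \<Rightarrow> 'a::idom"
  assumes \<iota>: "comm_ring_hom \<iota>" and "finite F"
  shows "\<exists>A. subring_over \<iota> A \<and> F \<subseteq> A \<and> separated_by_homs \<iota> A"
  using \<open>finite F\<close>
proof (induction F rule: finite_induct)
  case empty
  interpret comm_ring_hom \<iota> by fact
  have inj: "inj \<iota>"
  proof (rule injI)
    fix x y assume "\<iota> x = \<iota> y"
    then have *: "\<iota> (x - y) = 0" by (simp add: hom_minus)
    show "x = y"
    proof (rule ccontr)
      assume "x \<noteq> y"
      then have "\<iota> ((x - y) * inverse (x - y)) = 1" by simp
      with * show False by (simp only: hom_mult) simp
    qed
  qed
  have sub: "subring_over \<iota> (range \<iota>)"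
  proof
    fix x y assume "x \<in> range \<iota>" "y \<in> range \<iota>"
    then obtain a b where "x = \<iota> a" "y = \<iota> b" by blast
    then have "x + y = \<iota> (a + b)" "x * y = \<iota> (a * b)" by (simp_all add: hom_add hom_mult)
    then show "x + y \<in> range \<iota>" "x * y \<in> range \<iota>" by blast+
  qed simp
  have "hom_on \<iota> (range \<iota>) (inv_into UNIV \<iota>)"
    unfolding hom_on_def
  proof (intro conjI allI ballI)
    fix x y assume "x \<in> range \<iota>" "y \<in> range \<iota>"
    then obtain a b where "x = \<iota> a" "y = \<iota> b" by blast
    moreover have "inv_into UNIV \<iota> (\<iota> (a + b)) = a + b" "inv_into UNIV \<iota> (\<iota> (a * b)) = a * b"
      by (simp_all only: inv_f_f[OF inj])
    ultimately show "inv_into UNIV \<iota> (x + y) = inv_into UNIV \<iota> x + inv_into UNIV \<iota> y"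
      "inv_into UNIV \<iota> (x * y) = inv_into UNIV \<iota> x * inv_into UNIV \<iota> y"
      by (simp_all add: inv_f_f[OF inj] hom_add hom_mult)
  qed (simp add: inv_f_f[OF inj])
  moreover have "inv_into UNIV \<iota> b \<noteq> 0" if "b \<in> range \<iota>" "b \<noteq> 0" for b
    using that by (auto simp: inv_f_f[OF inj])
  ultimately have "separated_by_homs \<iota> (range \<iota>)"
    unfolding separated_by_homs_def by blast
  with sub show ?case by blast
next
  case (insert y F)
  then obtain A where A: "subring_over \<iota> A" "F \<subseteq> A" "separated_by_homs \<iota> A" by blast
  then interpret subring_over \<iota> A by simp
  show ?case
    using subring_adjoin[of y] separated_adjoin[OF A(1,3), of y] adjoin_self[of y] adjoin_base[of _ y] A(2)
    by blast
qed

section \<open>Irreducible matrix representations\<close>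

lemma mat_unit_vec_col:
  fixes A :: "'a::semiring_1 mat"
  assumes "A \<in> carrier_mat m n" "i < n"
  shows "A *\<^sub>v unit_vec n i = col A i"
  using assms by (intro eq_vecI) (auto simp: scalar_prod_right_unit)

lemma smult_mat_vec:
  fixes A :: "'a::comm_ring_1 mat"
  assumes "A \<in> carrier_mat m n" "v \<in> carrier_vec n"
  shows "(c \<cdot>\<^sub>m A) *\<^sub>v v = c \<cdot>\<^sub>v (A *\<^sub>v v)"
  using assms by (intro eq_vecI) auto

lemma mat_eq_if_action_eq:
  fixes A B :: "'a::semiring_1 mat"
  assumes AB: "A \<in> carrier_mat m n" "B \<in> carrier_mat m n"
    and "\<And>i. i < n \<Longrightarrow> A *\<^sub>v unit_vec n i = B *\<^sub>v unit_vec n i"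
  shows "A = B"
  by (rule mat_col_eqI) (use assms(3) AB in \<open>auto simp: mat_unit_vec_col[OF AB(1)] mat_unit_vec_col[OF AB(2)]\<close>)

lemma linear_map_matrix:
  fixes \<theta> :: "'a::comm_ring_1 vec \<Rightarrow> 'a vec"
  assumes car: "\<And>u. u \<in> carrier_vec n \<Longrightarrow> \<theta> u \<in> carrier_vec m"
    and add: "\<And>u v. u \<in> carrier_vec n \<Longrightarrow> v \<in> carrier_vec n \<Longrightarrow> \<theta> (u + v) = \<theta> u + \<theta> v"
    and smult: "\<And>c u. u \<in> carrier_vec n \<Longrightarrow> \<theta> (c \<cdot>\<^sub>v u) = c \<cdot>\<^sub>v \<theta> u"
  shows "\<exists>X\<in>carrier_mat m n. \<forall>u\<in>carrier_vec n. \<theta> u = X *\<^sub>v u"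
proof
  let ?X = "mat m n (\<lambda>(i, j). \<theta> (unit_vec n j) $ i)"
  show "?X \<in> carrier_mat m n" by simp
  show "\<forall>u\<in>carrier_vec n. \<theta> u = ?X *\<^sub>v u"
  proof
    fix u :: "'a vec" assume u: "u \<in> carrier_vec n"
    \<comment> \<open>Truncations of \<open>u\<close>: the basis expansion becomes an induction on
      the number of coordinates, without sums of vectors.\<close>
    let ?t = "\<lambda>k. vec n (\<lambda>j. if j < k then u $ j else 0)"
    have "\<theta> (?t k) $ i = (\<Sum>j<k. \<theta> (unit_vec n j) $ i * u $ j)" if "k \<le> n" "i < m" for k i
      using that
    proof (induction k)
      case 0
      have "?t 0 = 0 \<cdot>\<^sub>v 0\<^sub>v n" by auto
      then have "\<theta> (?t 0) = 0 \<cdot>\<^sub>v \<theta> (0\<^sub>v n)" using smult by simp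
      then show ?case using car[of "0\<^sub>v n"] 0 by simp
    next
      case (Suc k)
      have "?t (Suc k) = ?t k + u $ k \<cdot>\<^sub>v unit_vec n k"
        by (rule eq_vecI) (auto simp: less_Suc_eq unit_vec_def)
      then have "\<theta> (?t (Suc k)) = \<theta> (?t k) + u $ k \<cdot>\<^sub>v \<theta> (unit_vec n k)"
        using add smult by simp
      moreover have "\<theta> (?t k) \<in> carrier_vec m" "\<theta> (unit_vec n k) \<in> carrier_vec m"
        using car by auto
      ultimately show ?case using Suc by (simp add: mult.commute)
    qed
    from this[of n] have "\<theta> (?t n) $ i = (?X *\<^sub>v u) $ i" if "i < m" for i
      using that u by (simp add: scalar_prod_def atLeast0LessThan)
    moreover have "?t n = u" using u by auto
    ultimately show "\<theta> u = ?X *\<^sub>v u" using car[OF u] by auto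
  qed
qed

lemma injective_mat_dim_le:
  fixes X :: "'a::idom mat"
  assumes X: "X \<in> carrier_mat m n"
    and inj: "\<And>w. w \<in> carrier_vec n \<Longrightarrow> X *\<^sub>v w = 0\<^sub>v m \<Longrightarrow> w = 0\<^sub>v n"
  shows "n \<le> m"
proof (rule ccontr)
  assume "\<not> n \<le> m"
  then obtain l where l: "\<exists>j<n. l j \<noteq> 0" "\<forall>i<m. (\<Sum>j<n. X $$ (i, j) * l j) = 0"
    using homogeneous_system_nontrivial[of "{..<m}" "{..<n}" "\<lambda>i j. X $$ (i, j)"] by auto
  have "X *\<^sub>v vec n l = 0\<^sub>v m"
    using X l by (intro eq_vecI) (auto simp: scalar_prod_def atLeast0LessThan)
  from inj[OF _ this] have "vec n l = 0\<^sub>v n" by simp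
  with l show False by (metis index_vec index_zero_vec(1))
qed

locale matrix_rep =
  fixes \<iota> :: "'k::field \<Rightarrow> 'r::ring_1 center" and n :: nat and \<rho> :: "'r \<Rightarrow> 'k mat"
  assumes rep: "representation \<iota> n \<rho>"
begin

lemma dim_pos: "0 < n" and carrier [simp]: "\<rho> x \<in> carrier_mat n n"
  and one: "\<rho> 1 = 1\<^sub>m n" and add: "\<rho> (x + y) = \<rho> x + \<rho> y" and mult: "\<rho> (x * y) = \<rho> x * \<rho> y"
  and scalar: "\<rho> (of_center (\<iota> c)) = c \<cdot>\<^sub>m 1\<^sub>m n"
  using rep by (simp_all add: representation_def)

lemma dims [simp]: "dim_row (\<rho> x) = n" "dim_col (\<rho> x) = n"
  using carrier by blast+

lemma act_carrier [simp]: "v \<in> carrier_vec n \<Longrightarrow> \<rho> x *\<^sub>v v \<in> carrier_vec n"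
  using carrier by (rule mult_mat_vec_carrier)

lemma act_one: "v \<in> carrier_vec n \<Longrightarrow> \<rho> 1 *\<^sub>v v = v"
  by (simp add: one)
lemma act_add: "v \<in> carrier_vec n \<Longrightarrow> \<rho> (x + y) *\<^sub>v v = \<rho> x *\<^sub>v v + \<rho> y *\<^sub>v v"
  by (simp add: add add_mult_distrib_mat_vec[OF carrier carrier])
lemma act_mult: "v \<in> carrier_vec n \<Longrightarrow> \<rho> (x * y) *\<^sub>v v = \<rho> x *\<^sub>v (\<rho> y *\<^sub>v v)"
  by (simp add: mult assoc_mult_mat_vec[OF carrier carrier])
lemma act_scalar: "v \<in> carrier_vec n \<Longrightarrow> \<rho> (of_center (\<iota> c)) *\<^sub>v v = c \<cdot>\<^sub>v v"
  by (simp add: scalar smult_mat_vec[of _ n n])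

lemma zero: "\<rho> 0 = 0\<^sub>m n n"
proof -
  have 1: "\<rho> 0 = \<rho> 0 + \<rho> 0" using add[of 0 0] by simp
  have "\<rho> 0 $$ (i, j) = 0" if "i < n" "j < n" for i j
  proof -
    have "\<rho> 0 $$ (i, j) = \<rho> 0 $$ (i, j) + \<rho> 0 $$ (i, j)"
      using arg_cong[OF 1, of "\<lambda>A. A $$ (i, j)"] that by simp
    then show ?thesis by (simp only: add_cancel_right_right)
  qed
  then show ?thesis by (intro eq_matI) auto
qed

lemma sum: "finite I \<Longrightarrow> i < n \<Longrightarrow> j < n \<Longrightarrow> \<rho> (\<Sum>a\<in>I. f a) $$ (i, j) = (\<Sum>a\<in>I. \<rho> (f a) $$ (i, j))"
  by (induction I rule: finite_induct) (simp_all add: zero add)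

lemma scale: "\<rho> (of_center (\<iota> c) * x) = c \<cdot>\<^sub>m \<rho> x"
  by (simp add: mult scalar mult_smult_assoc_mat[OF one_carrier_mat carrier] left_mult_one_mat[OF carrier])

lemma act_zero: "v \<in> carrier_vec n \<Longrightarrow> \<rho> 0 *\<^sub>v v = 0\<^sub>v n"
  by (auto simp: zero intro!: eq_vecI)

lemma act_uminus: "v \<in> carrier_vec n \<Longrightarrow> \<rho> (- x) *\<^sub>v v = - (\<rho> x *\<^sub>v v)"
proof -
  assume v: "v \<in> carrier_vec n"
  have "\<rho> x *\<^sub>v v + \<rho> (- x) *\<^sub>v v = 0\<^sub>v n"
    using act_add[OF v, of x "- x"] act_zero[OF v] by simp
  then have "(\<rho> x *\<^sub>v v) $ i + (\<rho> (- x) *\<^sub>v v) $ i = 0" if "i < n" for i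
    using that v by (metis act_carrier carrier_vecD index_add_vec(1) index_zero_vec(1))
  then show ?thesis
    using v by (intro eq_vecI) (auto simp: eq_neg_iff_add_eq_0 add.commute)
qed

lemma act_diff: "v \<in> carrier_vec n \<Longrightarrow> \<rho> (x - y) *\<^sub>v v = \<rho> x *\<^sub>v v - \<rho> y *\<^sub>v v"
  using act_add[of v x "- y"] act_uminus[of v y] by (simp add: minus_add_uminus_vec[of _ n])

lemma act_sum:
  "finite I \<Longrightarrow> v \<in> carrier_vec n \<Longrightarrow> i < n \<Longrightarrow>
    (\<rho> (\<Sum>a\<in>I. f a) *\<^sub>v v) $ i = (\<Sum>a\<in>I. (\<rho> (f a) *\<^sub>v v) $ i)"
proof (induction I rule: finite_induct)
  case (insert x F)
  then have "(\<rho> (f x) *\<^sub>v v + \<rho> (\<Sum>a\<in>F. f a) *\<^sub>v v) $ i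
      = (\<rho> (f x) *\<^sub>v v) $ i + (\<rho> (\<Sum>a\<in>F. f a) *\<^sub>v v) $ i"
    by (intro index_add_vec(1)) simp
  with insert show ?case by (simp add: act_add)
qed (simp add: act_zero)

lemma nonzero_act: "\<rho> x \<noteq> 0\<^sub>m n n \<Longrightarrow> \<exists>v\<in>carrier_vec n. \<rho> x *\<^sub>v v \<noteq> 0\<^sub>v n"
proof (rule ccontr)
  assume x: "\<rho> x \<noteq> 0\<^sub>m n n" "\<not> (\<exists>v\<in>carrier_vec n. \<rho> x *\<^sub>v v \<noteq> 0\<^sub>v n)"
  have "\<rho> x = 0\<^sub>m n n"
    by (rule mat_eq_if_action_eq[of _ n n]) (use x in auto)
  with x show False by simp
qed

end

section \<open>Intertwiners and invariant subspaces\<close>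

definition left_ideal :: "'r::ring_1 set \<Rightarrow> bool" where
  "left_ideal K \<longleftrightarrow> 0 \<in> K \<and> (\<forall>a\<in>K. \<forall>b\<in>K. a + b \<in> K) \<and> (\<forall>x. \<forall>a\<in>K. x * a \<in> K)"

lemma left_ideal_diff: "left_ideal K \<Longrightarrow> a \<in> K \<Longrightarrow> b \<in> K \<Longrightarrow> a - b \<in> K"
  unfolding left_ideal_def by (metis diff_conv_add_uminus mult_minus1)

text \<open>The map from \<open>\<rho> a *\<^sub>v u\<close> to
  \<open>\<sigma> a *\<^sub>v v\<close>, for \<open>a\<close> in \<open>K\<close>, is well defined
  by the kernel condition and everywhere defined by surjectivity. Density uses it with
  \<open>\<rho> = \<sigma>\<close> and a proper \<open>K\<close>, equivalence of representations
  with \<open>K = UNIV\<close>.\<close>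

lemma intertwiner_exists:
  fixes \<iota> :: "'k::field \<Rightarrow> 'r::ring_1 center"
  assumes "representation \<iota> n \<rho>" "representation \<iota> m \<sigma>" and K: "left_ideal K"
    and u: "u \<in> carrier_vec n" and v: "v \<in> carrier_vec m"
    and onto: "\<And>w. w \<in> carrier_vec n \<Longrightarrow> \<exists>a\<in>K. \<rho> a *\<^sub>v u = w"
    and ker: "\<And>a. a \<in> K \<Longrightarrow> \<rho> a *\<^sub>v u = 0\<^sub>v n \<Longrightarrow> \<sigma> a *\<^sub>v v = 0\<^sub>v m"
  shows "\<exists>X\<in>carrier_mat m n. (\<forall>a\<in>K. X *\<^sub>v (\<rho> a *\<^sub>v u) = \<sigma> a *\<^sub>v v) \<and>
    (\<forall>x. \<forall>w\<in>carrier_vec n. X *\<^sub>v (\<rho> x *\<^sub>v w) = \<sigma> x *\<^sub>v (X *\<^sub>v w))"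
proof -
  interpret \<rho>: matrix_rep \<iota> n \<rho> by unfold_locales fact
  interpret \<sigma>: matrix_rep \<iota> m \<sigma> by unfold_locales fact
  define lift where "lift w = (SOME a. a \<in> K \<and> \<rho> a *\<^sub>v u = w)" for w
  have lift: "lift w \<in> K \<and> \<rho> (lift w) *\<^sub>v u = w" if "w \<in> carrier_vec n" for w
    unfolding lift_def by (rule someI_ex) (use onto[OF that] in blast)
  have wd: "\<sigma> a *\<^sub>v v = \<sigma> b *\<^sub>v v" if "a \<in> K" "b \<in> K" "\<rho> a *\<^sub>v u = \<rho> b *\<^sub>v u" for a b
  proof -
    have "\<sigma> (a - b) *\<^sub>v v = 0\<^sub>v m"
      using that u left_ideal_diff[OF K] by (intro ker) (simp_all add: \<rho>.act_diff)
    then have "\<sigma> a *\<^sub>v v - \<sigma> b *\<^sub>v v = 0\<^sub>v m" using v by (simp add: \<sigma>.act_diff)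
    then have "(\<sigma> a *\<^sub>v v - \<sigma> b *\<^sub>v v) $ i = 0" if "i < m" for i
      using that by simp
    then show ?thesis
      using v by (intro eq_vecI) auto
  qed
  let ?\<theta> = "\<lambda>w. \<sigma> (lift w) *\<^sub>v v"
  have \<theta>: "?\<theta> (\<rho> a *\<^sub>v u) = \<sigma> a *\<^sub>v v" if "a \<in> K" for a
    using lift[of "\<rho> a *\<^sub>v u"] that u by (intro wd) auto
  have KI: "a \<in> K \<Longrightarrow> b \<in> K \<Longrightarrow> a + b \<in> K" "a \<in> K \<Longrightarrow> x * a \<in> K" for a b x
    using K unfolding left_ideal_def by auto
  have "\<exists>X\<in>carrier_mat m n. \<forall>w\<in>carrier_vec n. ?\<theta> w = X *\<^sub>v w"
  proof (rule linear_map_matrix)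
    fix w w' :: "'k vec" assume w: "w \<in> carrier_vec n" "w' \<in> carrier_vec n"
    then have "?\<theta> (\<rho> (lift w + lift w') *\<^sub>v u) = \<sigma> (lift w + lift w') *\<^sub>v v"
      using lift KI by (intro \<theta>) auto
    with lift w show "?\<theta> (w + w') = ?\<theta> w + ?\<theta> w'"
      using u v by (simp add: \<rho>.act_add \<sigma>.act_add)
  next
    fix c and w :: "'k vec" assume w: "w \<in> carrier_vec n"
    then have "?\<theta> (\<rho> (of_center (\<iota> c) * lift w) *\<^sub>v u) = \<sigma> (of_center (\<iota> c) * lift w) *\<^sub>v v"
      using lift KI by (intro \<theta>) auto
    with lift w show "?\<theta> (c \<cdot>\<^sub>v w) = c \<cdot>\<^sub>v ?\<theta> w"
      using u v by (simp add: \<rho>.act_mult \<sigma>.act_mult \<rho>.act_scalar \<sigma>.act_scalar)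
  qed (use v in simp)
  then obtain X where X: "X \<in> carrier_mat m n" "\<And>w. w \<in> carrier_vec n \<Longrightarrow> ?\<theta> w = X *\<^sub>v w" by blast
  have 1: "X *\<^sub>v (\<rho> a *\<^sub>v u) = \<sigma> a *\<^sub>v v" if "a \<in> K" for a
    using X(2)[of "\<rho> a *\<^sub>v u"] \<theta>[OF that] u by simp
  have 2: "X *\<^sub>v (\<rho> x *\<^sub>v w) = \<sigma> x *\<^sub>v (X *\<^sub>v w)" if w: "w \<in> carrier_vec n" for x w
  proof -
    obtain a where a: "a \<in> K" "w = \<rho> a *\<^sub>v u" using onto[OF w] by blast
    have "X *\<^sub>v (\<rho> x *\<^sub>v w) = X *\<^sub>v (\<rho> (x * a) *\<^sub>v u)" using a u by (simp add: \<rho>.act_mult)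
    also have "\<dots> = \<sigma> x *\<^sub>v (\<sigma> a *\<^sub>v v)" using 1 a KI v by (simp add: \<sigma>.act_mult)
    finally show ?thesis using a 1 by simp
  qed
  from X(1) 1 2 show ?thesis by blast
qed

locale irreducible_matrix_rep = matrix_rep +
  assumes irr: "irreducible_rep \<iota> \<rho>"
begin

lemma invariant_subspace:
  assumes "W \<subseteq> carrier_vec n" "0\<^sub>v n \<in> W" "\<And>v w. v \<in> W \<Longrightarrow> w \<in> W \<Longrightarrow> v + w \<in> W"
    "\<And>c v. v \<in> W \<Longrightarrow> c \<cdot>\<^sub>v v \<in> W" "\<And>x v. v \<in> W \<Longrightarrow> \<rho> x *\<^sub>v v \<in> W"
  shows "W = {0\<^sub>v n} \<or> W = carrier_vec n"
proof -
  obtain m where m: "representation \<iota> m \<rho>" and irr': "\<And>W. VectorSpace.subspace class_ring W (module_vec TYPE('a) m) \<and>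
          (\<forall>x. \<forall>v\<in>W. \<rho> x *\<^sub>v v \<in> W) \<Longrightarrow> W = {0\<^sub>v m} \<or> W = carrier_vec m"
    using irr unfolding irreducible_rep_def by blast
  have [simp]: "m = n" using rep_dim_eq[OF m] rep_dim_eq[OF rep] by simp
  have vs: "vectorspace (class_ring :: 'a ring) (module_vec TYPE('a) n)"
    using vec_vs .
  then have "VectorSpace.subspace class_ring W (module_vec TYPE('a) n) \<longleftrightarrow>
      submodule class_ring W (module_vec TYPE('a) n)"
    by (simp add: VectorSpace.subspace_def)
  with vectorspace.axioms(1)[OF vs] have "VectorSpace.subspace class_ring W (module_vec TYPE('a) n)"
    unfolding submodule_def
    using assms by (auto simp: module_vec_simps)
  with irr'[of W] assms show ?thesis by simp
qed

lemma left_ideal_onto: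
  assumes K: "left_ideal K" and u: "u \<in> carrier_vec n"
    and a: "a \<in> K" "\<rho> a *\<^sub>v u \<noteq> 0\<^sub>v n" and w: "w \<in> carrier_vec n"
  shows "\<exists>a\<in>K. \<rho> a *\<^sub>v u = w"
proof -
  let ?W = "{\<rho> a *\<^sub>v u | a. a \<in> K}"
  have K': "0 \<in> K" "a \<in> K \<Longrightarrow> b \<in> K \<Longrightarrow> a + b \<in> K" "a \<in> K \<Longrightarrow> x * a \<in> K" for a b x
    using K unfolding left_ideal_def by auto
  have "?W = {0\<^sub>v n} \<or> ?W = carrier_vec n"
  proof (rule invariant_subspace)
    show "?W \<subseteq> carrier_vec n" using u by auto
    have "0\<^sub>v n = \<rho> 0 *\<^sub>v u" using act_zero[OF u] by simp
    then show "0\<^sub>v n \<in> ?W" using K'(1) by blast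
  next
    fix v w assume "v \<in> ?W" "w \<in> ?W"
    then obtain a b where ab: "a \<in> K" "b \<in> K" "v = \<rho> a *\<^sub>v u" "w = \<rho> b *\<^sub>v u" by blast
    then have "v + w = \<rho> (a + b) *\<^sub>v u" using act_add[OF u] by simp
    with ab K'(2) show "v + w \<in> ?W" by blast
  next
    fix c v assume "v \<in> ?W"
    then obtain a where a: "a \<in> K" "v = \<rho> a *\<^sub>v u" by blast
    then have "c \<cdot>\<^sub>v v = \<rho> (of_center (\<iota> c) * a) *\<^sub>v u"
      using act_mult[OF u] act_scalar u by simp
    with a K'(3) show "c \<cdot>\<^sub>v v \<in> ?W" by blast
  next
    fix x v assume "v \<in> ?W"
    then obtain a where a: "a \<in> K" "v = \<rho> a *\<^sub>v u" by blast
    then have "\<rho> x *\<^sub>v v = \<rho> (x * a) *\<^sub>v u" using act_mult[OF u] by simp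
    with a K'(3) show "\<rho> x *\<^sub>v v \<in> ?W" by blast
  qed
  moreover have "\<rho> a *\<^sub>v u \<in> ?W" using a by blast
  ultimately have "?W = carrier_vec n" using a by auto
  with w have "w \<in> ?W" by simp
  then show ?thesis by blast
qed

lemma orbit:
  assumes "u \<in> carrier_vec n" "u \<noteq> 0\<^sub>v n" "w \<in> carrier_vec n"
  shows "\<exists>a. \<rho> a *\<^sub>v u = w"
  using left_ideal_onto[of UNIV u 1 w] assms by (auto simp: left_ideal_def act_one)

text \<open>By irreducibility some \<open>a\<close> carries the image of \<open>y\<close> to a
  vector that \<open>x\<close> does not kill. Primeness of kernels is what later separates the
  members of a fiber.\<close>

lemma prime_kernel:
  assumes "\<rho> x \<noteq> 0\<^sub>m n n" "\<rho> y \<noteq> 0\<^sub>m n n"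
  shows "\<exists>a. \<rho> (x * a * y) \<noteq> 0\<^sub>m n n"
proof -
  obtain v w where vw: "v \<in> carrier_vec n" "\<rho> y *\<^sub>v v \<noteq> 0\<^sub>v n" "w \<in> carrier_vec n" "\<rho> x *\<^sub>v w \<noteq> 0\<^sub>v n"
    using assms nonzero_act by blast
  then obtain a where "\<rho> a *\<^sub>v (\<rho> y *\<^sub>v v) = w" using orbit[of "\<rho> y *\<^sub>v v" w] by auto
  then have "\<rho> (x * a * y) *\<^sub>v v \<noteq> 0\<^sub>v n" using vw by (simp add: act_mult)
  then show ?thesis using vw by (intro exI[of _ a]) auto
qed

end

section \<open>Schur's lemma, density and Burnside's theorem\<close>

locale alg_closed_irrep = irreducible_matrix_rep \<iota> n \<rho>
  for \<iota> :: "'k::alg_closed_field \<Rightarrow> 'r::ring_1 center" and n \<rho>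
begin

lemma schur:
  assumes T: "T \<in> carrier_mat n n"
    and comm: "\<And>x w. w \<in> carrier_vec n \<Longrightarrow> T *\<^sub>v (\<rho> x *\<^sub>v w) = \<rho> x *\<^sub>v (T *\<^sub>v w)"
  shows "\<exists>c. \<forall>w\<in>carrier_vec n. T *\<^sub>v w = c \<cdot>\<^sub>v w"
proof -
  have "degree (char_poly T) > 0" using degree_monic_char_poly[OF T] dim_pos by simp
  then obtain c where "poly (char_poly T) c = 0" using alg_closed_imp_poly_has_root by blast
  then obtain v where v: "v \<in> carrier_vec n" "v \<noteq> 0\<^sub>v n" "T *\<^sub>v v = c \<cdot>\<^sub>v v"
    using eigenvalue_root_char_poly[OF T] T unfolding eigenvalue_def eigenvector_def by auto
  let ?W = "{w \<in> carrier_vec n. T *\<^sub>v w = c \<cdot>\<^sub>v w}"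
  have "?W = {0\<^sub>v n} \<or> ?W = carrier_vec n"
  proof (rule invariant_subspace)
    show "\<rho> x *\<^sub>v w \<in> ?W" if "w \<in> ?W" for x w
      using that comm mult_mat_vec[OF carrier] by auto
    show "a \<cdot>\<^sub>v w \<in> ?W" if "w \<in> ?W" for a w
      using that mult_mat_vec[OF T] by (auto simp: smult_smult_assoc mult.commute)
    show "w + w' \<in> ?W" if "w \<in> ?W" "w' \<in> ?W" for w w'
      using that by (auto simp: mult_add_distrib_mat_vec[OF T] smult_add_distrib_vec[of _ n])
    show "0\<^sub>v n \<in> ?W" using T by (auto intro!: eq_vecI)
  qed auto
  with v have "?W = carrier_vec n" by blast
  then show ?thesis by blast
qed

text \<open>
  Jacobson density for subsets \<open>Y\<close> of the standard basis, by induction on \<open>Y\<close>: the elements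
  killing \<open>Y - {y}\<close> form a left ideal, and if they kill \<open>v\<close> as soon as they kill \<open>e\<^sub>y\<close>, then
  \<open>a e\<^sub>y \<mapsto> a v\<close> is an endomorphism, hence a scalar.
\<close>

lemma basis_density:
  assumes "finite Y" "Y \<subseteq> {..<n}" "v \<in> carrier_vec n"
    and "\<And>a. \<forall>y\<in>Y. \<rho> a *\<^sub>v unit_vec n y = 0\<^sub>v n \<Longrightarrow> \<rho> a *\<^sub>v v = 0\<^sub>v n"
    and "i < n" "i \<notin> Y"
  shows "v $ i = 0"
  using assms
proof (induction Y arbitrary: v i rule: finite_induct)
  case empty
  then have "v = 0\<^sub>v n" using act_one by force
  with empty show ?case by simp
next
  case (insert y Y)
  let ?K = "{a. \<forall>y\<in>Y. \<rho> a *\<^sub>v unit_vec n y = 0\<^sub>v n}"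
  have K: "left_ideal ?K"
    unfolding left_ideal_def
  proof (intro conjI ballI allI)
    show "0 \<in> ?K" by (simp add: act_zero)
    show "a + b \<in> ?K" if "a \<in> ?K" "b \<in> ?K" for a b using that by (simp add: act_add)
    show "x * a \<in> ?K" if "a \<in> ?K" for x a using that
      by (auto simp: act_mult intro!: eq_vecI)
  qed
  note v = insert.prems(2) and kill = insert.prems(3)
  have e: "unit_vec n y \<in> carrier_vec n" by simp
  show ?case
  proof (cases "\<exists>a\<in>?K. \<rho> a *\<^sub>v unit_vec n y \<noteq> 0\<^sub>v n")
    case False
    show ?thesis
    proof (rule insert.IH)
      fix a assume "\<forall>y\<in>Y. \<rho> a *\<^sub>v unit_vec n y = 0\<^sub>v n"
      with False show "\<rho> a *\<^sub>v v = 0\<^sub>v n" by (intro kill) auto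
    qed (use insert.prems in auto)
  next
    case True
    then obtain a0 where a0: "a0 \<in> ?K" "\<rho> a0 *\<^sub>v unit_vec n y \<noteq> 0\<^sub>v n" by blast
    have "\<exists>X\<in>carrier_mat n n. (\<forall>a\<in>?K. X *\<^sub>v (\<rho> a *\<^sub>v unit_vec n y) = \<rho> a *\<^sub>v v) \<and>
      (\<forall>x. \<forall>w\<in>carrier_vec n. X *\<^sub>v (\<rho> x *\<^sub>v w) = \<rho> x *\<^sub>v (X *\<^sub>v w))"
    proof (rule intertwiner_exists[OF rep rep K e v])
      show "\<exists>a\<in>?K. \<rho> a *\<^sub>v unit_vec n y = w" if "w \<in> carrier_vec n" for w
        by (rule left_ideal_onto[OF K e a0 that])
      show "\<rho> a *\<^sub>v v = 0\<^sub>v n" if "a \<in> ?K" "\<rho> a *\<^sub>v unit_vec n y = 0\<^sub>v n" for a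
        using that by (intro kill) auto
    qed
    then obtain X where X: "X \<in> carrier_mat n n" "\<And>a. a \<in> ?K \<Longrightarrow> X *\<^sub>v (\<rho> a *\<^sub>v unit_vec n y) = \<rho> a *\<^sub>v v"
      "\<And>x w. w \<in> carrier_vec n \<Longrightarrow> X *\<^sub>v (\<rho> x *\<^sub>v w) = \<rho> x *\<^sub>v (X *\<^sub>v w)" by blast
    from schur[OF X(1,3)] obtain c where c: "\<And>w. w \<in> carrier_vec n \<Longrightarrow> X *\<^sub>v w = c \<cdot>\<^sub>v w" by blast
    \<comment> \<open>\<open>i\<close> differs from \<open>y\<close>, so subtracting a multiple of
      that basis vector leaves coordinate \<open>i\<close> unchanged.\<close>
    let ?v = "v - c \<cdot>\<^sub>v unit_vec n y"
    have "?v $ i = 0"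
    proof (rule insert.IH)
      fix a assume a: "\<forall>y\<in>Y. \<rho> a *\<^sub>v unit_vec n y = 0\<^sub>v n"
      then have "\<rho> a *\<^sub>v v = c \<cdot>\<^sub>v (\<rho> a *\<^sub>v unit_vec n y)"
        using X(2)[of a] c[of "\<rho> a *\<^sub>v unit_vec n y"] by simp
      then show "\<rho> a *\<^sub>v ?v = 0\<^sub>v n"
        using v by (simp add: mult_minus_distrib_mat_vec[OF carrier] mult_mat_vec[OF carrier])
    qed (use insert.prems in auto)
    with insert.prems show ?thesis by (auto simp: unit_vec_def)
  qed
qed

text \<open>For each \<open>j\<close>, density provides an element that kills all other basis
  vectors but not the one at \<open>j\<close>; a further element moves the surviving image to column
  \<open>j\<close> of \<open>M\<close>, and the products are added up.\<close>

lemma burnside: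
  assumes M: "M \<in> carrier_mat n n"
  shows "\<exists>x. \<rho> x = M"
proof -
  have "\<exists>x. \<forall>i<n. \<rho> x *\<^sub>v unit_vec n i = (if i = j then col M j else 0\<^sub>v n)" if j: "j < n" for j
  proof -
    have "\<exists>a. (\<forall>i\<in>{..<n} - {j}. \<rho> a *\<^sub>v unit_vec n i = 0\<^sub>v n) \<and> \<rho> a *\<^sub>v unit_vec n j \<noteq> 0\<^sub>v n"
    proof (rule ccontr)
      assume "\<not> ?thesis"
      then have "unit_vec n j $ j = (0 :: 'k)"
        using j by (intro basis_density[of "{..<n} - {j}"]) auto
      with j show False by simp
    qed
    then obtain a where a: "\<And>i. i < n \<Longrightarrow> i \<noteq> j \<Longrightarrow> \<rho> a *\<^sub>v unit_vec n i = 0\<^sub>v n"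
      "\<rho> a *\<^sub>v unit_vec n j \<noteq> 0\<^sub>v n" by blast
    then obtain b where b: "\<rho> b *\<^sub>v (\<rho> a *\<^sub>v unit_vec n j) = col M j"
      using orbit[of "\<rho> a *\<^sub>v unit_vec n j" "col M j"] M j by auto
    have "\<rho> (b * a) *\<^sub>v unit_vec n i = (if i = j then col M j else 0\<^sub>v n)" if "i < n" for i
      using a b that by (auto simp: act_mult intro!: eq_vecI)
    then show ?thesis by blast
  qed
  then obtain x where x: "\<And>j i. j < n \<Longrightarrow> i < n \<Longrightarrow>
    \<rho> (x j) *\<^sub>v unit_vec n i = (if i = j then col M j else 0\<^sub>v n)" by metis
  have "\<rho> (\<Sum>j<n. x j) = M"
  proof (rule mat_eq_if_action_eq[OF carrier M])
    fix i assume i: "i < n"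
    show "\<rho> (\<Sum>j<n. x j) *\<^sub>v unit_vec n i = M *\<^sub>v unit_vec n i"
    proof (rule eq_vecI)
      fix l assume "l < dim_vec (M *\<^sub>v unit_vec n i)"
      then have l: "l < n" using M by simp
      have "(\<rho> (\<Sum>j<n. x j) *\<^sub>v unit_vec n i) $ l = (\<Sum>j<n. (\<rho> (x j) *\<^sub>v unit_vec n i) $ l)"
        using l by (intro act_sum) auto
      also have "\<dots> = (\<Sum>j<n. if i = j then col M i $ l else 0)"
        using x i l by (intro sum.cong) auto
      also have "\<dots> = (M *\<^sub>v unit_vec n i) $ l" using i M by (simp add: mat_unit_vec_col[OF M])
      finally show "(\<rho> (\<Sum>j<n. x j) *\<^sub>v unit_vec n i) $ l = (M *\<^sub>v unit_vec n i) $ l" .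
    qed (use M in simp)
  qed
  then show ?thesis ..
qed

lemma center_acts_by_scalars: "\<exists>\<phi>. \<forall>z. \<rho> (of_center z) = \<phi> z \<cdot>\<^sub>m 1\<^sub>m n"
proof -
  have "\<exists>c. \<rho> (of_center z) = c \<cdot>\<^sub>m 1\<^sub>m n" for z
  proof -
    have "\<rho> (of_center z) *\<^sub>v (\<rho> x *\<^sub>v w) = \<rho> x *\<^sub>v (\<rho> (of_center z) *\<^sub>v w)"
      if "w \<in> carrier_vec n" for x w
      using that act_mult[OF that, of "of_center z" x] act_mult[OF that, of x "of_center z"]
      by (simp add: of_center_commute)
    from schur[OF carrier this] obtain c where
      c: "\<And>w. w \<in> carrier_vec n \<Longrightarrow> \<rho> (of_center z) *\<^sub>v w = c \<cdot>\<^sub>v w" by blast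
    have "\<rho> (of_center z) = c \<cdot>\<^sub>m 1\<^sub>m n"
      by (rule mat_eq_if_action_eq[OF carrier])
        (use c in \<open>auto simp: smult_mat_vec[of _ n n]\<close>)
    then show ?thesis ..
  qed
  then show ?thesis by metis
qed

text \<open>Since \<open>n\<close> is positive, the entry at (0, 0) recovers \<open>\<phi>\<close>
  from \<open>\<rho>\<close>; this yields the ring laws and the uniqueness required by the definite
  description in \<open>central_character\<close>.\<close>

lemma central_character_eqI:
  assumes \<phi>: "\<And>z. \<rho> (of_center z) = \<phi> z \<cdot>\<^sub>m 1\<^sub>m n"
  shows "\<phi> \<in> center_homs \<iota>" "central_character \<iota> \<rho> = \<phi>"
proof -
  have entry: "\<rho> (of_center z) $$ (0, 0) = \<phi> z" for z
    using \<phi> dim_pos by simp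
  show hom: "\<phi> \<in> center_homs \<iota>"
    unfolding center_homs_def
  proof (intro CollectI conjI allI)
    show "comm_ring_hom \<phi>"
    proof
      fix x y
      show "\<phi> (x + y) = \<phi> x + \<phi> y"
        using dim_pos by (simp flip: entry add: plus_center.rep_eq add)
      show "\<phi> (x * y) = \<phi> x * \<phi> y"
      proof -
        have "\<rho> (of_center (x * y)) = (\<phi> x \<cdot>\<^sub>m 1\<^sub>m n) * (\<phi> y \<cdot>\<^sub>m 1\<^sub>m n)"
          by (simp add: times_center.rep_eq mult \<phi>)
        also have "\<dots> = (\<phi> x * \<phi> y) \<cdot>\<^sub>m 1\<^sub>m n"
          by (simp add: mult_smult_distrib[of _ n n _ n] mult_smult_assoc_mat[of _ n n _ n])
            (auto intro!: eq_matI)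
        finally show ?thesis using entry[of "x * y"] dim_pos by simp
      qed
      show "\<phi> 1 = 1" using dim_pos by (simp flip: entry add: one_center.rep_eq one)
      show "\<phi> 0 = 0" using dim_pos by (simp flip: entry add: zero_center.rep_eq zero)
    qed
    fix c show "\<phi> (\<iota> c) = c" using dim_pos by (simp flip: entry add: scalar)
  qed
  have [simp]: "rep_dim \<rho> = n" using rep_dim_eq[OF rep] .
  show "central_character \<iota> \<rho> = \<phi>"
    unfolding central_character_def
  proof (rule the_equality)
    show "\<phi> \<in> center_homs \<iota> \<and> (\<forall>z. \<rho> (of_center z) = \<phi> z \<cdot>\<^sub>m 1\<^sub>m (rep_dim \<rho>))"
      using hom \<phi> by simp
    show "\<psi> = \<phi>" if "\<psi> \<in> center_homs \<iota> \<and> (\<forall>z. \<rho> (of_center z) = \<psi> z \<cdot>\<^sub>m 1\<^sub>m (rep_dim \<rho>))" for \<psi>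
      using that dim_pos by (auto simp flip: entry)
  qed
qed

lemma central_character:
  shows "central_character \<iota> \<rho> \<in> center_homs \<iota>"
    and "\<rho> (of_center z) = central_character \<iota> \<rho> z \<cdot>\<^sub>m 1\<^sub>m n"
  using center_acts_by_scalars central_character_eqI by metis+

lemma rep_center_mult: "\<rho> (of_center z * x) = central_character \<iota> \<rho> z \<cdot>\<^sub>m \<rho> x"
  by (simp add: mult central_character mult_smult_assoc_mat[OF one_carrier_mat carrier]
      left_mult_one_mat[OF carrier])

end

section \<open>Equivalence of representations with nested kernels\<close>

lemma alg_closed_irrepI:
  "irreducible_rep \<iota> \<rho> \<Longrightarrow> alg_closed_irrep \<iota> (rep_dim \<rho>) \<rho>"
proof -
  assume irr: "irreducible_rep \<iota> \<rho>"
  then obtain n where n: "representation \<iota> n \<rho>" unfolding irreducible_rep_def by blast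
  with irr show ?thesis by unfold_locales (simp_all add: rep_dim_eq)
qed

text \<open>The quotient by the kernel of \<open>\<rho>\<close> is a full matrix algebra, which is
  simple, so inclusion is already equality. Concretely, lifts of the diagonal idempotents cannot all
  die under \<open>\<sigma>\<close>. If the one at \<open>i\<close> survives with a nonzero image
  vector \<open>?v\<close>, then \<open>ker1\<close> and \<open>ker2\<close> say that
  \<open>?e\<close> and \<open>?v\<close> have the same annihilator, and matching their orbits gives
  mutually inverse intertwiners.\<close>

lemma rep_equiv_if_kernel_subset:
  fixes \<iota> :: "'k::alg_closed_field \<Rightarrow> 'r::ring_1 center"
  assumes "alg_closed_irrep \<iota> n \<rho>" "alg_closed_irrep \<iota> m \<sigma>"
    and ker: "\<And>x. \<rho> x = 0\<^sub>m n n \<Longrightarrow> \<sigma> x = 0\<^sub>m m m"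
  shows "(\<rho>, \<sigma>) \<in> rep_equiv \<iota>"
proof -
  interpret \<rho>: alg_closed_irrep \<iota> n \<rho> by fact
  interpret \<sigma>: alg_closed_irrep \<iota> m \<sigma> by fact
  let ?E = "\<lambda>i. mat n n (\<lambda>(a, b). if a = i \<and> b = i then 1 else 0)"
  have "\<exists>x. \<rho> x = ?E i" for i by (rule \<rho>.burnside) simp
  then obtain x where x: "\<And>i. \<rho> (x i) = ?E i" by metis
  have xe: "\<rho> (x i) *\<^sub>v unit_vec n j = (if i = j then unit_vec n i else 0\<^sub>v n)" if "j < n" for i j
    unfolding x mat_unit_vec_col[OF mat_carrier that] using that by (auto intro!: eq_vecI)
  have "\<exists>i<n. \<sigma> (x i) \<noteq> 0\<^sub>m m m"
  proof (rule ccontr)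
    assume neg: "\<not> ?thesis"
    \<comment> \<open>The lifted idempotents sum to 1 modulo the kernel of \<open>\<rho>\<close>,
      hence modulo that of \<open>\<sigma>\<close>.\<close>
    have "\<rho> (1 - (\<Sum>i<n. x i)) = 0\<^sub>m n n"
    proof (rule mat_eq_if_action_eq[of _ n n])
      fix j assume j: "j < n"
      have "\<rho> (\<Sum>i<n. x i) *\<^sub>v unit_vec n j = unit_vec n j"
      proof (rule eq_vecI)
        fix l assume "l < dim_vec (unit_vec n j :: 'k vec)"
        then have l: "l < n" by simp
        have "(\<rho> (\<Sum>i<n. x i) *\<^sub>v unit_vec n j) $ l = (\<Sum>i<n. (\<rho> (x i) *\<^sub>v unit_vec n j) $ l)"
          using l by (intro \<rho>.act_sum) auto
        also have "\<dots> = (\<Sum>i<n. if i = j then unit_vec n j $ l else 0)"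
          using j l by (intro sum.cong) (auto simp: xe)
        finally show "(\<rho> (\<Sum>i<n. x i) *\<^sub>v unit_vec n j) $ l = unit_vec n j $ l"
          using j by simp
      qed simp
      then show "\<rho> (1 - (\<Sum>i<n. x i)) *\<^sub>v unit_vec n j = 0\<^sub>m n n *\<^sub>v unit_vec n j"
        by (auto simp: \<rho>.act_diff \<rho>.act_one intro!: eq_vecI)
    qed simp_all
    then have 1: "\<sigma> (1 - (\<Sum>i<n. x i)) = 0\<^sub>m m m" by (rule ker)
    have "\<sigma> (\<Sum>i<n. x i) $$ (0, 0) = 0"
      using neg \<sigma>.dim_pos by (subst \<sigma>.sum) (auto intro!: sum.neutral)
    moreover have "\<sigma> 1 = \<sigma> (1 - (\<Sum>i<n. x i)) + \<sigma> (\<Sum>i<n. x i)" by (simp flip: \<sigma>.add)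
    ultimately have "\<sigma> 1 $$ (0, 0) = 0" using 1 \<sigma>.dim_pos by simp
    then show False using \<sigma>.dim_pos by (simp add: \<sigma>.one)
  qed
  then obtain i where i: "i < n" "\<sigma> (x i) \<noteq> 0\<^sub>m m m" by blast
  then obtain v0 where v0: "v0 \<in> carrier_vec m" "\<sigma> (x i) *\<^sub>v v0 \<noteq> 0\<^sub>v m" using \<sigma>.nonzero_act by blast
  let ?v = "\<sigma> (x i) *\<^sub>v v0" and ?e = "unit_vec n i"
  have v: "?v \<in> carrier_vec m" using v0 by simp
  have e: "?e \<in> carrier_vec n" "?e \<noteq> (0\<^sub>v n :: 'k vec)" using i by simp_all
  have U: "left_ideal UNIV" by (simp add: left_ideal_def)
  have ker1: "\<sigma> a *\<^sub>v ?v = 0\<^sub>v m" if a: "\<rho> a *\<^sub>v ?e = 0\<^sub>v n" for a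
  proof -
    \<comment> \<open>\<open>x i\<close> acts as the projection to the line of \<open>?e\<close>, so
      an \<open>a\<close> that kills \<open>?e\<close> gives a product in the kernel of
      \<open>\<rho>\<close>, hence of \<open>\<sigma>\<close>.\<close>
    have "\<rho> (a * x i) = 0\<^sub>m n n"
    proof (rule mat_eq_if_action_eq[of _ n n])
      fix j assume j: "j < n"
      show "\<rho> (a * x i) *\<^sub>v unit_vec n j = 0\<^sub>m n n *\<^sub>v unit_vec n j"
        using a xe[OF j, of i] by (auto simp: \<rho>.act_mult intro!: eq_vecI)
    qed simp_all
    then have "\<sigma> (a * x i) *\<^sub>v v0 = 0\<^sub>v m" using ker v0 by (auto intro!: eq_vecI)
    then show ?thesis using v0 by (simp add: \<sigma>.act_mult)
  qed
  have "\<exists>X\<in>carrier_mat m n. (\<forall>a\<in>UNIV. X *\<^sub>v (\<rho> a *\<^sub>v ?e) = \<sigma> a *\<^sub>v ?v) \<and>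
    (\<forall>x. \<forall>w\<in>carrier_vec n. X *\<^sub>v (\<rho> x *\<^sub>v w) = \<sigma> x *\<^sub>v (X *\<^sub>v w))"
    using \<rho>.orbit[OF e] by (intro intertwiner_exists[OF \<rho>.rep \<sigma>.rep U e(1) v] ker1) auto
  then obtain X where X: "X \<in> carrier_mat m n" "\<And>a. X *\<^sub>v (\<rho> a *\<^sub>v ?e) = \<sigma> a *\<^sub>v ?v"
    "\<And>x w. w \<in> carrier_vec n \<Longrightarrow> X *\<^sub>v (\<rho> x *\<^sub>v w) = \<sigma> x *\<^sub>v (X *\<^sub>v w)" by blast
  have ker2: "\<rho> a *\<^sub>v ?e = 0\<^sub>v n" if a: "\<sigma> a *\<^sub>v ?v = 0\<^sub>v m" for a
  proof (rule ccontr)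
    assume nz: "\<rho> a *\<^sub>v ?e \<noteq> 0\<^sub>v n"
    obtain b where b: "\<rho> b *\<^sub>v (\<rho> a *\<^sub>v ?e) = ?e" using \<rho>.orbit[OF _ nz e(1)] e by auto
    have "?v = X *\<^sub>v (\<rho> 1 *\<^sub>v ?e)" using X(2)[of 1] v \<sigma>.act_one[OF v] by simp
    also have "\<dots> = X *\<^sub>v (\<rho> (b * a) *\<^sub>v ?e)" using b e by (simp add: \<rho>.act_one \<rho>.act_mult)
    also have "\<dots> = \<sigma> b *\<^sub>v (\<sigma> a *\<^sub>v ?v)" using X(2)[of "b * a"] v by (simp add: \<sigma>.act_mult)
    also have "\<dots> = 0\<^sub>v m" using a by (auto intro!: eq_vecI)
    finally show False using v0 by simp
  qed
  have "\<exists>Y\<in>carrier_mat n m. (\<forall>a\<in>UNIV. Y *\<^sub>v (\<sigma> a *\<^sub>v ?v) = \<rho> a *\<^sub>v ?e) \<and>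
    (\<forall>x. \<forall>w\<in>carrier_vec m. Y *\<^sub>v (\<sigma> x *\<^sub>v w) = \<rho> x *\<^sub>v (Y *\<^sub>v w))"
    using \<sigma>.orbit[OF v v0(2)] by (intro intertwiner_exists[OF \<sigma>.rep \<rho>.rep U v e(1)] ker2) auto
  then obtain Y where Y: "Y \<in> carrier_mat n m" "\<And>a. Y *\<^sub>v (\<sigma> a *\<^sub>v ?v) = \<rho> a *\<^sub>v ?e" by blast
  have YX: "Y *\<^sub>v (X *\<^sub>v w) = w" if w: "w \<in> carrier_vec n" for w
    using \<rho>.orbit[OF e w] X(2) Y(2) by auto
  have XY: "X *\<^sub>v (Y *\<^sub>v w) = w" if w: "w \<in> carrier_vec m" for w
    using \<sigma>.orbit[OF v v0(2) w] X(2) Y(2) by auto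
  have Y0: "Y *\<^sub>v 0\<^sub>v m = 0\<^sub>v n" and X0: "X *\<^sub>v 0\<^sub>v n = 0\<^sub>v m"
    using X Y by (auto intro!: eq_vecI)
  have "n \<le> m" by (rule injective_mat_dim_le[OF X(1)]) (metis YX Y0)
  moreover have "m \<le> n" by (rule injective_mat_dim_le[OF Y(1)]) (metis XY X0)
  ultimately have mn: "m = n" by simp
  note X = X[unfolded mn] and Y = Y[unfolded mn] and XY = XY[unfolded mn] and YX = YX[unfolded mn]
  have "Y * X = 1\<^sub>m n" "X * Y = 1\<^sub>m n"
    by (rule mat_eq_if_action_eq[of _ n n]; use X(1) Y(1) XY YX in \<open>simp add: assoc_mult_mat_vec[of _ n n]\<close>)+
  moreover have "\<rho> a = Y * \<sigma> a * X" for a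
  proof (rule mat_eq_if_action_eq[of _ n n])
    have s: "\<sigma> a \<in> carrier_mat n n" using \<sigma>.carrier[of a] mn by simp
    then show "Y * \<sigma> a * X \<in> carrier_mat n n" using X Y by simp
    fix j assume "j < n"
    have "(Y * \<sigma> a * X) *\<^sub>v unit_vec n j = Y *\<^sub>v (\<sigma> a *\<^sub>v (X *\<^sub>v unit_vec n j))"
      using s X(1) Y(1) by (simp add: assoc_mult_mat_vec[of _ n n _ n])
    also have "\<dots> = \<rho> a *\<^sub>v unit_vec n j"
      using X(3)[of "unit_vec n j" a] YX[of "\<rho> a *\<^sub>v unit_vec n j"] by simp
    finally show "\<rho> a *\<^sub>v unit_vec n j = (Y * \<sigma> a * X) *\<^sub>v unit_vec n j" by simp
  qed simp
  moreover have "\<sigma> a \<in> carrier_mat n n" for a using \<sigma>.carrier[of a] mn by simp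
  ultimately have "similar_mat_wit (\<rho> a) (\<sigma> a) Y X" for a
    using X(1) Y(1) \<rho>.carrier[of a] unfolding similar_mat_wit_def Let_def by simp
  then show ?thesis
    unfolding rep_equiv_def using \<rho>.irr \<sigma>.irr by blast
qed

section \<open>Simple quotients\<close>

lemma left_idealD:
  assumes "left_ideal K"
  shows "0 \<in> K" "a \<in> K \<Longrightarrow> b \<in> K \<Longrightarrow> a + b \<in> K" "a \<in> K \<Longrightarrow> x * a \<in> K"
    "a \<in> K \<Longrightarrow> b \<in> K \<Longrightarrow> a - b \<in> K"
  using assms left_ideal_diff[OF assms] unfolding left_ideal_def by auto

lemma left_ideal_sum: "left_ideal K \<Longrightarrow> (\<And>i. i \<in> I \<Longrightarrow> f i \<in> K) \<Longrightarrow> sum f I \<in> K"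
  by (induction I rule: infinite_finite_induct) (auto simp: left_ideal_def)

lemma of_center_simps:
  "of_center 0 = 0" "of_center 1 = 1" "of_center (a + b) = of_center a + of_center b"
  "of_center (a - b) = of_center a - of_center b" "of_center (a * b) = of_center a * of_center b"
  "of_center (- a) = - of_center a"
  by (simp_all add: zero_center.rep_eq one_center.rep_eq plus_center.rep_eq minus_center.rep_eq
      times_center.rep_eq uminus_center.rep_eq)

lemma of_center_left_commute: "x * (of_center z * y) = of_center z * (x * y)"
  using of_center_commute[of z x] by (simp flip: mult.assoc)

text \<open>The simple module \<open>R / L\<close> is realized by coordinates: \<open>B\<close> is a
  basis modulo \<open>L\<close>, \<open>\<pi>\<close> reads off coordinates, and
  \<open>\<rho> x\<close> is left multiplication by \<open>x\<close>. An invariant subspace pulls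
  back along \<open>\<pi>\<close> to a left ideal above \<open>L\<close>, so maximality leaves two
  choices. The last clause turns congruences modulo \<open>L\<close> into scalar action; for central
  \<open>x\<close> it identifies the central character.\<close>

lemma irreducible_rep_from_maximal_left_ideal:
  fixes \<iota> :: "'k::field \<Rightarrow> 'r::ring_1 center"
  assumes \<iota>: "comm_ring_hom \<iota>" and L: "left_ideal L" "1 \<notin> L"
    and max: "\<And>J. left_ideal J \<Longrightarrow> L \<subseteq> J \<Longrightarrow> 1 \<notin> J \<Longrightarrow> J = L"
    and G: "finite G" "\<And>x. \<exists>l. x - (\<Sum>g\<in>G. of_center (\<iota> (l g)) * g) \<in> L"
  shows "\<exists>\<rho>. irreducible_rep \<iota> \<rho> \<and>
    (\<forall>x c. (\<forall>y. x * y - of_center (\<iota> c) * y \<in> L) \<longrightarrow> \<rho> x = c \<cdot>\<^sub>m 1\<^sub>m (rep_dim \<rho>))"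
proof -
  interpret \<iota>: comm_ring_hom \<iota> by fact
  note LI = left_idealD[OF L(1)]
  define k where "k c = of_center (\<iota> c)" for c
  have k: "k (a + b) = k a + k b" "k (a * b) = k a * k b" "k 1 = 1" "k 0 = 0" "k (- a) = - k a"
    "k (a - b) = k a - k b" for a b
    by (simp_all add: k_def \<iota>.hom_add \<iota>.hom_mult \<iota>.hom_uminus \<iota>.hom_minus of_center_simps)
  have k_comm: "x * (k a * y) = k a * (x * y)" for a x y
    unfolding k_def by (rule of_center_left_commute)
  \<comment> \<open>A spanning subset of least size modulo \<open>L\<close> is independent, since a
    relation with \<open>l b\<close> nonzero would allow \<open>b\<close> to be dropped.\<close>
  let ?spans = "\<lambda>B. B \<subseteq> G \<and> (\<forall>x. \<exists>l. x - (\<Sum>g\<in>B. k (l g) * g) \<in> L)"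
  have "?spans G" using G unfolding k_def by simp
  then obtain B where B: "?spans B" and Bmin: "\<And>B'. ?spans B' \<Longrightarrow> card B \<le> card B'"
    using arg_min_nat_lemma[of ?spans G card] by blast
  have fB: "finite B" using B G finite_subset by blast
  have indep: "l b = 0" if l: "(\<Sum>g\<in>B. k (l g) * g) \<in> L" and b: "b \<in> B" for l b
  proof (rule ccontr)
    assume lb: "l b \<noteq> 0"
    have "?spans (B - {b})"
    proof (intro conjI allI)
      fix x
      obtain l' where l': "x - (\<Sum>g\<in>B. k (l' g) * g) \<in> L" using B by blast
      \<comment> \<open>Subtracting \<open>?q\<close> times the relation cancels the coefficient of
        \<open>b\<close>.\<close>
      let ?q = "l' b / l b"
      let ?l = "\<lambda>g. l' g - ?q * l g"
      have "(\<Sum>g\<in>B. k (?l g) * g) = (\<Sum>g\<in>B. k (l' g) * g) - k ?q * (\<Sum>g\<in>B. k (l g) * g)"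
        by (simp only: k left_diff_distrib sum_subtractf sum_distrib_left mult.assoc)
      moreover have "(\<Sum>g\<in>B. k (?l g) * g) = (\<Sum>g\<in>B - {b}. k (?l g) * g)"
        using fB b lb by (simp add: sum.remove[of B b] k)
      ultimately have eq: "(\<Sum>g\<in>B - {b}. k (?l g) * g) = (\<Sum>g\<in>B. k (l' g) * g) - k ?q * (\<Sum>g\<in>B. k (l g) * g)"
        by (simp only:)
      have "u - (v - w) = (u - v) + w" for u v w :: 'r by (simp add: algebra_simps)
      then have "x - (\<Sum>g\<in>B - {b}. k (?l g) * g)
          = (x - (\<Sum>g\<in>B. k (l' g) * g)) + k ?q * (\<Sum>g\<in>B. k (l g) * g)" unfolding eq .
      also have "\<dots> \<in> L" using l' l LI by blast
      finally have "x - (\<Sum>g\<in>B - {b}. k (?l g) * g) \<in> L" .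
      then show "\<exists>l. x - (\<Sum>g\<in>B - {b}. k (l g) * g) \<in> L" by (intro exI[of _ ?l])
    qed (use B in auto)
    then have "card B \<le> card (B - {b})" by (rule Bmin)
    with fB b show False by (metis card_Diff1_less linorder_not_less)
  qed
  define n where "n = card B"
  obtain e where e: "bij_betw e {..<n} B"
    using ex_bij_betw_nat_finite[OF fB] unfolding n_def by (auto simp: atLeast0LessThan)
  define lin where "lin v = (\<Sum>i<n. k (v $ i) * e i)" for v
  have lin_add: "lin (v + w) = lin v + lin w" if "v \<in> carrier_vec n" "w \<in> carrier_vec n" for v w
    using that by (simp add: lin_def k distrib_right sum.distrib)
  have lin_smult: "lin (c \<cdot>\<^sub>v v) = k c * lin v" if "v \<in> carrier_vec n" for c v
    using that by (simp add: lin_def k sum_distrib_left mult.assoc)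
  have lin_B: "(\<Sum>g\<in>B. k (l g) * g) = lin (vec n (\<lambda>i. l (e i)))" for l
    unfolding lin_def by (subst sum.reindex_bij_betw[OF e, symmetric]) simp
  have ex: "\<exists>v. v \<in> carrier_vec n \<and> x - lin v \<in> L" for x
    using B lin_B by (metis vec_carrier)
  have lin_L: "v = 0\<^sub>v n" if v: "v \<in> carrier_vec n" "lin v \<in> L" for v
  proof (rule eq_vecI)
    let ?l = "\<lambda>g. v $ (inv_into {..<n} e g)"
    have "vec n (\<lambda>i. ?l (e i)) = v"
      using v e by (intro eq_vecI) (auto simp: bij_betw_def)
    then have "?l b = 0" if "b \<in> B" for b
      using indep[of ?l, OF _ that] v lin_B by simp
    then show "v $ i = 0\<^sub>v n $ i" if "i < dim_vec (0\<^sub>v n)" for i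
      using that e by (metis bij_betw_apply bij_betw_inv_into_left index_zero_vec lessThan_iff)
  qed (use v in simp)
  define \<pi> where "\<pi> x = (SOME v. v \<in> carrier_vec n \<and> x - lin v \<in> L)" for x
  have \<pi>: "\<pi> x \<in> carrier_vec n" "x - lin (\<pi> x) \<in> L" for x
    using someI_ex[OF ex[of x]] unfolding \<pi>_def by auto
  have \<pi>_eqI: "\<pi> x = v" if v: "v \<in> carrier_vec n" "x - lin v \<in> L" for x v
  proof -
    have "lin (\<pi> x + (- 1) \<cdot>\<^sub>v v) = (x - lin v) - (x - lin (\<pi> x))"
      using v \<pi> by (simp add: lin_add lin_smult k)
    also have "\<dots> \<in> L" using v \<pi> LI by blast
    finally have *: "\<pi> x + (- 1) \<cdot>\<^sub>v v = 0\<^sub>v n" using v \<pi> by (intro lin_L) auto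
    show ?thesis
    proof (rule eq_vecI)
      fix i assume "i < dim_vec v"
      then show "\<pi> x $ i = v $ i"
        using arg_cong[OF *, of "\<lambda>v. v $ i"] v \<pi>(1)[of x] by simp
    qed (use v \<pi>(1)[of x] in simp)
  qed
  have \<pi>_lin: "\<pi> (lin v) = v" if "v \<in> carrier_vec n" for v
    using that LI by (intro \<pi>_eqI) auto
  have \<pi>_cong: "\<pi> x = \<pi> y" if "x - y \<in> L" for x y
  proof (rule \<pi>_eqI[OF \<pi>(1)])
    have "x - lin (\<pi> y) = (x - y) + (y - lin (\<pi> y))" by simp
    then show "x - lin (\<pi> y) \<in> L" using that \<pi> LI by metis
  qed
  have \<pi>_add: "\<pi> (x + y) = \<pi> x + \<pi> y" for x y
  proof (rule \<pi>_eqI)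
    have "x + y - lin (\<pi> x + \<pi> y) = (x - lin (\<pi> x)) + (y - lin (\<pi> y))"
      using \<pi> by (simp add: lin_add)
    then show "x + y - lin (\<pi> x + \<pi> y) \<in> L" using \<pi> LI by metis
  qed (use \<pi> in simp)
  have \<pi>_smult: "\<pi> (k c * x) = c \<cdot>\<^sub>v \<pi> x" for c x
  proof (rule \<pi>_eqI)
    have "k c * x - lin (c \<cdot>\<^sub>v \<pi> x) = k c * (x - lin (\<pi> x))"
      using \<pi> by (simp add: lin_smult right_diff_distrib)
    then show "k c * x - lin (c \<cdot>\<^sub>v \<pi> x) \<in> L" using \<pi> LI by metis
  qed (use \<pi> in simp)
  have \<pi>_L: "\<pi> x = 0\<^sub>v n \<longleftrightarrow> x \<in> L" for x
  proof
    have l0: "lin (0\<^sub>v n) = 0" by (simp add: lin_def k)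
    show "x \<in> L" if "\<pi> x = 0\<^sub>v n" using \<pi>(2)[of x] that l0 by simp
    show "\<pi> x = 0\<^sub>v n" if "x \<in> L" using that l0 by (intro \<pi>_eqI) auto
  qed
  have "\<exists>X\<in>carrier_mat n n. \<forall>y. \<pi> (x * y) = X *\<^sub>v \<pi> y" for x
  proof -
    have "\<exists>X\<in>carrier_mat n n. \<forall>v\<in>carrier_vec n. \<pi> (x * lin v) = X *\<^sub>v v"
      by (rule linear_map_matrix)
        (simp_all add: \<pi> lin_add distrib_left \<pi>_add lin_smult k_comm \<pi>_smult)
    then obtain X where X: "X \<in> carrier_mat n n" "\<And>v. v \<in> carrier_vec n \<Longrightarrow> \<pi> (x * lin v) = X *\<^sub>v v" by blast
    have "\<pi> (x * y) = X *\<^sub>v \<pi> y" for y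
    proof -
      have "x * y - x * lin (\<pi> y) \<in> L" using LI(3)[OF \<pi>(2)[of y], of x] by (simp add: right_diff_distrib)
      from \<pi>_cong[OF this] X(2)[OF \<pi>(1)[of y]] show ?thesis by simp
    qed
    with X show ?thesis by blast
  qed
  then obtain \<rho> where \<rho>: "\<And>x. \<rho> x \<in> carrier_mat n n" "\<And>x y. \<pi> (x * y) = \<rho> x *\<^sub>v \<pi> y" by metis
  have mat_eq: "X = Y" if "X \<in> carrier_mat n n" "Y \<in> carrier_mat n n" "\<And>y. X *\<^sub>v \<pi> y = Y *\<^sub>v \<pi> y" for X Y
    by (rule mat_eq_if_action_eq[OF that(1,2)]) (metis that(3) \<pi>_lin unit_vec_carrier)
  have scalar: "\<rho> x = c \<cdot>\<^sub>m 1\<^sub>m n" if "\<And>y. x * y - k c * y \<in> L" for x c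
  proof (rule mat_eq[OF \<rho>(1)])
    fix y
    have "\<rho> x *\<^sub>v \<pi> y = c \<cdot>\<^sub>v \<pi> y"
      using \<pi>_cong[OF that[of y]] \<rho>(2)[of x y] \<pi>_smult by simp
    then show "\<rho> x *\<^sub>v \<pi> y = (c \<cdot>\<^sub>m 1\<^sub>m n) *\<^sub>v \<pi> y"
      using \<pi>(1)[of y] by (simp add: smult_mat_vec[of _ n n])
  qed simp
  have rep: "representation \<iota> n \<rho>"
    unfolding representation_def
  proof (intro conjI allI)
    show "0 < n"
    proof (rule ccontr)
      assume "\<not> 0 < n"
      then have "\<pi> 1 = 0\<^sub>v n" using \<pi>(1)[of 1] by (intro eq_vecI) auto
      with \<pi>_L L show False by simp
    qed
    show "\<rho> 1 = 1\<^sub>m n"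
      by (rule mat_eq[OF \<rho>(1)]) (simp_all flip: \<rho>(2) add: one_mult_mat_vec[OF \<pi>(1)])
    show "\<rho> (x + y) = \<rho> x + \<rho> y" for x y
      by (rule mat_eq[OF \<rho>(1)])
        (simp_all flip: \<rho>(2) add: \<rho>(1) add_mult_distrib_mat_vec[OF \<rho>(1) \<rho>(1) \<pi>(1)] distrib_right \<pi>_add)
    show "\<rho> (x * y) = \<rho> x * \<rho> y" for x y
      by (rule mat_eq[OF \<rho>(1)])
        (simp_all flip: \<rho>(2) add: \<rho>(1) mult_carrier_mat[OF \<rho>(1) \<rho>(1)] assoc_mult_mat_vec[OF \<rho>(1) \<rho>(1) \<pi>(1)] mult.assoc)
    show "\<rho> (of_center (\<iota> c)) = c \<cdot>\<^sub>m 1\<^sub>m n" for c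
      by (rule scalar) (simp add: k_def LI)
  qed (rule \<rho>)
  have "irreducible_rep \<iota> \<rho>"
    unfolding irreducible_rep_def
  proof (intro exI[of _ n] conjI rep allI impI, elim conjE)
    fix W assume sub: "VectorSpace.subspace class_ring W (module_vec TYPE('k) n)"
      and inv: "\<forall>x. \<forall>v\<in>W. \<rho> x *\<^sub>v v \<in> W"
    then have W: "W \<subseteq> carrier_vec n" "0\<^sub>v n \<in> W" "\<And>v w. v \<in> W \<Longrightarrow> w \<in> W \<Longrightarrow> v + w \<in> W"
      unfolding VectorSpace.subspace_def submodule_def by (auto simp: module_vec_simps)
    let ?J = "{x. \<pi> x \<in> W}"
    have J: "left_ideal ?J"
      unfolding left_ideal_def using W inv by (auto simp: \<pi>_add \<rho>(2) \<pi>_L[THEN iffD2] LI)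
    have LJ: "L \<subseteq> ?J" using W(2) by (auto simp: \<pi>_L[THEN iffD2])
    show "W = {0\<^sub>v n} \<or> W = carrier_vec n"
    proof (cases "1 \<in> ?J")
      case True
      have "v \<in> W" if "v \<in> carrier_vec n" for v
        using left_idealD(3)[OF J True, of "lin v"] \<pi>_lin[OF that] by simp
      with W show ?thesis by blast
    next
      case False
      from max[OF J LJ this] have JL: "?J = L" .
      have "v = 0\<^sub>v n" if "v \<in> W" for v
      proof -
        have v: "v \<in> carrier_vec n" using that W by blast
        then have "lin v \<in> ?J" using that \<pi>_lin by simp
        with JL \<pi>_L[of "lin v"] \<pi>_lin[OF v] show ?thesis by simp
      qed
      with W show ?thesis by blast
    qed
  qed
  then show ?thesis
    using scalar unfolding k_def by (intro exI[of _ \<rho>]) (simp add: rep_dim_eq[OF rep])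
qed

lemma maximal_left_ideal_exists:
  assumes "left_ideal K" "1 \<notin> K"
  shows "\<exists>L. K \<subseteq> L \<and> left_ideal L \<and> 1 \<notin> L \<and> (\<forall>J. left_ideal J \<longrightarrow> L \<subseteq> J \<longrightarrow> 1 \<notin> J \<longrightarrow> J = L)"
proof -
  let ?A = "{L. K \<subseteq> L \<and> left_ideal L \<and> 1 \<notin> L}"
  have "\<exists>M\<in>?A. \<forall>X\<in>?A. M \<subseteq> X \<longrightarrow> X = M"
  proof (rule subset_Zorn_nonempty)
    show "?A \<noteq> {}" using assms by blast
    fix \<C> assume \<C>: "\<C> \<noteq> {}" "subset.chain ?A \<C>"
    have in_A: "X \<in> ?A" if "X \<in> \<C>" for X using \<C> that by (auto simp: subset.chain_def)
    have chain: "X \<subseteq> Y \<or> Y \<subseteq> X" if "X \<in> \<C>" "Y \<in> \<C>" for X Y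
      using \<C> that unfolding subset.chain_def by blast
    have "left_ideal (\<Union>\<C>)"
      unfolding left_ideal_def
    proof (intro conjI ballI allI)
      show "0 \<in> \<Union>\<C>" using \<C>(1) in_A left_idealD(1) by blast
      show "x * a \<in> \<Union>\<C>" if "a \<in> \<Union>\<C>" for x a using that in_A left_idealD(3) by blast
      show "a + b \<in> \<Union>\<C>" if "a \<in> \<Union>\<C>" "b \<in> \<Union>\<C>" for a b
      proof -
        from that obtain X Y where XY: "X \<in> \<C>" "Y \<in> \<C>" "a \<in> X" "b \<in> Y" by blast
        with chain[OF XY(1,2)] obtain Z where "Z \<in> \<C>" "a \<in> Z" "b \<in> Z" by blast
        with in_A[of Z] left_idealD(2)[of Z a b] show ?thesis by blast
      qed
    qed
    then show "\<Union>\<C> \<in> ?A" using \<C>(1) in_A by blast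
  qed
  then obtain L where L: "L \<in> ?A" and max: "\<forall>X\<in>?A. L \<subseteq> X \<longrightarrow> X = L" by (rule bexE)
  show ?thesis
  proof (intro exI[of _ L] conjI allI impI)
    show "J = L" if "left_ideal J" "L \<subseteq> J" "1 \<notin> J" for J
      using that L(1) by (intro max[rule_format]) auto
  qed (use L in auto)
qed


section \<open>Extending characters of central subrings\<close>

lemma of_center_cancel:
  fixes t :: "'r::prime_ring"
  assumes "of_center z * t = 0" "z \<noteq> 0"
  shows "t = 0"
proof -
  have "of_center z * x * t = 0" for x
    using assms(1) by (simp add: of_center_commute[of z x] mult.assoc)
  then have "of_center z = 0 \<or> t = 0" by (rule prime_ring)
  with assms(2) show ?thesis by (metis of_center_inject zero_center.rep_eq)
qed

text \<open>A general central subring \<open>C\<close> is allowed because of two uses: the whole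
  center for surjectivity, and a finitely generated subring for separation of central
  elements.\<close>

lemma irreducible_rep_over_character:
  fixes \<iota> :: "'k::field \<Rightarrow> 'r::prime_ring center"
  assumes C: "subring_over \<iota> C" and G: "finite G"
    and gen: "\<And>x. \<exists>c. (\<forall>g\<in>G. c g \<in> C) \<and> x = (\<Sum>g\<in>G. of_center (c g) * g)"
    and \<phi>: "hom_on \<iota> C \<phi>"
  shows "\<exists>\<rho>. irreducible_rep \<iota> \<rho> \<and> (\<forall>z\<in>C. \<rho> (of_center z) = \<phi> z \<cdot>\<^sub>m 1\<^sub>m (rep_dim \<rho>))"
proof -
  interpret subring_over \<iota> C by fact
  note \<phi>s = hom_on_zero[OF \<phi>] hom_on_add[OF \<phi>] hom_on_mult[OF \<phi>] hom_on_diff[OF \<phi>] hom_on_one[OF \<phi>]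
    hom_on_scalar[OF \<phi>]
  define m where "m = {c \<in> C. \<phi> c = 0}"
  have m: "0 \<in> m" "a \<in> m \<Longrightarrow> b \<in> m \<Longrightarrow> a + b \<in> m" "c \<in> C \<Longrightarrow> a \<in> m \<Longrightarrow> a * c \<in> m" "m \<subseteq> C" for a b c
    using \<phi>s by (auto simp: m_def zero add mult)
  \<comment> \<open>The left ideal generated by \<open>m\<close>, written on the fixed generators so
    that membership of 1 yields a square system.\<close>
  define L0 where "L0 = {\<Sum>g\<in>G. of_center (c g) * g | c. \<forall>g\<in>G. c g \<in> m}"
  have L0I: "(\<Sum>g\<in>G. of_center (c g) * g) \<in> L0" if "\<And>g. g \<in> G \<Longrightarrow> c g \<in> m" for c
    using that unfolding L0_def by blast
  have L0_zero: "0 \<in> L0" using L0I[of "\<lambda>_. 0"] m by (simp add: of_center_simps)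
  have L0_add: "x + y \<in> L0" if xy: "x \<in> L0" "y \<in> L0" for x y
  proof -
    obtain a b where "x = (\<Sum>g\<in>G. of_center (a g) * g)" "y = (\<Sum>g\<in>G. of_center (b g) * g)"
      "\<forall>g\<in>G. a g \<in> m" "\<forall>g\<in>G. b g \<in> m" using xy unfolding L0_def by blast
    then show ?thesis using L0I[of "\<lambda>g. a g + b g"] m
      by (simp add: of_center_simps distrib_right sum.distrib)
  qed
  have L0_sum: "sum f I \<in> L0" if "\<And>i. i \<in> I \<Longrightarrow> f i \<in> L0" for f :: "'r \<Rightarrow> 'r" and I
    using that by (induction I rule: infinite_finite_induct) (auto intro: L0_zero L0_add)
  have mR: "of_center a * x \<in> L0" if a: "a \<in> m" for a x
  proof -
    obtain c where c: "\<forall>g\<in>G. c g \<in> C" "x = (\<Sum>g\<in>G. of_center (c g) * g)" using gen by blast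
    have "of_center a * x = (\<Sum>g\<in>G. of_center (a * c g) * g)"
      by (simp add: c(2) sum_distrib_left of_center_simps mult.assoc)
    then show ?thesis using L0I[of "\<lambda>g. a * c g"] m a c by simp
  qed
  have L0_left: "left_ideal L0"
    unfolding left_ideal_def
  proof (intro conjI ballI allI)
    fix x y assume "y \<in> L0"
    then obtain c where c: "y = (\<Sum>g\<in>G. of_center (c g) * g)" "\<forall>g\<in>G. c g \<in> m"
      unfolding L0_def by blast
    have "x * y = (\<Sum>g\<in>G. of_center (c g) * (x * g))"
      by (simp add: c(1) sum_distrib_left of_center_left_commute)
    also have "\<dots> \<in> L0" using c(2) by (intro L0_sum mR) auto
    finally show "x * y \<in> L0" .
  qed (auto intro: L0_zero L0_add)
  have "1 \<notin> L0"
  proof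
    assume "1 \<in> L0"
    then have "g \<in> L0" for g using left_idealD(3)[OF L0_left, of 1 g] by simp
    then have "\<exists>c. (\<forall>h\<in>G. c h \<in> m) \<and> g = (\<Sum>h\<in>G. of_center (c h) * h)" for g
      unfolding L0_def by blast
    then obtain c where c: "\<And>g h. h \<in> G \<Longrightarrow> c g h \<in> m" "\<And>g. g = (\<Sum>h\<in>G. of_center (c g h) * h)" by metis
    \<comment> \<open>Nakayama: the generators themselves solve the homogeneous system whose matrix
      is the identity minus \<open>c\<close>, congruent to the identity modulo
      \<open>m\<close>.\<close>
    have "g = 0" if g: "g \<in> G" for g
    proof (rule unipotent_system_trivial[where z = "\<lambda>g. g" and S = "of_center ` C" and T = UNIV and
          P = "of_center ` m" and m = "\<lambda>g h. of_center ((if g = h then 1 else 0) - c g h)"])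
      show "1 \<in> of_center ` C" using one of_center_simps(2) by (metis imageI)
      show "a - b \<in> of_center ` C" "a * b \<in> of_center ` C" if "a \<in> of_center ` C" "b \<in> of_center ` C" for a b :: 'r
        using that diff mult by (auto simp: of_center_simps[symmetric])
      show "a + b \<in> of_center ` m" if ab: "a \<in> of_center ` m" "b \<in> of_center ` m" for a b :: 'r
      proof -
        obtain x y where "a = of_center x" "b = of_center y" "x \<in> m" "y \<in> m" using ab by blast
        then show ?thesis using m(2)[of x y] by (intro image_eqI[of _ _ "x + y"]) (simp_all add: of_center_simps)
      qed
      show "a * b \<in> of_center ` m" if ab: "a \<in> of_center ` C" "b \<in> of_center ` m" for a b :: 'r
      proof -
        obtain x y where "a = of_center x" "b = of_center y" "x \<in> C" "y \<in> m" using ab by blast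
        then show ?thesis using m(3)[of x y] of_center_commute[of x b]
          by (intro image_eqI[of _ _ "y * x"]) (simp_all add: of_center_simps)
      qed
      show "a * b \<in> of_center ` m" if ab: "a \<in> of_center ` m" "b \<in> of_center ` C" for a b :: 'r
      proof -
        obtain x y where "a = of_center x" "b = of_center y" "x \<in> m" "y \<in> C" using ab by blast
        then show ?thesis using m(3)[of y x] by (intro image_eqI[of _ _ "x * y"]) (simp_all add: of_center_simps)
      qed
      show "s * t = t * s" if "s \<in> of_center ` C" for s t :: 'r
        using that of_center_commute by blast
      \<comment> \<open>\<open>s\<close> comes from a central element on which \<open>\<phi>\<close>
        is 1; it is nonzero, hence regular in the prime ring.\<close>
      show "t = 0" if st: "s \<in> of_center ` C" "1 - s \<in> of_center ` m" "s * t = 0" for s t :: 'r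
      proof -
        obtain a b where ab: "a \<in> C" "s = of_center a" "b \<in> m" "1 - s = of_center b" using st by auto
        then have "of_center (1 - a) = of_center b" by (simp add: of_center_simps)
        then have "1 - a \<in> m" using ab by (simp add: of_center_inject)
        then have "a \<noteq> 0" using \<phi>s by (auto simp: m_def)
        moreover have "of_center a * t = 0" using st ab by simp
        ultimately show ?thesis using of_center_cancel by blast
      qed
      fix i j assume ij: "i \<in> G" "j \<in> G"
      have cC: "c i j \<in> C" using c(1)[OF ij(2)] m by blast
      show "of_center ((if i = j then 1 else 0) - c i j) \<in> of_center ` C"
        using cC diff one zero by auto
      have "(if i = j then 1 else 0) - of_center ((if i = j then 1 else 0) - c i j) = of_center (c i j)"
        by (simp add: of_center_simps)
      then show "(if i = j then 1 else 0) - of_center ((if i = j then 1 else 0) - c i j) \<in> of_center ` m"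
        using c(1)[OF ij(2), of i] by simp
    next
      fix i assume i: "i \<in> G"
      have "(\<Sum>j\<in>G. of_center ((if i = j then 1 else 0) - c i j) * j)
          = (\<Sum>j\<in>G. (if i = j then j else 0)) - (\<Sum>j\<in>G. of_center (c i j) * j)"
        unfolding sum_subtractf[symmetric]
        by (rule sum.cong) (simp_all add: of_center_simps left_diff_distrib)
      also have "\<dots> = 0" using i G c(2)[of i] by simp
      finally show "(\<Sum>j\<in>G. of_center ((if i = j then 1 else 0) - c i j) * j) = 0" .
    qed (use G g in auto)
    then have "(\<Sum>h\<in>G. of_center (c 1 h) * h) = 0" by (metis (no_types, lifting) mult_zero_right sum.neutral)
    then have "(1 :: 'r) = 0" using c(2)[of 1] by simp
    then show False by simp
  qed
  from maximal_left_ideal_exists[OF L0_left this] obtain L where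
    L: "L0 \<subseteq> L" "left_ideal L" "1 \<notin> L" "\<And>J. left_ideal J \<Longrightarrow> L \<subseteq> J \<Longrightarrow> 1 \<notin> J \<Longrightarrow> J = L" by blast
  have red: "of_center z * x - of_center (\<iota> (\<phi> z)) * x \<in> L" if z: "z \<in> C" for z x
  proof -
    have "z - \<iota> (\<phi> z) \<in> m" using z \<phi>s scalar diff by (simp add: m_def)
    from mR[OF this, of x] L(1) show ?thesis by (auto simp: of_center_simps left_diff_distrib)
  qed
  \<comment> \<open>Reducing the coefficients by \<open>\<phi>\<close> shows that \<open>G\<close>
    spans \<open>R / L\<close> over k.\<close>
  have "\<exists>l. x - (\<Sum>g\<in>G. of_center (\<iota> (l g)) * g) \<in> L" for x
  proof -
    obtain c where c: "\<forall>g\<in>G. c g \<in> C" "x = (\<Sum>g\<in>G. of_center (c g) * g)" using gen by blast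
    have "x - (\<Sum>g\<in>G. of_center (\<iota> (\<phi> (c g))) * g)
        = (\<Sum>g\<in>G. of_center (c g) * g - of_center (\<iota> (\<phi> (c g))) * g)"
      by (simp add: c(2) sum_subtractf)
    also have "\<dots> \<in> L" using c(1) by (intro left_ideal_sum[OF L(2)] red) auto
    finally show ?thesis by (intro exI[of _ "\<lambda>g. \<phi> (c g)"])
  qed
  from irreducible_rep_from_maximal_left_ideal[OF comm_ring_hom_axioms L(2,3,4) G this]
  obtain \<rho> where "irreducible_rep \<iota> \<rho>"
    "\<forall>x c. (\<forall>y. x * y - of_center (\<iota> c) * y \<in> L) \<longrightarrow> \<rho> x = c \<cdot>\<^sub>m 1\<^sub>m (rep_dim \<rho>)" by blast
  with red show ?thesis by blast
qed

text \<open>As in the Artin-Tate lemma, \<open>F\<close> collects structure constants: the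
  coefficients of 1, of the algebra generators and of products of two module generators. Over any
  \<open>C\<close> containing them, the \<open>C\<close>-span of \<open>G\<close> is a subalgebra
  that contains the algebra generators, hence is all of R.\<close>

lemma finite_over_central_subring:
  fixes \<iota> :: "'k::field \<Rightarrow> 'r::ring_1 center"
  assumes affine: "affine_algebra \<iota>" and G: "finite G" "center_module.span G = UNIV"
  shows "\<exists>F. finite F \<and> (\<forall>C. subring_over \<iota> C \<longrightarrow> F \<subseteq> C \<longrightarrow>
    (\<forall>x. \<exists>c. (\<forall>g\<in>G. c g \<in> C) \<and> x = (\<Sum>g\<in>G. of_center (c g) * g)))"
proof -
  from affine obtain S where S: "finite S" "subalgebra \<iota> hull S = UNIV"
    unfolding affine_algebra_def by blast
  have "\<exists>c. x = (\<Sum>g\<in>G. of_center (c g) * g)" for x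
    using G center_module.span_finite[OF G(1)] unfolding center_scale_def by blast
  then obtain co where co: "\<And>x. x = (\<Sum>g\<in>G. of_center (co x g) * g)" by metis
  define F where "F = (\<lambda>(x, g). co x g) ` ((insert 1 S \<union> (\<lambda>(a, b). a * b) ` (G \<times> G)) \<times> G)"
  have F: "co x g \<in> F" if "g \<in> G" "x = 1 \<or> x \<in> S \<or> (\<exists>a\<in>G. \<exists>b\<in>G. x = a * b)" for x g
    unfolding F_def using that by (intro image_eqI[of _ _ "(x, g)"]) auto
  have "finite F" unfolding F_def using S(1) G(1) by auto
  moreover have "\<exists>c. (\<forall>g\<in>G. c g \<in> C) \<and> x = (\<Sum>g\<in>G. of_center (c g) * g)"
    if C: "subring_over \<iota> C" "F \<subseteq> C" for C x
  proof -
    interpret subring_over \<iota> C by fact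
    define T where "T = {\<Sum>g\<in>G. of_center (c g) * g | c. \<forall>g\<in>G. c g \<in> C}"
    have TI: "(\<Sum>g\<in>G. of_center (c g) * g) \<in> T" if "\<And>g. g \<in> G \<Longrightarrow> c g \<in> C" for c
      using that unfolding T_def by blast
    have T_zero: "0 \<in> T" using TI[of "\<lambda>_. 0"] zero by (simp add: of_center_simps)
    have T_add: "x + y \<in> T" if xy: "x \<in> T" "y \<in> T" for x y
    proof -
      obtain a b where "x = (\<Sum>g\<in>G. of_center (a g) * g)" "y = (\<Sum>g\<in>G. of_center (b g) * g)"
        "\<forall>g\<in>G. a g \<in> C" "\<forall>g\<in>G. b g \<in> C" using xy unfolding T_def by blast
      then show ?thesis using TI[of "\<lambda>g. a g + b g"] add
        by (simp add: of_center_simps distrib_right sum.distrib)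
    qed
    have T_sum: "sum f I \<in> T" if "\<And>i. i \<in> I \<Longrightarrow> f i \<in> T" for f :: "'r \<Rightarrow> 'r" and I
      using that by (induction I rule: infinite_finite_induct) (auto intro: T_zero T_add)
    have T_scale: "of_center a * x \<in> T" if a: "a \<in> C" and x: "x \<in> T" for a x
    proof -
      obtain c where c: "\<forall>g\<in>G. c g \<in> C" "x = (\<Sum>g\<in>G. of_center (c g) * g)" using x unfolding T_def by blast
      have "of_center a * x = (\<Sum>g\<in>G. of_center (a * c g) * g)"
        by (simp add: c(2) sum_distrib_left of_center_simps mult.assoc)
      then show ?thesis using TI[of "\<lambda>g. a * c g"] mult a c by simp
    qed
    have T_F: "x \<in> T" if "x = 1 \<or> x \<in> S \<or> (\<exists>a\<in>G. \<exists>b\<in>G. x = a * b)" for x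
      using TI[of "co x"] co[of x] F[OF _ that] C(2) by auto
    have T_mult: "x * y \<in> T" if xy: "x \<in> T" "y \<in> T" for x y
    proof -
      obtain a b where ab: "x = (\<Sum>g\<in>G. of_center (a g) * g)" "y = (\<Sum>g\<in>G. of_center (b g) * g)"
        "\<forall>g\<in>G. a g \<in> C" "\<forall>g\<in>G. b g \<in> C" using xy unfolding T_def by blast
      have comm: "(of_center u * g) * (of_center v * h) = of_center u * (of_center v * (g * h))"
        for u v :: "'r center" and g h :: 'r
        using of_center_left_commute[of g v h] by (simp add: mult.assoc)
      have "x * y = (\<Sum>g\<in>G. \<Sum>h\<in>G. of_center (a g) * (of_center (b h) * (g * h)))"
        unfolding ab(1,2) sum_product comm ..
      also have "\<dots> \<in> T" using ab(3,4) by (intro T_sum T_scale T_F) auto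
      finally show ?thesis .
    qed
    have "of_center (\<iota> c) \<in> T" for c
      using T_scale[OF scalar T_F, of 1 c] by simp
    then have "subalgebra \<iota> T" unfolding subalgebra_def using T_add T_mult by blast
    then have "subalgebra \<iota> hull S \<subseteq> T" by (intro hull_minimal) (auto intro: T_F)
    then have "x \<in> T" using S(2) by blast
    then show ?thesis unfolding T_def by blast
  qed
  ultimately show ?thesis by blast
qed

text \<open>A character of the finitely generated \<open>C\<close> extends to the center without
  integrality arguments: the central character of an irreducible representation over it restricts to
  it on \<open>C\<close>.\<close>

theorem center_homs_separate:
  fixes \<iota> :: "'k::alg_closed_field \<Rightarrow> 'r::prime_ring center" and G :: "'r set"
  assumes affine: "affine_algebra \<iota>" and G: "finite G" "center_module.span G = UNIV"
    and a: "a \<noteq> 0"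
  shows "\<exists>\<tau>\<in>center_homs \<iota>. \<tau> a \<noteq> 0"
proof -
  from finite_over_central_subring[OF affine G] obtain F where F: "finite F"
    "\<forall>C. subring_over \<iota> C \<longrightarrow> F \<subseteq> C \<longrightarrow>
      (\<forall>x. \<exists>c. (\<forall>g\<in>G. c g \<in> C) \<and> x = (\<Sum>g\<in>G. of_center (c g) * g))"
    by blast
  have \<iota>: "comm_ring_hom \<iota>" using affine by (simp add: affine_algebra_def)
  from finitely_generated_separated_by_homs[OF \<iota>, of "insert a F"] F(1) obtain C where
    C: "subring_over \<iota> C" "insert a F \<subseteq> C" "separated_by_homs \<iota> C" by blast
  with a obtain \<phi> where \<phi>: "hom_on \<iota> C \<phi>" "\<phi> a \<noteq> 0" unfolding separated_by_homs_def by blast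
  have "F \<subseteq> C" using C by blast
  from irreducible_rep_over_character[OF C(1) G(1) F(2)[rule_format, OF C(1) this] \<phi>(1)] obtain \<rho> where
    \<rho>: "irreducible_rep \<iota> \<rho>" "\<And>z. z \<in> C \<Longrightarrow> \<rho> (of_center z) = \<phi> z \<cdot>\<^sub>m 1\<^sub>m (rep_dim \<rho>)" by blast
  interpret alg_closed_irrep \<iota> "rep_dim \<rho>" \<rho> by (rule alg_closed_irrepI[OF \<rho>(1)])
  have "\<phi> a \<cdot>\<^sub>m 1\<^sub>m (rep_dim \<rho>) = central_character \<iota> \<rho> a \<cdot>\<^sub>m 1\<^sub>m (rep_dim \<rho>)"
    using \<rho>(2)[of a] C(2) central_character(2) by simp
  from arg_cong[OF this, of "\<lambda>M. M $$ (0, 0)"] have "central_character \<iota> \<rho> a = \<phi> a"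
    using dim_pos by simp
  with \<phi>(2) central_character(1) show ?thesis by metis
qed

section \<open>Independence over the center\<close>

lemma center_scale_eq: "center_scale z x = of_center z * x"
  by (simp add: center_scale_def)

lemma in_center:
  assumes "\<And>x. a * x = x * a"
  shows "\<exists>z. a = of_center z"
proof
  show "a = of_center (Abs_center a)"
    by (rule Abs_center_inverse[symmetric]) (use assms in blast)
qed

lemma of_center_eq_0_iff: "of_center z = 0 \<longleftrightarrow> z = 0"
  by (metis of_center_inject zero_center.rep_eq)

lemma span_insert_dependent:
  fixes X :: "'r::prime_ring set"
  assumes X: "center_module.independent X" and dep: "\<not> center_module.independent (insert g X)"
  shows "\<exists>z. z \<noteq> 0 \<and> of_center z * g \<in> center_module.span X"
proof -
  from dep obtain t u where t: "finite t" "t \<subseteq> insert g X" "(\<Sum>v\<in>t. center_scale (u v) v) = 0" "\<exists>v\<in>t. u v \<noteq> 0"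
    unfolding center_module.dependent_explicit by blast
  have gt: "g \<in> t"
  proof (rule ccontr)
    assume "g \<notin> t"
    then have "t \<subseteq> X" using t by blast
    with t X show False unfolding center_module.dependent_explicit by blast
  qed
  have sum: "center_scale (u g) g = - (\<Sum>v\<in>t - {g}. center_scale (u v) v)"
    using t gt by (simp add: sum.remove[of t g] add_eq_0_iff2)
  have "u g \<noteq> 0"
  proof
    assume u: "u g = 0"
    then have "(\<Sum>v\<in>t - {g}. center_scale (u v) v) = 0" using sum by simp
    moreover have "t - {g} \<subseteq> X" "finite (t - {g})" "\<exists>v\<in>t - {g}. u v \<noteq> 0" using t u by auto
    ultimately show False using X unfolding center_module.dependent_explicit by blast
  qed
  moreover have "center_scale (u g) g \<in> center_module.span X"
    unfolding sum using t(2)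
    by (intro center_module.span_neg center_module.span_sum center_module.span_scale center_module.span_base) auto
  ultimately show ?thesis unfolding center_scale_eq by blast
qed

text \<open>\<open>X\<close> stands for a basis of R over the fraction field of the center, and
  \<open>c\<close> is a common denominator for coordinates in it.\<close>

locale central_frame =
  fixes X :: "'r::prime_ring set" and c :: "'r center"
  assumes finite_X: "finite X" and independent_X: "center_module.independent X"
    and c_nonzero: "c \<noteq> 0" and c_span: "of_center c * x \<in> center_module.span X"

lemma central_frame_exists:
  fixes G :: "'r::prime_ring set"
  assumes G: "finite G" "center_module.span G = UNIV"
  shows "\<exists>(X :: 'r set) c. central_frame X c"
proof -
  let ?P = "\<lambda>X. X \<subseteq> G \<and> center_module.independent X"
  have "?P {}" using center_module.independent_empty by simp
  moreover have "\<forall>X. ?P X \<longrightarrow> card X < Suc (card G)"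
    using G(1) by (simp add: card_mono less_Suc_eq_le)
  ultimately obtain X where X: "?P X" and max: "\<And>Y. ?P Y \<Longrightarrow> card Y \<le> card X"
    using ex_has_greatest_nat[of ?P "{}" card "Suc (card G)"] by (auto intro: less_imp_le)
  have fX: "finite X" using X G finite_subset by blast
  have "\<exists>z. z \<noteq> 0 \<and> of_center z * g \<in> center_module.span X" if g: "g \<in> G" for g
  proof (cases "g \<in> X")
    case True
    then show ?thesis using center_module.span_base by (intro exI[of _ 1]) (simp add: of_center_simps)
  next
    case False
    have "\<not> center_module.independent (insert g X)"
      using max[of "insert g X"] X g False fX by auto
    with X show ?thesis by (intro span_insert_dependent) auto
  qed
  then obtain z where z: "\<And>g. g \<in> G \<Longrightarrow> z g \<noteq> 0" "\<And>g. g \<in> G \<Longrightarrow> of_center (z g) * g \<in> center_module.span X"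
    by metis
  \<comment> \<open>Clears the denominators of all generators at once.\<close>
  let ?c = "\<Prod>g\<in>G. z g"
  have cG: "center_scale ?c g \<in> center_module.span X" if "g \<in> G" for g
  proof -
    have "?c = (\<Prod>g\<in>G - {g}. z g) * z g" using G(1) that by (simp add: prod.remove[of G g] mult.commute)
    then have "center_scale ?c g = center_scale (\<Prod>g\<in>G - {g}. z g) (of_center (z g) * g)"
      by (simp add: center_scale_eq of_center_simps mult.assoc)
    then show ?thesis using z(2)[OF that] by (simp add: center_module.span_scale)
  qed
  have "of_center ?c * x \<in> center_module.span X" for x
  proof -
    have "x \<in> center_module.span G" using G by simp
    then have "center_scale ?c x \<in> center_module.span X"
    proof (induction rule: center_module.span_induct_alt)
      case base
      show ?case by (simp add: center_module.span_zero)
    next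
      case (step a y x)
      have eq: "center_scale ?c (center_scale a y + x) = center_scale a (center_scale ?c y) + center_scale ?c x"
        by (simp add: center_module.scale_right_distrib mult.commute)
      have "y \<in> G" "center_scale ?c x \<in> center_module.span X" using step by auto
      then show ?case unfolding eq
        by (intro center_module.span_add center_module.span_scale[OF cG])
    qed
    then show ?thesis by (simp add: center_scale_eq)
  qed
  then have "central_frame X ?c"
    using X fX z(1) G(1) by unfold_locales auto
  then show ?thesis by blast
qed

context central_frame
begin

lemma coordinates: "\<exists>u. of_center c * x = (\<Sum>v\<in>X. of_center (u v) * v)"
  using c_span[of x] center_module.span_finite[OF finite_X] by (auto simp: center_scale_eq)

text \<open>Multiplying by \<open>c\<close> turns the claim into a homogeneous system with more
  unknowns than equations. The family is indexed, so coinciding values count separately.\<close>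

lemma relation_exists:
  fixes y :: "'j \<Rightarrow> 'r"
  assumes J: "finite J" "card X < card J"
  shows "\<exists>l. (\<exists>j\<in>J. l j \<noteq> 0) \<and> (\<Sum>j\<in>J. of_center (l j) * y j) = 0"
proof -
  have "\<exists>u. center_scale c (y j) = (\<Sum>v\<in>X. center_scale (u v) v)" for j
    using coordinates[of "y j"] by (simp only: center_scale_eq)
  then have "\<forall>j. \<exists>u. center_scale c (y j) = (\<Sum>v\<in>X. center_scale (u v) v)" ..
  from choice[OF this] obtain f where f: "\<And>j. center_scale c (y j) = (\<Sum>v\<in>X. center_scale (f j v) v)"
    by blast
  obtain l where l: "\<exists>j\<in>J. l j \<noteq> 0" "\<And>v. v \<in> X \<Longrightarrow> (\<Sum>j\<in>J. f j v * l j) = 0"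
    using homogeneous_system_nontrivial[OF finite_X J, of "\<lambda>v j. f j v"] by blast
  have "center_scale c (\<Sum>j\<in>J. center_scale (l j) (y j)) = (\<Sum>j\<in>J. center_scale (l j) (center_scale c (y j)))"
    unfolding center_module.scale_sum_right by (rule sum.cong[OF refl center_module.scale_left_commute])
  also have "\<dots> = (\<Sum>j\<in>J. \<Sum>v\<in>X. center_scale (f j v * l j) v)"
    unfolding f center_module.scale_sum_right center_module.scale_scale by (simp only: mult.commute)
  also have "\<dots> = (\<Sum>v\<in>X. center_scale (\<Sum>j\<in>J. f j v * l j) v)"
    unfolding center_module.scale_sum_left by (rule sum.swap)
  also have "\<dots> = 0" using l(2) by simp
  finally have "of_center c * (\<Sum>j\<in>J. of_center (l j) * y j) = 0" unfolding center_scale_eq .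
  with c_nonzero have "(\<Sum>j\<in>J. of_center (l j) * y j) = 0" using of_center_cancel by blast
  with l show ?thesis by blast
qed

lemma independent_card_le:
  fixes Y :: "'r set"
  assumes "finite Y" "center_module.independent Y"
  shows "card Y \<le> card X"
proof (rule ccontr)
  assume "\<not> card Y \<le> card X"
  with relation_exists[of Y "\<lambda>y. y"] assms(1) obtain l where
    "\<exists>j\<in>Y. l j \<noteq> 0" "(\<Sum>j\<in>Y. of_center (l j) * j) = 0" by auto
  with assms show False unfolding center_module.dependent_explicit center_scale_eq by blast
qed

text \<open>The dimension over the fraction field of what \<open>L\<close> spans.
  \<open>GREATEST\<close> is a true maximum here, because \<open>independent_card_le\<close> bounds
  the cardinalities by \<open>card X\<close>.\<close>

definition rk :: "'r set \<Rightarrow> nat" where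
  "rk L = (GREATEST k. \<exists>Y\<subseteq>L. finite Y \<and> center_module.independent Y \<and> card Y = k)"

lemma rk_witness: "\<exists>Y\<subseteq>L. finite Y \<and> center_module.independent Y \<and> card Y = rk L"
  unfolding rk_def
  by (rule GreatestI_nat[where b = "card X"])
    (use independent_card_le center_module.independent_empty in \<open>auto intro!: exI[of _ "{}"]\<close>)

lemma card_le_rk: "Y \<subseteq> L \<Longrightarrow> finite Y \<Longrightarrow> center_module.independent Y \<Longrightarrow> card Y \<le> rk L"
  unfolding rk_def by (rule Greatest_le_nat[where b = "card X"]) (use independent_card_le in auto)

text \<open>A largest independent subset of \<open>L'\<close> is also largest in \<open>L\<close>.
  This replaces equality of nested subspaces of equal dimension: equality holds up to nonzero
  central factors.\<close>

lemma rk_saturated: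
  assumes L: "center_module.subspace L'" "L' \<subseteq> L" "rk L \<le> rk L'" and x: "x \<in> L"
  shows "\<exists>z. z \<noteq> 0 \<and> of_center z * x \<in> L'"
proof -
  obtain Y where Y: "Y \<subseteq> L'" "finite Y" "center_module.independent Y" "card Y = rk L'"
    using rk_witness by blast
  show ?thesis
  proof (cases "x \<in> Y")
    case True
    with Y(1) show ?thesis by (intro exI[of _ 1]) (auto simp: of_center_simps)
  next
    case False
    have "\<not> center_module.independent (insert x Y)"
      using card_le_rk[of "insert x Y" L] Y L x False by auto
    from span_insert_dependent[OF Y(3) this] center_module.span_minimal[OF Y(1) L(1)]
    show ?thesis by blast
  qed
qed

end


section \<open>Nonzero ideals meet the center\<close>

definition right_ideal :: "'r::ring_1 set \<Rightarrow> bool" where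
  "right_ideal K \<longleftrightarrow> 0 \<in> K \<and> (\<forall>a\<in>K. \<forall>b\<in>K. a + b \<in> K) \<and> (\<forall>a\<in>K. \<forall>x. a * x \<in> K)"

lemma right_idealD:
  assumes "right_ideal K"
  shows "0 \<in> K" "a \<in> K \<Longrightarrow> b \<in> K \<Longrightarrow> a + b \<in> K" "a \<in> K \<Longrightarrow> a * x \<in> K"
    "a \<in> K \<Longrightarrow> b \<in> K \<Longrightarrow> a - b \<in> K" "a \<in> K \<Longrightarrow> of_center z * a \<in> K"
proof -
  show 1: "0 \<in> K" "\<And>a b. a \<in> K \<Longrightarrow> b \<in> K \<Longrightarrow> a + b \<in> K" "\<And>a x. a \<in> K \<Longrightarrow> a * x \<in> K"
    using assms unfolding right_ideal_def by auto
  show "a \<in> K \<Longrightarrow> b \<in> K \<Longrightarrow> a - b \<in> K"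
    using 1(2)[of a "b * (- 1)"] 1(3)[of b "- 1"] by simp
  show "a \<in> K \<Longrightarrow> of_center z * a \<in> K"
    unfolding of_center_commute by (rule 1(3))
qed

lemma right_ideal_subspace: "right_ideal K \<Longrightarrow> center_module.subspace K"
  by (rule center_module.subspaceI) (simp_all add: right_idealD center_scale_eq)

lemma right_ideal_mult_image:
  assumes "right_ideal K"
  shows "right_ideal ((\<lambda>x. a * x) ` K)"
  unfolding right_ideal_def
proof (intro conjI ballI allI)
  show "0 \<in> (\<lambda>x. a * x) ` K" using right_idealD(1)[OF assms] by (intro image_eqI[of _ _ 0]) auto
  show "x + y \<in> (\<lambda>x. a * x) ` K" if "x \<in> (\<lambda>x. a * x) ` K" "y \<in> (\<lambda>x. a * x) ` K" for x y
    using that right_idealD(2)[OF assms] by (auto simp flip: distrib_left)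
  show "x * y \<in> (\<lambda>x. a * x) ` K" if "x \<in> (\<lambda>x. a * x) ` K" for x y
    using that right_idealD(3)[OF assms] by (auto simp: mult.assoc)
qed

lemma right_ideal_annihilator:
  assumes "right_ideal K"
  shows "right_ideal {x \<in> K. a * x = 0}"
  unfolding right_ideal_def using right_idealD[OF assms]
  by (auto simp: distrib_left mult.assoc[symmetric])

definition two_sided_ideal :: "'r::ring_1 set \<Rightarrow> bool" where
  "two_sided_ideal I \<longleftrightarrow> right_ideal I \<and> (\<forall>a\<in>I. \<forall>x. x * a \<in> I)"

context central_frame
begin

text \<open>Brauer's lemma with the denominator \<open>z\<close> cleared.\<close>

lemma quasi_idempotent_exists:
  fixes K :: "'r set"
  assumes K: "right_ideal K" "K \<noteq> {0}"
  shows "\<exists>e\<in>K. \<exists>z. z \<noteq> 0 \<and> e \<noteq> 0 \<and> e * e = of_center z * e"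
proof -
  let ?P = "\<lambda>L. right_ideal L \<and> L \<subseteq> K \<and> L \<noteq> {0}"
  have "?P K" using K by simp
  \<comment> \<open>Least rank replaces minimality of a right ideal: smaller nonzero right ideals
    may exist, but they agree with \<open>L\<close> up to central factors.\<close>
  then obtain L where L: "?P L" and min: "\<And>L'. ?P L' \<Longrightarrow> rk L \<le> rk L'"
    using arg_min_nat_lemma[of ?P K rk] by blast
  have LI: "right_ideal L" using L by simp
  note LD = right_idealD[OF LI]
  obtain a0 where a0: "a0 \<in> L" "a0 \<noteq> 0" using L LD(1) by blast
  then obtain r where "a0 * r * a0 \<noteq> 0" using prime_ring[of a0 a0] by blast
  with a0 LD(3) obtain a b where ab: "a \<in> L" "b \<in> L" "a * b \<noteq> 0" by blast
  let ?aL = "(\<lambda>x. a * x) ` L"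
  have aL: "?P ?aL"
  proof (intro conjI)
    show "right_ideal ?aL" by (rule right_ideal_mult_image[OF LI])
    show "?aL \<subseteq> K" using L ab LD(3) by blast
    show "?aL \<noteq> {0}" using ab by blast
  qed
  have "?aL \<subseteq> L" using ab LD(3) by blast
  \<comment> \<open>\<open>a L\<close> lies in \<open>L\<close> and has the same rank, so a nonzero
    central multiple of \<open>a\<close> falls into it and can be written
    \<open>a * e\<close>.\<close>
  from rk_saturated[OF right_ideal_subspace this min[OF aL] ab(1)] aL obtain z e where
    z: "z \<noteq> 0" and e: "e \<in> L" "of_center z * a = a * e" by blast
  let ?ann = "{x \<in> L. a * x = 0}"
  have ann: "right_ideal ?ann" by (rule right_ideal_annihilator[OF LI])
  \<comment> \<open>Otherwise the annihilator would have the rank of \<open>L\<close> and contain a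
    central multiple of \<open>b\<close>, although \<open>a * b\<close> is nonzero.\<close>
  have ann0: "?ann = {0}"
  proof (rule ccontr)
    assume "?ann \<noteq> {0}"
    then have "?P ?ann" using ann L by blast
    from rk_saturated[OF right_ideal_subspace[OF ann] _ min[OF this] ab(2)] obtain w where
      w: "w \<noteq> 0" "of_center w * b \<in> ?ann" by blast
    then have "of_center w * (a * b) = 0" by (simp add: of_center_left_commute)
    with w ab show False using of_center_cancel by blast
  qed
  have "a * (e * e - of_center z * e) = a * e * e - of_center z * (a * e)"
    by (simp add: right_diff_distrib mult.assoc of_center_left_commute)
  also have "\<dots> = 0" by (simp add: e(2)[symmetric] mult.assoc)
  finally have "e * e - of_center z * e \<in> ?ann" using LD e by blast
  with ann0 have "e * e = of_center z * e" by simp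
  moreover have "e \<noteq> 0"
  proof
    assume "e = 0"
    with e have "of_center z * a = 0" by simp
    with z have "a = 0" using of_center_cancel by blast
    with ab show False by simp
  qed
  ultimately show ?thesis using e z L by blast
qed

text \<open>
  With denominators, \<open>e/z\<close> is an idempotent of \<open>I\<close> whose annihilator has minimal rank. An idempotent
  \<open>f/w\<close> in \<open>(1 - e/z) I\<close> would make \<open>e/z + (f/w) (1 - e/z)\<close> an idempotent with smaller annihilator,
  so \<open>1 - e/z\<close> annihilates \<open>I\<close>.
\<close>

lemma ideal_meets_center:
  fixes I :: "'r set"
  assumes I: "two_sided_ideal I" "I \<noteq> {0}"
  shows "\<exists>z. z \<noteq> 0 \<and> of_center z \<in> I"
proof -
  have RI: "right_ideal I" using I by (simp add: two_sided_ideal_def)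
  note ID = right_idealD[OF RI]
  have IL: "x * a \<in> I" if "a \<in> I" for x a using I that by (simp add: two_sided_ideal_def)
  let ?P = "\<lambda>e. e \<in> I \<and> e \<noteq> 0 \<and> (\<exists>z. z \<noteq> 0 \<and> e * e = of_center z * e)"
  let ?ann = "\<lambda>e. {x \<in> UNIV. e * x = 0}"
  have U: "right_ideal (UNIV :: 'r set)" by (simp add: right_ideal_def)
  obtain e0 where "?P e0" using quasi_idempotent_exists[OF RI I(2)] by blast
  then obtain e where e: "?P e" and min: "\<And>e'. ?P e' \<Longrightarrow> rk (?ann e) \<le> rk (?ann e')"
    using arg_min_nat_lemma[of ?P e0 "\<lambda>e. rk (?ann e)"] by blast
  then obtain z where z: "z \<noteq> 0" "e * e = of_center z * e" by blast
  let ?d = "of_center z - e"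
  have ed: "e * ?d = 0" using z by (simp add: right_diff_distrib of_center_commute[of z e])
  have "(\<lambda>x. ?d * x) ` I = {0}"
  proof (rule ccontr)
    assume "(\<lambda>x. ?d * x) ` I \<noteq> {0}"
    from quasi_idempotent_exists[OF right_ideal_mult_image[OF RI] this] obtain x w where
      x: "x \<in> I" "w \<noteq> 0" "?d * x \<noteq> 0" "(?d * x) * (?d * x) = of_center w * (?d * x)" by blast
    define f where "f = ?d * x"
    have f: "f \<in> I" "f \<noteq> 0" "f * f = of_center w * f" using x IL by (auto simp: f_def)
    have ef: "e * f = 0" using ed by (simp add: f_def mult.assoc[symmetric])
    have df: "?d * f = of_center z * f" using ef by (simp add: left_diff_distrib)
    \<comment> \<open>This is \<open>e/z + (f/w) (1 - e/z)\<close> multiplied by \<open>z w\<close>;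
      the computations below give its products with \<open>e\<close>, \<open>f\<close> and itself,
      denominators cleared.\<close>
    define g where "g = of_center w * e + f * ?d"
    have zw_scale: "of_center (z * w) * x = of_center w * (of_center z * x)" for x
      by (simp add: of_center_simps mult.assoc mult.commute[of z w])
    have "e * g = of_center w * (e * e) + (e * f) * ?d"
      by (simp only: g_def distrib_left of_center_left_commute mult.assoc)
    then have eg: "e * g = of_center (z * w) * e" using ef z by (simp add: zw_scale)
    have "g * f = of_center w * (e * f) + f * (?d * f)"
      by (simp only: g_def distrib_right mult.assoc)
    also have "f * (?d * f) = of_center z * (f * f)" unfolding df by (rule of_center_left_commute)
    finally have gf: "g * f = of_center (z * w) * f"
      by (simp add: ef f(3) of_center_simps mult.assoc)
    have zw: "z * w \<noteq> 0" using z x by simp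
    have "?d * g = of_center z * g - of_center (z * w) * e"
      by (simp only: left_diff_distrib eg)
    also have "\<dots> = of_center z * (f * ?d)"
      by (simp add: g_def distrib_left of_center_simps mult.assoc)
    finally have dg: "?d * g = of_center z * (f * ?d)" .
    have "f * (?d * g) = of_center z * ((f * f) * ?d)"
      unfolding dg of_center_left_commute[of f] mult.assoc ..
    also have "\<dots> = of_center (z * w) * (f * ?d)"
      unfolding f(3) by (simp only: zw_scale mult.assoc of_center_left_commute[of "of_center z" w])
    finally have fdg: "f * (?d * g) = of_center (z * w) * (f * ?d)" .
    have "g * g = of_center w * (e * g) + f * (?d * g)"
      by (subst (1) g_def) (simp only: distrib_right mult.assoc)
    also have "\<dots> = of_center (z * w) * g"
      unfolding fdg eg by (simp only: g_def distrib_left of_center_left_commute[of "of_center w" "z * w"])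
    finally have gg: "g * g = of_center (z * w) * g" .
    have "?P g"
    proof (intro conjI)
      show "g \<in> I" unfolding g_def by (rule ID(2)[OF ID(5) ID(3)]) (use e f in auto)
      show "g \<noteq> 0"
      proof
        assume "g = 0"
        with gf have "of_center (z * w) * f = 0" by simp
        with zw f(2) show False using of_center_cancel by blast
      qed
      show "\<exists>z. z \<noteq> 0 \<and> g * g = of_center z * g" using gg zw by blast
    qed
    then have "rk (?ann e) \<le> rk (?ann g)" by (rule min)
    \<comment> \<open>\<open>e * g\<close> is a nonzero central multiple of \<open>e\<close>, hence
      the inclusion. The rank drops because \<open>e\<close> annihilates \<open>f\<close>, while
      \<open>g * f\<close> is a nonzero central multiple of \<open>f\<close>.\<close>
    moreover have "?ann g \<subseteq> ?ann e"
    proof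
      fix y assume "y \<in> ?ann g"
      then have "e * (g * y) = 0" by simp
      then have "of_center (z * w) * (e * y) = 0" by (simp add: eg flip: mult.assoc)
      then show "y \<in> ?ann e" using zw of_center_cancel by blast
    qed
    moreover have "f \<in> ?ann e" using ef by simp
    ultimately obtain u where u: "u \<noteq> 0" "of_center u * f \<in> ?ann g"
      using rk_saturated[OF right_ideal_subspace[OF right_ideal_annihilator[OF U]]] by blast
    then have "of_center u * (of_center (z * w) * f) = 0"
      using of_center_left_commute[of g u f] by (simp add: gf)
    then show False using u zw f(2) of_center_cancel by blast
  qed
  then have d0: "?d * x = 0" if "x \<in> I" for x using that by blast
  obtain a where a: "a \<in> I" "a \<noteq> 0" using I(2) ID(1) by blast
  \<comment> \<open>Primeness now gives \<open>?d = 0\<close>, so \<open>e\<close> itself is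
    central.\<close>
  have "?d * r * a = 0" for r using d0[OF IL[OF a(1), of r]] by (simp add: mult.assoc)
  with a have "?d = 0" using prime_ring by blast
  then have "of_center z = e" by simp
  moreover have "e \<in> I" using e by blast
  ultimately show ?thesis using z(1) by (intro exI[of _ z]) simp
qed

end


section \<open>The multiplication algebra\<close>

text \<open>The image of R tensored with its opposite ring in the additive maps on R; the submodules
  of R over these operators are the two-sided ideals.\<close>

inductive_set mult_ops :: "('r::ring_1 \<Rightarrow> 'r) set" where
  id: "(\<lambda>y. y) \<in> mult_ops"
| mult: "f \<in> mult_ops \<Longrightarrow> (\<lambda>y. a * f y * b) \<in> mult_ops"
| add: "f \<in> mult_ops \<Longrightarrow> g \<in> mult_ops \<Longrightarrow> (\<lambda>y. f y + g y) \<in> mult_ops"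

lemma mult_ops_left: "f \<in> mult_ops \<Longrightarrow> (\<lambda>y. a * f y) \<in> mult_ops"
  using mult_ops.mult[of f a 1] by simp

lemma mult_ops_right: "f \<in> mult_ops \<Longrightarrow> (\<lambda>y. f y * b) \<in> mult_ops"
  using mult_ops.mult[of f 1 b] by simp

lemma mult_ops_diff: "f \<in> mult_ops \<Longrightarrow> g \<in> mult_ops \<Longrightarrow> (\<lambda>y. f y - g y) \<in> mult_ops"
  using mult_ops.add[OF _ mult_ops_left[of g "- 1"], of f] by simp

lemma mult_ops_add_apply: "f \<in> mult_ops \<Longrightarrow> f (x + y) = f x + f y"
  by (induction rule: mult_ops.induct) (simp_all add: distrib_left distrib_right add_ac)

lemma mult_ops_scale_apply: "f \<in> mult_ops \<Longrightarrow> f (of_center z * x) = of_center z * f x"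
  by (induction rule: mult_ops.induct)
    (simp_all add: distrib_left of_center_left_commute mult.assoc)

lemma mult_ops_zero: "f \<in> mult_ops \<Longrightarrow> f 0 = 0"
  by (induction rule: mult_ops.induct) simp_all

lemma mult_ops_diff_apply: "f \<in> mult_ops \<Longrightarrow> f (x - y) = f x - f y"
  using mult_ops_add_apply[of f "x - y" y] by simp

lemma mult_ops_sum: "f \<in> mult_ops \<Longrightarrow> f (sum g A) = (\<Sum>a\<in>A. f (g a))"
  by (induction A rule: infinite_finite_induct) (simp_all add: mult_ops_zero mult_ops_add_apply)

lemma mult_ops_lincomb:
  "f \<in> mult_ops \<Longrightarrow> f (\<Sum>v\<in>A. of_center (u v) * g v) = (\<Sum>v\<in>A. of_center (u v) * f (g v))"
  by (simp add: mult_ops_sum mult_ops_scale_apply)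

text \<open>Multiplying an operator on either side preserves vanishing on \<open>Y\<close>. These
  values at \<open>y\<close> play the part of the orbit under an annihilator in Jacobson
  density.\<close>

lemma ideal_mult_ops_image:
  "two_sided_ideal {f y | f. f \<in> mult_ops \<and> (\<forall>x\<in>Y. f x = 0)}" (is "two_sided_ideal ?J")
  unfolding two_sided_ideal_def right_ideal_def
proof (intro conjI ballI allI)
  have "(\<lambda>y. 0 * y) \<in> mult_ops" by (rule mult_ops_left[OF mult_ops.id])
  then show "0 \<in> ?J" by force
next
  fix a b assume "a \<in> ?J" "b \<in> ?J"
  then obtain f g where fg: "f \<in> mult_ops" "g \<in> mult_ops" "\<forall>x\<in>Y. f x = 0" "\<forall>x\<in>Y. g x = 0" "a = f y" "b = g y"
    by blast
  then show "a + b \<in> ?J"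
    by (intro CollectI exI[of _ "\<lambda>y. f y + g y"]) (auto intro: mult_ops.add)
next
  fix a r assume "a \<in> ?J"
  then obtain f where f: "f \<in> mult_ops" "\<forall>x\<in>Y. f x = 0" "a = f y" by blast
  then show "a * r \<in> ?J" by (intro CollectI exI[of _ "\<lambda>y. f y * r"]) (auto intro: mult_ops_right)
  show "r * a \<in> ?J" using f by (intro CollectI exI[of _ "\<lambda>y. r * f y"]) (auto intro: mult_ops_left)
qed

context central_frame
begin

text \<open>
  Jacobson density for \<open>R\<close> as a bimodule over itself. A bimodule map from a nonzero ideal to \<open>R\<close> is
  multiplication by a fraction of central elements, since the ideal contains some \<open>w\<close> in the center.
\<close>

lemma mult_ops_density:
  fixes Y :: "'r set" and x :: 'r
  assumes "finite Y" "\<And>f. f \<in> mult_ops \<Longrightarrow> \<forall>y\<in>Y. f y = 0 \<Longrightarrow> f x = 0"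
  shows "\<exists>w. w \<noteq> 0 \<and> of_center w * x \<in> center_module.span Y"
  using assms
proof (induction Y arbitrary: x rule: finite_induct)
  case empty
  then have "x = 0" using mult_ops.id by auto
  then show ?case by (intro exI[of _ 1]) (simp add: center_module.span_zero)
next
  case (insert y Y)
  note kill = insert.prems
  let ?J = "{f y | f. f \<in> mult_ops \<and> (\<forall>x\<in>Y. f x = 0)}"
  have mono: "center_module.span Y \<subseteq> center_module.span (insert y Y)"
    by (rule center_module.span_mono) blast
  show ?case
  proof (cases "?J = {0}")
    case True
    have "\<exists>w. w \<noteq> 0 \<and> of_center w * x \<in> center_module.span Y"
    proof (rule insert.IH)
      fix f :: "'r \<Rightarrow> 'r" assume f: "f \<in> mult_ops" "\<forall>y\<in>Y. f y = 0"
      then have "f y \<in> ?J" by blast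
      with True f show "f x = 0" by (intro kill) auto
    qed
    with mono show ?thesis by blast
  next
    case False
    from ideal_meets_center[OF ideal_mult_ops_image False] obtain w f0 where
      w: "w \<noteq> 0" and f0: "f0 \<in> mult_ops" "\<forall>x\<in>Y. f0 x = 0" "of_center w = f0 y" by blast
    \<comment> \<open>The operator \<open>f0\<close> followed by the commutator with
      \<open>r\<close> kills \<open>Y\<close> through \<open>f0\<close>, and kills \<open>y\<close>
      because \<open>f0 y\<close> is central; so it kills \<open>x\<close>.\<close>
    have "f0 x * r = r * f0 x" for r
    proof -
      have "f0 x * r - r * f0 x = 0"
        by (rule kill[of "\<lambda>x. f0 x * r - r * f0 x"])
          (use f0 in \<open>auto intro!: mult_ops_diff mult_ops_left mult_ops_right simp flip: f0(3) simp: of_center_commute[of w r]\<close>)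
      then show ?thesis by simp
    qed
    then obtain t where t: "f0 x = of_center t" using in_center by blast
    \<comment> \<open>The bimodule map from \<open>f y\<close> to \<open>f x\<close> sends
      \<open>w\<close> to \<open>t\<close>, so it is multiplication by \<open>t/w\<close>; the
      induction hypothesis applies to \<open>x - (t/w) y\<close>, cleared of its
      denominator.\<close>
    let ?x = "of_center w * x - of_center t * y"
    have "\<exists>v. v \<noteq> 0 \<and> of_center v * ?x \<in> center_module.span Y"
    proof (rule insert.IH)
      fix f :: "'r \<Rightarrow> 'r" assume f: "f \<in> mult_ops" "\<forall>y\<in>Y. f y = 0"
      have "f0 x * f y - of_center w * f x = 0"
        by (rule kill[of "\<lambda>x. f0 x * f y - of_center w * f x"])
          (use f f0 in \<open>auto intro!: mult_ops_diff mult_ops_left mult_ops_right simp flip: f0(3)\<close>)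
      then show "f ?x = 0"
        by (simp add: mult_ops_diff_apply[OF f(1)] mult_ops_scale_apply[OF f(1)] t)
    qed
    then obtain v where v: "v \<noteq> 0" "of_center v * ?x \<in> center_module.span Y" by blast
    have "center_scale (v * t) y \<in> center_module.span (insert y Y)"
      by (intro center_module.span_scale center_module.span_base) simp
    from center_module.span_add[OF subsetD[OF mono v(2)] this]
    have "of_center (v * w) * x \<in> center_module.span (insert y Y)"
      by (simp add: center_scale_eq right_diff_distrib of_center_simps mult.assoc)
    with v w show ?thesis by (intro exI[of _ "v * w"]) auto
  qed
qed

text \<open>If every operator vanishing on the rest of \<open>X\<close> killed \<open>x\<close>,
  density would make a central multiple of \<open>x\<close> a combination of the rest. So the values
  at \<open>x\<close> form a nonzero ideal, which contains a nonzero central element.\<close>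

lemma dual_mult_ops:
  assumes x: "x \<in> X"
  shows "\<exists>f\<in>mult_ops. \<exists>w. w \<noteq> 0 \<and> f x = of_center w \<and> (\<forall>y\<in>X - {x}. f y = 0)"
proof -
  let ?J = "{f x | f. f \<in> mult_ops \<and> (\<forall>y\<in>X - {x}. f y = 0)}"
  have "?J \<noteq> {0}"
  proof
    assume J: "?J = {0}"
    have "\<exists>w. w \<noteq> 0 \<and> of_center w * x \<in> center_module.span (X - {x})"
      using J finite_X by (intro mult_ops_density) auto
    then obtain w u where w: "w \<noteq> 0" "of_center w * x = (\<Sum>v\<in>X - {x}. center_scale (u v) v)"
      using center_module.span_finite[of "X - {x}"] finite_X by auto
    let ?u = "\<lambda>v. if v = x then - w else u v"
    have "(\<Sum>v\<in>X. center_scale (?u v) v) = 0"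
      using x w finite_X by (simp add: sum.remove[of X x] center_scale_eq of_center_simps)
    then have "?u x = 0" using independent_X finite_X x
      by (intro center_module.independentD[of X X ?u]) auto
    with w show False by simp
  qed
  from ideal_meets_center[OF ideal_mult_ops_image this] obtain w f where
    "w \<noteq> 0" "f \<in> mult_ops" "\<forall>y\<in>X - {x}. f y = 0" "of_center w = f x" by blast
  then show ?thesis by (intro bexI[of _ f] exI[of _ w]) auto
qed

end

section \<open>The rank over the center\<close>

text \<open>The additive extension of \<open>\<phi>\<close> to the free abelian group, from which
  functionals on the tensor product are obtained.\<close>

definition frag_eval :: "('a \<Rightarrow> 'q::comm_ring_1) \<Rightarrow> ('a \<Rightarrow>\<^sub>0 int) \<Rightarrow> 'q" where
  "frag_eval \<phi> x = (\<Sum>k\<in>Poly_Mapping.keys x. of_int (poly_mapping.lookup x k) * \<phi> k)"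

lemma frag_eval_superset:
  assumes "finite K" "Poly_Mapping.keys x \<subseteq> K"
  shows "frag_eval \<phi> x = (\<Sum>k\<in>K. of_int (poly_mapping.lookup x k) * \<phi> k)"
  unfolding frag_eval_def using assms
  by (intro sum.mono_neutral_left) (auto simp: in_keys_iff)

lemma frag_eval_diff: "frag_eval \<phi> (x - y) = frag_eval \<phi> x - frag_eval \<phi> y"
proof -
  let ?K = "Poly_Mapping.keys x \<union> Poly_Mapping.keys y"
  have "Poly_Mapping.keys (x - y) \<subseteq> ?K" by (rule Poly_Mapping.keys_diff)
  then show ?thesis
    by (simp add: frag_eval_superset[of ?K] Poly_Mapping.lookup_minus left_diff_distrib sum_subtractf)
qed

lemma frag_eval_add: "frag_eval \<phi> (x + y) = frag_eval \<phi> x + frag_eval \<phi> y"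
  using frag_eval_diff[of \<phi> "x + y" y] by simp

lemma frag_eval_of: "frag_eval \<phi> (frag_of k) = \<phi> k"
  by (simp add: frag_eval_def)

lemma frag_eval_zero: "frag_eval \<phi> 0 = 0"
  by (simp add: frag_eval_def)

section \<open>The tensor product with the fraction field has basis \<open>X\<close>\<close>

definition tensor_emb :: "'r::prime_ring \<Rightarrow> 'r center_tensor" where
  "tensor_emb a = abs_center_tensor (frag_of (a, 1))"

lemma tensor_emb_add: "tensor_emb (a + b) = tensor_emb a + tensor_emb b"
  unfolding tensor_emb_def plus_center_tensor.abs_eq center_tensor.abs_eq_iff tensor_rel_def
  using tensor_null.add_left[of a b 1] by (simp add: algebra_simps)

lemma tensor_emb_scale: "tensor_emb (center_scale z a) = tensor_scale (Fract z 1) (tensor_emb a)"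
  unfolding tensor_emb_def tensor_scale.abs_eq tensor_scale_raw_simps center_tensor.abs_eq_iff tensor_rel_def
  using tensor_null.balanced[of z a 1] by simp

lemma tensor_emb_sum:
  fixes f :: "'i \<Rightarrow> 'r::prime_ring"
  shows "tensor_emb (\<Sum>i\<in>I. f i) = (\<Sum>i\<in>I. tensor_emb (f i))"
proof -
  have "tensor_emb (0 :: 'r) = 0" using tensor_emb_add[of 0 "0 :: 'r"] by simp
  then show ?thesis by (induction I rule: infinite_finite_induct) (simp_all add: tensor_emb_add)
qed

text \<open>The elements \<open>a \<otimes> q\<close>, equal to \<open>q\<close> times
  \<open>a \<otimes> 1\<close>, generate the tensor product as a group.\<close>

lemma tensor_induct:
  assumes "\<And>a q. P (tensor_scale q (tensor_emb a))" "\<And>s t. P s \<Longrightarrow> P t \<Longrightarrow> P (s - t)"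
  shows "P t"
proof -
  have P: "P (abs_center_tensor x)" for x
  proof -
    have z: "P 0" using assms(1)[of 0 0] by simp
    have "Poly_Mapping.keys x \<subseteq> UNIV" by simp
    then show ?thesis
    proof (induction rule: frag_induction)
      case zero
      show ?case using z by (simp add: zero_center_tensor_def)
    next
      case (one i)
      obtain a q where i: "i = (a, q)" by (cases i)
      show ?case using assms(1)[of q a]
        unfolding tensor_emb_def tensor_scale.abs_eq tensor_scale_raw_simps i by simp
    next
      case (diff a b)
      then show ?case using assms(2) unfolding minus_center_tensor.abs_eq[symmetric] by blast
    qed
  qed
  show ?thesis using P[of "rep_center_tensor t"] Quotient_abs_rep[OF Quotient_center_tensor] by metis
qed

context central_frame
begin

text \<open>Multiplication by \<open>c\<close> carries \<open>a\<close> into the span of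
  \<open>X\<close>, where coordinates exist; the denominator \<open>c\<close> undoes it.\<close>

definition coord :: "'r \<Rightarrow> 'r \<Rightarrow> 'r center fract" where
  "coord v a = Fract (center_module.representation X (center_scale c a) v) c"

lemma c_span': "center_scale c a \<in> center_module.span X"
  using c_span[of a] by (simp only: center_scale_eq)

lemma coord_add: "coord v (a + b) = coord v a + coord v b"
proof -
  have "center_module.representation X (center_scale c (a + b)) v
      = center_module.representation X (center_scale c a) v + center_module.representation X (center_scale c b) v"
    by (simp add: center_module.scale_right_distrib center_module.representation_add[OF independent_X c_span' c_span'])
  then show ?thesis using c_nonzero
    by (simp add: coord_def eq_fract distrib_right)
qed

lemma coord_scale: "coord v (center_scale z a) = Fract z 1 * coord v a"
proof -
  have "center_scale c (center_scale z a) = center_scale z (center_scale c a)"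
    by (rule center_module.scale_left_commute)
  then have "center_module.representation X (center_scale c (center_scale z a)) v
      = z * center_module.representation X (center_scale c a) v"
    by (simp only: center_module.representation_scale[OF independent_X c_span'])
  then show ?thesis unfolding coord_def by simp
qed

lemma coord_basis: "w \<in> X \<Longrightarrow> coord v w = (if v = w then 1 else 0)"
  using c_nonzero
  by (simp add: coord_def center_module.representation_scale[OF independent_X center_module.span_base]
      center_module.representation_basis[OF independent_X] One_fract_def Zero_fract_def eq_fract)

text \<open>The functional sending \<open>a \<otimes> q\<close> to \<open>coord v a * q\<close>,
  read on a representative; \<open>frag_eval_null\<close> makes the choice harmless. These
  functionals are dual to the images of \<open>X\<close> and prove their independence.\<close>

definition tensor_coord :: "'r \<Rightarrow> 'r center_tensor \<Rightarrow> 'r center fract" where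
  "tensor_coord v t = frag_eval (\<lambda>(a, q). coord v a * q) (rep_center_tensor t)"

lemma frag_eval_null:
  "x \<in> tensor_null \<Longrightarrow> frag_eval (\<lambda>(a, q). coord v a * q) x = 0"
  by (induction rule: tensor_null.induct)
    (simp_all add: frag_eval_diff frag_eval_add frag_eval_of frag_eval_zero coord_add coord_scale algebra_simps)

lemma tensor_coord_abs:
  "tensor_coord v (abs_center_tensor x) = frag_eval (\<lambda>(a, q). coord v a * q) x"
proof -
  have "tensor_rel (rep_center_tensor (abs_center_tensor x)) x"
    by (rule Quotient_rep_abs[OF Quotient_center_tensor]) (simp add: tensor_rel_def tensor_null.zero)
  then have "rep_center_tensor (abs_center_tensor x) - x \<in> tensor_null" by (simp only: tensor_rel_def)
  from frag_eval_null[OF this, of v] show ?thesis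
    by (simp add: tensor_coord_def frag_eval_diff)
qed

lemma abs_center_tensor_surj: "\<exists>x. t = abs_center_tensor x"
  by (metis Quotient_abs_rep[OF Quotient_center_tensor])

lemma tensor_coord_diff: "tensor_coord v (s - t) = tensor_coord v s - tensor_coord v t"
proof -
  obtain x y where "s = abs_center_tensor x" "t = abs_center_tensor y"
    using abs_center_tensor_surj by metis
  then show ?thesis
    by (simp add: minus_center_tensor.abs_eq tensor_coord_abs frag_eval_diff)
qed

lemma tensor_coord_add: "tensor_coord v (s + t) = tensor_coord v s + tensor_coord v t"
  using tensor_coord_diff[of v "s + t" t] by simp

lemma tensor_coord_emb: "tensor_coord v (tensor_scale q (tensor_emb a)) = coord v a * q"
  unfolding tensor_emb_def tensor_scale.abs_eq tensor_scale_raw_simps tensor_coord_abs frag_eval_of by simp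

lemma tensor_coord_sum:
  "tensor_coord v (\<Sum>i\<in>I. tensor_scale (u i) (tensor_emb (f i))) = (\<Sum>i\<in>I. coord v (f i) * u i)"
proof -
  have "tensor_coord v 0 = 0" using tensor_coord_diff[of v 0 0] by simp
  then show ?thesis
    by (induction I rule: infinite_finite_induct) (simp_all add: tensor_coord_add tensor_coord_emb)
qed

lemma tensor_emb_inj: "inj_on tensor_emb X"
proof (rule inj_onI)
  fix v w assume vw: "v \<in> X" "w \<in> X" "tensor_emb v = tensor_emb w"
  have "tensor_coord v (tensor_scale 1 (tensor_emb v)) = tensor_coord v (tensor_scale 1 (tensor_emb w))"
    using vw by simp
  then have "coord v v = coord v w" by (simp only: tensor_coord_emb mult_1_right)
  then show "v = w" using vw(1,2) by (simp add: coord_basis split: if_splits)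
qed

lemma tensor_emb_independent: "\<not> center_tensor.dependent (tensor_emb ` X)"
proof
  assume "center_tensor.dependent (tensor_emb ` X)"
  then obtain u where u: "\<exists>t\<in>tensor_emb ` X. u t \<noteq> 0" "(\<Sum>t\<in>tensor_emb ` X. tensor_scale (u t) t) = 0"
    using center_tensor.dependent_finite[of "tensor_emb ` X"] finite_X by auto
  have *: "(\<Sum>v\<in>X. tensor_scale (u (tensor_emb v)) (tensor_emb v)) = 0"
    using u(2) by (simp add: sum.reindex[OF tensor_emb_inj])
  have "u (tensor_emb v) = 0" if v: "v \<in> X" for v
  proof -
    have "(\<Sum>w\<in>X. coord v w * u (tensor_emb w)) = 0"
      using arg_cong[OF *, of "tensor_coord v"] tensor_coord_diff[of v 0 0]
      by (simp add: tensor_coord_sum)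
    moreover have "(\<Sum>w\<in>X. coord v w * u (tensor_emb w)) = (\<Sum>w\<in>X. if v = w then u (tensor_emb w) else 0)"
      by (rule sum.cong) (simp_all add: coord_basis)
    ultimately show ?thesis using v finite_X by simp
  qed
  with u(1) show False by auto
qed

lemma tensor_emb_span: "center_tensor.span (tensor_emb ` X) = UNIV"
proof -
  have emb: "tensor_emb a \<in> center_tensor.span (tensor_emb ` X)" for a
  proof -
    obtain u where "center_scale c a = (\<Sum>v\<in>X. center_scale (u v) v)"
      using coordinates[of a] by (auto simp only: center_scale_eq)
    then have "tensor_scale (Fract c 1) (tensor_emb a) = (\<Sum>v\<in>X. tensor_scale (Fract (u v) 1) (tensor_emb v))"
      by (simp flip: tensor_emb_scale tensor_emb_sum)
    also have "\<dots> \<in> center_tensor.span (tensor_emb ` X)"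
      by (intro center_tensor.span_sum center_tensor.span_scale center_tensor.span_base) simp
    finally have "tensor_scale (Fract 1 c) (tensor_scale (Fract c 1) (tensor_emb a)) \<in> center_tensor.span (tensor_emb ` X)"
      by (rule center_tensor.span_scale)
    moreover have "Fract 1 c * Fract c 1 = 1" using c_nonzero by (simp add: One_fract_def eq_fract)
    ultimately show ?thesis by simp
  qed
  have "t \<in> center_tensor.span (tensor_emb ` X)" for t
    by (induction t rule: tensor_induct) (auto intro: center_tensor.span_scale emb center_tensor.span_diff)
  then show ?thesis by blast
qed

lemma center_rank_eq: "center_rank TYPE('r) = card X"
proof -
  have "center_tensor.dim (UNIV :: 'r center_tensor set) = card (tensor_emb ` X)"
    by (rule center_tensor.dim_eq_card) (simp_all add: tensor_emb_span tensor_emb_independent)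
  then show ?thesis by (simp add: center_rank_def card_image[OF tensor_emb_inj])
qed

end


section \<open>Dimensions and fibers\<close>

lemma (in matrix_rep) mult_ops_kernel:
  assumes "f \<in> mult_ops" "\<rho> y = 0\<^sub>m n n"
  shows "\<rho> (f y) = 0\<^sub>m n n"
proof -
  note rho_mult = mult and rho_add = add
  show ?thesis using assms
  proof (induction rule: mult_ops.induct)
    case (mult f a b)
    then show ?case by (simp add: rho_mult left_mult_zero_mat[OF carrier] right_mult_zero_mat[OF carrier])
  qed (simp_all add: rho_add)
qed

lemma (in matrix_rep) lincomb_entry:
  assumes "finite A" "i < n" "j < n"
  shows "\<rho> (\<Sum>a\<in>A. of_center (\<iota> (l a)) * g a) $$ (i, j) = (\<Sum>a\<in>A. l a * \<rho> (g a) $$ (i, j))"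
  using assms by (simp add: sum scale)

lemma (in alg_closed_irrep) center_lincomb_entry:
  assumes "finite A" "i < n" "j < n"
  shows "\<rho> (\<Sum>a\<in>A. of_center (z a) * g a) $$ (i, j) = (\<Sum>a\<in>A. central_character \<iota> \<rho> (z a) * \<rho> (g a) $$ (i, j))"
  using assms by (simp add: sum rep_center_mult)

lemma (in alg_closed_irrep) kernel_eq_iff: "\<rho> x = 0\<^sub>m n n \<longleftrightarrow> (\<forall>i<n. \<forall>j<n. \<rho> x $$ (i, j) = 0)"
  by (auto intro!: eq_matI)

lemma (in alg_closed_irrep) character_hom: "comm_ring_hom (central_character \<iota> \<rho>)"
  "central_character \<iota> \<rho> (\<iota> a) = a"
  using central_character(1) by (auto simp: center_homs_def)

context central_frame
begin

text \<open>
  The operators \<open>y \<mapsto> \<Sum>\<^sub>l x\<^sub>l\<^sub>i y x\<^sub>j\<^sub>l\<close>, for lifts \<open>x\<^sub>i\<^sub>j\<close> of the matrix units, extract matrix entries modulo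
  the kernel of \<open>\<rho>\<close>. Hence the lifts are independent over the center.
\<close>

lemma dim_squared_le:
  fixes \<iota> :: "'k::alg_closed_field \<Rightarrow> 'r center"
  assumes "alg_closed_irrep \<iota> n \<rho>"
  shows "n * n \<le> card X"
proof (rule ccontr)
  interpret alg_closed_irrep \<iota> n \<rho> by fact
  let ?I = "{..<n} \<times> {..<n}"
  assume "\<not> n * n \<le> card X"
  then have big: "finite ?I" "card X < card ?I" by simp_all
  have "\<exists>x. \<rho> x = mat n n (\<lambda>ab. if ab = p then 1 else 0)" for p
    by (rule burnside) simp
  then obtain x where x: "\<And>p. \<rho> (x p) = mat n n (\<lambda>ab. if ab = p then 1 else 0)" by metis
  have act: "\<rho> (x (i, j)) *\<^sub>v unit_vec n s = (if s = j then unit_vec n i else 0\<^sub>v n)"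
    if "s < n" for i j s
    unfolding x mat_unit_vec_col[OF mat_carrier that] using that by (auto simp: unit_vec_def intro!: eq_vecI)
  from relation_exists[OF big, of x] obtain z where
    z: "\<exists>p\<in>?I. z p \<noteq> 0" "(\<Sum>p\<in>?I. of_center (z p) * x p) = 0" by blast
  \<comment> \<open>The operator with index \<open>q\<close> applied to the lift \<open>x p\<close>:
    modulo the kernel of \<open>\<rho>\<close> it gives 1 if \<open>q = p\<close> and 0
    otherwise.\<close>
  define m where "m q p = (\<Sum>l<n. x (l, fst q) * x p * x (snd q, l))" for q p
  have m_mod: "\<rho> ((if q = p then 1 else 0) - m q p) = 0\<^sub>m n n" if pq: "q \<in> ?I" "p \<in> ?I" for p q
  proof -
    obtain i j a b where ij: "q = (i, j)" "p = (a, b)" "i < n" "j < n" "a < n" "b < n" using pq by auto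
    have "\<rho> (m q p) *\<^sub>v unit_vec n s = \<rho> (if q = p then 1 else 0) *\<^sub>v unit_vec n s" if s: "s < n" for s
    proof (rule eq_vecI)
      fix t assume "t < dim_vec (\<rho> (if q = p then 1 else 0) *\<^sub>v unit_vec n s)"
      then have t: "t < n" by simp
      have z0: "\<rho> r *\<^sub>v 0\<^sub>v n = 0\<^sub>v n" for r by (auto intro!: eq_vecI)
      have "\<rho> (x (l, i) * x p * x (j, l)) *\<^sub>v unit_vec n s
          = (if s = l \<and> q = p then unit_vec n s else 0\<^sub>v n)" if "l < n" for l
        using that s ij by (auto simp: act_mult act z0)
      then have "(\<rho> (m q p) *\<^sub>v unit_vec n s) $ t
          = (\<Sum>l<n. (if s = l \<and> q = p then unit_vec n s else 0\<^sub>v n) $ t)"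
        unfolding m_def using t ij by (subst act_sum) auto
      also have "\<dots> = (\<Sum>l<n. if s = l then (if q = p then unit_vec n s $ t else 0) else 0)"
        using t by (intro sum.cong) auto
      also have "\<dots> = (\<rho> (if q = p then 1 else 0) *\<^sub>v unit_vec n s) $ t"
        using s t by (simp add: one zero)
      finally show "(\<rho> (m q p) *\<^sub>v unit_vec n s) $ t = (\<rho> (if q = p then 1 else 0) *\<^sub>v unit_vec n s) $ t" .
    qed simp
    then show ?thesis
      by (intro mat_eq_if_action_eq[of _ n n]) (auto simp: act_diff intro!: eq_vecI)
  qed
  have "of_center (z q) = 0" if q: "q \<in> ?I" for q
  proof (rule unipotent_system_trivial[where I = ?I and S = UNIV and P = "{a. \<rho> a = 0\<^sub>m n n}" and
        T = "range of_center" and z = "\<lambda>p. of_center (z p)" and m = m])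
    show "s * t = t * s" if "t \<in> range of_center" for s t :: 'r
      using that of_center_commute by (metis rangeE)
    show "t = 0" if st: "1 - s \<in> {a. \<rho> a = 0\<^sub>m n n}" "t \<in> range of_center" "s * t = 0" for s t :: 'r
    proof -
      obtain w where w: "t = of_center w" using st(2) by blast
      \<comment> \<open>The roles are reversed compared with Nakayama: \<open>t\<close> is central
        here, so a nonzero \<open>s\<close> suffices for cancellation.\<close>
      have "s \<noteq> 0"
      proof
        assume "s = 0"
        with st(1) have "1\<^sub>m n = (0\<^sub>m n n :: 'k mat)" by (simp add: one)
        from arg_cong[OF this, of "\<lambda>M. M $$ (0, 0)"] dim_pos show False by simp
      qed
      moreover have "of_center w * s = 0" using st(3) w of_center_commute by metis
      ultimately have "w = 0" using of_center_cancel by blast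
      with w show ?thesis by (simp add: of_center_simps)
    qed
    \<comment> \<open>Central coefficients pass through the operators, so this is an operator
      applied to the relation.\<close>
    show "(\<Sum>p\<in>?I. m q p * of_center (z p)) = 0" for q
    proof -
      have "(\<Sum>p\<in>?I. m q p * of_center (z p))
          = (\<Sum>p\<in>?I. \<Sum>l<n. x (l, fst q) * (of_center (z p) * x p) * x (snd q, l))"
        unfolding m_def sum_distrib_right
      proof (intro sum.cong refl)
        fix p l
        show "x (l, fst q) * x p * x (snd q, l) * of_center (z p)
            = x (l, fst q) * (of_center (z p) * x p) * x (snd q, l)"
          by (metis mult.assoc of_center_commute)
      qed
      also have "\<dots> = (\<Sum>l<n. x (l, fst q) * (\<Sum>p\<in>?I. of_center (z p) * x p) * x (snd q, l))"
        by (subst sum.swap) (simp only: sum_distrib_left sum_distrib_right)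
      also have "\<dots> = 0" by (simp add: z(2))
      finally show ?thesis .
    qed
    show "a + b \<in> {a. \<rho> a = 0\<^sub>m n n}" if "a \<in> {a. \<rho> a = 0\<^sub>m n n}" "b \<in> {a. \<rho> a = 0\<^sub>m n n}" for a b
      using that by (simp add: add)
    show "a * b \<in> {a. \<rho> a = 0\<^sub>m n n}" if "b \<in> {a. \<rho> a = 0\<^sub>m n n}" for a b
      using that by (simp add: mult right_mult_zero_mat[OF carrier])
    show "a * b \<in> {a. \<rho> a = 0\<^sub>m n n}" if "a \<in> {a. \<rho> a = 0\<^sub>m n n}" for a b
      using that by (simp add: mult left_mult_zero_mat[OF carrier])
    show "(if i = j then 1 else 0) - m i j \<in> {a. \<rho> a = 0\<^sub>m n n}" if "i \<in> ?I" "j \<in> ?I" for i j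
      using m_mod[OF that] by simp
  qed (use q in auto)
  with z(1) show False by (auto simp: of_center_eq_0_iff)
qed

text \<open>Applying \<open>f x\<close> to a relation among the images of \<open>X\<close> stays in
  the kernel of \<open>\<rho>\<close> and leaves \<open>l x\<close> times the scalar by which
  \<open>w x\<close> acts. The element \<open>d\<close> is fixed before the representation, so it
  cuts out a single open set.\<close>

lemma independent_locus:
  "\<exists>d. d \<noteq> 0 \<and> (\<forall>(\<iota> :: 'k::alg_closed_field \<Rightarrow> 'r center) n \<rho>. alg_closed_irrep \<iota> n \<rho> \<longrightarrow>
     central_character \<iota> \<rho> d \<noteq> 0 \<longrightarrow> central_character \<iota> \<rho> c \<noteq> 0 \<and>
     (\<forall>l. \<rho> (\<Sum>x\<in>X. of_center (\<iota> (l x)) * x) = 0\<^sub>m n n \<longrightarrow> (\<forall>x\<in>X. l x = 0)))"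
proof -
  have "\<forall>x. \<exists>f w. x \<in> X \<longrightarrow> f \<in> mult_ops \<and> w \<noteq> 0 \<and> f x = of_center w \<and> (\<forall>y\<in>X - {x}. f y = 0)"
    using dual_mult_ops by blast
  then obtain f w where fw: "\<And>x. x \<in> X \<Longrightarrow> f x \<in> mult_ops" "\<And>x. x \<in> X \<Longrightarrow> w x \<noteq> 0"
    "\<And>x. x \<in> X \<Longrightarrow> f x x = of_center (w x)" "\<And>x y. x \<in> X \<Longrightarrow> y \<in> X \<Longrightarrow> y \<noteq> x \<Longrightarrow> f x y = 0"
    by (metis Diff_iff singletonD)
  \<comment> \<open>A character that is nonzero at this product is nonzero at \<open>c\<close> and
    at every \<open>w x\<close>.\<close>
  let ?d = "c * (\<Prod>x\<in>X. w x)"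
  have "?d \<noteq> 0" using c_nonzero fw(2) finite_X by simp
  moreover have "central_character \<iota> \<rho> c \<noteq> 0 \<and>
      (\<forall>l. \<rho> (\<Sum>x\<in>X. of_center (\<iota> (l x)) * x) = 0\<^sub>m n n \<longrightarrow> (\<forall>x\<in>X. l x = 0))"
    if irr: "alg_closed_irrep \<iota> n \<rho>" and nz: "central_character \<iota> \<rho> ?d \<noteq> 0"
    for \<iota> :: "'k \<Rightarrow> 'r center" and n \<rho>
  proof (intro conjI allI impI ballI)
    interpret alg_closed_irrep \<iota> n \<rho> by fact
    interpret \<chi>: comm_ring_hom "central_character \<iota> \<rho>" by (rule character_hom)
    show "central_character \<iota> \<rho> c \<noteq> 0" using nz by (auto simp: \<chi>.hom_mult)
    fix l x assume l: "\<rho> (\<Sum>x\<in>X. of_center (\<iota> (l x)) * x) = 0\<^sub>m n n" and x: "x \<in> X"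
    have "?d = c * (\<Prod>y\<in>X - {x}. w y) * w x" using finite_X x by (simp add: prod.remove[of X x] ac_simps)
    then have wx: "central_character \<iota> \<rho> (w x) \<noteq> 0" using nz by (auto simp: \<chi>.hom_mult)
    have "f x (\<Sum>y\<in>X. of_center (\<iota> (l y)) * y) = (\<Sum>y\<in>X. of_center (\<iota> (l y)) * f x y)"
      by (rule mult_ops_lincomb[OF fw(1)[OF x]])
    also have "\<dots> = (\<Sum>y\<in>X. if y = x then of_center (\<iota> (l y)) * of_center (w y) else 0)"
      using fw x by (intro sum.cong) auto
    also have "\<dots> = of_center (\<iota> (l x)) * of_center (w x)" using x finite_X by simp
    finally have "\<rho> (of_center (\<iota> (l x)) * of_center (w x)) = 0\<^sub>m n n"
      using mult_ops_kernel[OF fw(1)[OF x] l] by simp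
    then have "l x \<cdot>\<^sub>m (central_character \<iota> \<rho> (w x) \<cdot>\<^sub>m 1\<^sub>m n) = 0\<^sub>m n n"
      by (simp add: scale central_character(2))
    from arg_cong[OF this, of "\<lambda>M. M $$ (0, 0)"] wx dim_pos show "l x = 0" by simp
  qed
  ultimately show ?thesis by blast
qed

text \<open>\<open>d\<close> cuts out the complement of the set \<open>V\<close> of the theorem.\<close>

lemma azumaya_locus:
  "\<exists>d. d \<noteq> 0 \<and> (\<forall>(\<iota> :: 'k::alg_closed_field \<Rightarrow> 'r center) n \<rho>. alg_closed_irrep \<iota> n \<rho> \<longrightarrow>
     central_character \<iota> \<rho> d \<noteq> 0 \<longrightarrow> n * n = card X \<and>
     (\<forall>m \<sigma>. alg_closed_irrep \<iota> m \<sigma> \<longrightarrow> central_character \<iota> \<sigma> = central_character \<iota> \<rho> \<longrightarrow>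
       (\<rho>, \<sigma>) \<in> rep_equiv \<iota>))"
proof -
  from independent_locus obtain d where d: "d \<noteq> 0" and
    indep: "\<And>(\<iota> :: 'k \<Rightarrow> 'r center) n \<rho> l x. alg_closed_irrep \<iota> n \<rho> \<Longrightarrow> central_character \<iota> \<rho> d \<noteq> 0 \<Longrightarrow>
      \<rho> (\<Sum>x\<in>X. of_center (\<iota> (l x)) * x) = 0\<^sub>m n n \<Longrightarrow> x \<in> X \<Longrightarrow> l x = 0" and
    c: "\<And>(\<iota> :: 'k \<Rightarrow> 'r center) n \<rho> l x. alg_closed_irrep \<iota> n \<rho> \<Longrightarrow> central_character \<iota> \<rho> d \<noteq> 0 \<Longrightarrow>
      central_character \<iota> \<rho> c \<noteq> 0" by blast
  have "n * n = card X \<and> (\<forall>m \<sigma>. alg_closed_irrep \<iota> m \<sigma> \<longrightarrow>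
      central_character \<iota> \<sigma> = central_character \<iota> \<rho> \<longrightarrow> (\<rho>, \<sigma>) \<in> rep_equiv \<iota>)"
    if irr: "alg_closed_irrep \<iota> n \<rho>" and nz: "central_character \<iota> \<rho> d \<noteq> 0"
    for \<iota> :: "'k \<Rightarrow> 'r center" and n \<rho>
  proof (intro conjI allI impI)
    interpret \<rho>: alg_closed_irrep \<iota> n \<rho> by fact
    let ?\<chi> = "central_character \<iota> \<rho>"
    note indep = indep[OF irr nz] and c = c[OF irr nz]
    \<comment> \<open>The images of \<open>X\<close> are independent in a space of dimension
      \<open>n * n\<close>.\<close>
    have "card X \<le> n * n"
    proof (rule ccontr)
      assume "\<not> card X \<le> n * n"
      then obtain l where l: "\<exists>x\<in>X. l x \<noteq> 0" "\<forall>p\<in>{..<n} \<times> {..<n}. (\<Sum>x\<in>X. \<rho> x $$ p * l x) = 0"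
        using homogeneous_system_nontrivial[of "{..<n} \<times> {..<n}" X "\<lambda>p x. \<rho> x $$ p"] finite_X by auto
      have "\<rho> (\<Sum>x\<in>X. of_center (\<iota> (l x)) * x) = 0\<^sub>m n n"
        unfolding \<rho>.kernel_eq_iff using l(2)
        by (auto simp: \<rho>.lincomb_entry[OF finite_X] mult.commute)
      with indep[of l] l(1) show False by blast
    qed
    with dim_squared_le[OF irr] show "n * n = card X" by simp
    fix m \<sigma> assume irr': "alg_closed_irrep \<iota> m \<sigma>" and eq: "central_character \<iota> \<sigma> = ?\<chi>"
    interpret \<sigma>: alg_closed_irrep \<iota> m \<sigma> by fact
    show "(\<rho>, \<sigma>) \<in> rep_equiv \<iota>"
    proof (rule rep_equiv_if_kernel_subset[OF irr irr'])
      fix y assume y: "\<rho> y = 0\<^sub>m n n"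
      \<comment> \<open>Both representations reduce the coefficients \<open>u x\<close> by the same
        character. Independence under \<open>\<rho>\<close> makes the reduced coefficients vanish;
        then \<open>\<sigma>\<close> kills \<open>of_center c * y\<close>, hence
        \<open>y\<close>.\<close>
      obtain u where u: "of_center c * y = (\<Sum>x\<in>X. of_center (u x) * x)" using coordinates by blast
      have "\<rho> (of_center c * y) = 0\<^sub>m n n" unfolding \<rho>.rep_center_mult y by (auto intro!: eq_matI)
      then have "\<rho> (\<Sum>x\<in>X. of_center (\<iota> (?\<chi> (u x))) * x) = 0\<^sub>m n n"
        unfolding u \<rho>.kernel_eq_iff by (simp add: \<rho>.lincomb_entry[OF finite_X] \<rho>.center_lincomb_entry[OF finite_X])
      then have 0: "?\<chi> (u x) = 0" if "x \<in> X" for x using indep[of "\<lambda>x. ?\<chi> (u x)"] that by blast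
      have "\<sigma> (of_center c * y) = 0\<^sub>m m m"
        unfolding u \<sigma>.kernel_eq_iff by (simp add: \<sigma>.center_lincomb_entry[OF finite_X] eq 0)
      then have *: "?\<chi> c \<cdot>\<^sub>m \<sigma> y = 0\<^sub>m m m" unfolding \<sigma>.rep_center_mult eq .
      have "\<sigma> y $$ (i, j) = 0" if "i < m" "j < m" for i j
        using arg_cong[OF *, of "\<lambda>M. M $$ (i, j)"] c that by simp
      then show "\<sigma> y = 0\<^sub>m m m" unfolding \<sigma>.kernel_eq_iff by blast
    qed
  qed
  with d show ?thesis by blast
qed

end

text \<open>The kernel of \<open>\<rho>\<close> is prime, so elements that separate
  \<open>\<rho>\<close> from one \<open>\<sigma>\<close> at a time can be multiplied, with a
  suitable factor in between, without falling into that kernel.\<close>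

lemma separating_element:
  fixes \<iota> :: "'k::alg_closed_field \<Rightarrow> 'r::ring_1 center"
  assumes \<rho>: "irreducible_rep \<iota> \<rho>" and "finite S"
    and "\<And>\<sigma>. \<sigma> \<in> S \<Longrightarrow> irreducible_rep \<iota> \<sigma>"
    and "\<And>\<sigma>. \<sigma> \<in> S \<Longrightarrow> (\<sigma>, \<rho>) \<notin> rep_equiv \<iota>"
  shows "\<exists>x. \<rho> x \<noteq> 0\<^sub>m (rep_dim \<rho>) (rep_dim \<rho>) \<and> (\<forall>\<sigma>\<in>S. \<sigma> x = 0\<^sub>m (rep_dim \<sigma>) (rep_dim \<sigma>))"
  using assms(2-4)
proof (induction S rule: finite_induct)
  interpret \<rho>: alg_closed_irrep \<iota> "rep_dim \<rho>" \<rho> by (rule alg_closed_irrepI[OF \<rho>])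
  {
    case empty
    have "\<rho> 1 $$ (0, 0) \<noteq> 0" using \<rho>.dim_pos by (simp add: \<rho>.one)
    then have "\<rho> 1 \<noteq> 0\<^sub>m (rep_dim \<rho>) (rep_dim \<rho>)" using \<rho>.dim_pos by auto
    then show ?case by blast
  next
    case (insert \<sigma> S)
    then obtain x where x: "\<rho> x \<noteq> 0\<^sub>m (rep_dim \<rho>) (rep_dim \<rho>)" "\<forall>\<sigma>\<in>S. \<sigma> x = 0\<^sub>m (rep_dim \<sigma>) (rep_dim \<sigma>)"
      by blast
    have irr: "irreducible_rep \<iota> \<tau>" if "\<tau> \<in> insert \<sigma> S" for \<tau> using insert.prems that by blast
    obtain y where y: "\<sigma> y = 0\<^sub>m (rep_dim \<sigma>) (rep_dim \<sigma>)" "\<rho> y \<noteq> 0\<^sub>m (rep_dim \<rho>) (rep_dim \<rho>)"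
      using rep_equiv_if_kernel_subset[OF alg_closed_irrepI[OF irr] \<rho>.alg_closed_irrep_axioms, of \<sigma>] insert.prems(2)[of \<sigma>]
      by blast
    from \<rho>.prime_kernel[OF x(1) y(2)] obtain a where a: "\<rho> (x * a * y) \<noteq> 0\<^sub>m (rep_dim \<rho>) (rep_dim \<rho>)" ..
    have "\<tau> (x * a * y) = 0\<^sub>m (rep_dim \<tau>) (rep_dim \<tau>)" if \<tau>: "\<tau> \<in> insert \<sigma> S" for \<tau>
    proof -
      interpret \<tau>: alg_closed_irrep \<iota> "rep_dim \<tau>" \<tau> by (rule alg_closed_irrepI[OF irr[OF \<tau>]])
      show ?thesis
      proof (cases "\<tau> = \<sigma>")
        case True
        have "\<tau> (x * a * y) = \<tau> (x * a) * 0\<^sub>m (rep_dim \<tau>) (rep_dim \<tau>)"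
          using y(1) True \<tau>.mult[of "x * a" y] by simp
        also have "\<dots> = 0\<^sub>m (rep_dim \<tau>) (rep_dim \<tau>)" by (rule right_mult_zero_mat[OF \<tau>.carrier])
        finally show ?thesis .
      next
        case False
        then have "\<tau> x = 0\<^sub>m (rep_dim \<tau>) (rep_dim \<tau>)" using \<tau> x(2) by blast
        then show ?thesis by (simp add: \<tau>.mult left_mult_zero_mat[OF \<tau>.carrier])
      qed
    qed
    with a show ?case by blast
  }
qed

section \<open>Fibers of the central character map and Zariski density\<close>

lemma Irrep_class:
  assumes "C \<in> Irrep \<iota>"
  shows "C \<noteq> {}" "\<rho> \<in> C \<Longrightarrow> irreducible_rep \<iota> \<rho>"
    "\<rho> \<in> C \<Longrightarrow> C' \<in> Irrep \<iota> \<Longrightarrow> \<sigma> \<in> C' \<Longrightarrow> (\<rho>, \<sigma>) \<in> rep_equiv \<iota> \<longleftrightarrow> C = C'"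
  using assms in_quotient_imp_non_empty[OF equiv_rep_equiv] in_quotient_imp_subset[OF equiv_rep_equiv]
    quotient_eq_iff[OF equiv_rep_equiv, of C \<iota> C' \<rho> \<sigma>]
  unfolding Irrep_def by blast+

text \<open>Separating elements \<open>x C\<close> have coordinate vectors on \<open>G\<close> that
  are independent after reduction by \<open>\<tau>\<close>: a relation among them, evaluated under
  the representation of \<open>D\<close>, isolates \<open>l D\<close>. The bound is put on finite
  subsets, so that finiteness of the fiber follows from it.\<close>

lemma card_fiber_le:
  fixes \<iota> :: "'k::alg_closed_field \<Rightarrow> 'r::ring_1 center" and G :: "'r set"
  assumes G: "finite G" "center_module.span G = UNIV"
    and F: "finite F" "F \<subseteq> {C \<in> Irrep \<iota>. central_character_map \<iota> C = \<tau>}"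
  shows "card F \<le> card G"
proof (rule ccontr)
  assume "\<not> card F \<le> card G"
  have "\<exists>u. x = (\<Sum>g\<in>G. of_center (u g) * g)" for x
    using G center_module.span_finite[OF G(1)] unfolding center_scale_def by blast
  then obtain co where co: "\<And>x. x = (\<Sum>g\<in>G. of_center (co x g) * g)" by metis
  define rep where "rep C = (SOME \<rho>. \<rho> \<in> C)" for C :: "('r \<Rightarrow> 'k mat) set"
  have C: "C \<in> Irrep \<iota>" "central_character_map \<iota> C = \<tau>" if "C \<in> F" for C using F(2) that by auto
  have rep: "rep C \<in> C" if "C \<in> F" for C
    unfolding rep_def some_in_eq by (rule Irrep_class(1)[OF C(1)[OF that]])
  have irr: "irreducible_rep \<iota> (rep C)" if "C \<in> F" for C
    using Irrep_class(2)[OF C(1) rep] that by blast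
  have \<tau>: "central_character \<iota> (rep C) = \<tau>" if "C \<in> F" for C
    using central_character_map_eq[OF C(1) rep] C(2) that by metis
  have "\<exists>x. C \<in> F \<longrightarrow> rep C x \<noteq> 0\<^sub>m (rep_dim (rep C)) (rep_dim (rep C)) \<and>
      (\<forall>D\<in>F - {C}. rep D x = 0\<^sub>m (rep_dim (rep D)) (rep_dim (rep D)))" for C
  proof (cases "C \<in> F")
    case True
    have "(rep D, rep C) \<notin> rep_equiv \<iota>" if "D \<in> F - {C}" for D
      using Irrep_class(3)[OF C(1) rep C(1) rep, of D C] that True by blast
    then have "\<exists>x. rep C x \<noteq> 0\<^sub>m (rep_dim (rep C)) (rep_dim (rep C)) \<and>
        (\<forall>\<sigma>\<in>rep ` (F - {C}). \<sigma> x = 0\<^sub>m (rep_dim \<sigma>) (rep_dim \<sigma>))"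
      using F(1) irr by (intro separating_element[OF irr[OF True]]) auto
    then show ?thesis by blast
  qed simp
  then obtain x where x: "\<And>C. C \<in> F \<Longrightarrow> rep C (x C) \<noteq> 0\<^sub>m (rep_dim (rep C)) (rep_dim (rep C))"
    "\<And>C D. C \<in> F \<Longrightarrow> D \<in> F \<Longrightarrow> D \<noteq> C \<Longrightarrow> rep D (x C) = 0\<^sub>m (rep_dim (rep D)) (rep_dim (rep D))"
    by (metis Diff_iff singletonD)
  obtain l where l: "\<exists>C\<in>F. l C \<noteq> 0" "\<And>g. g \<in> G \<Longrightarrow> (\<Sum>C\<in>F. \<tau> (co (x C) g) * l C) = 0"
    using homogeneous_system_nontrivial[OF G(1) F(1), of "\<lambda>g C. \<tau> (co (x C) g)"] \<open>\<not> card F \<le> card G\<close>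
    by auto
  have "l D = 0" if D: "D \<in> F" for D
  proof -
    interpret alg_closed_irrep \<iota> "rep_dim (rep D)" "rep D" by (rule alg_closed_irrepI[OF irr[OF D]])
    let ?n = "rep_dim (rep D)"
    obtain i j where ij: "i < ?n" "j < ?n" "rep D (x D) $$ (i, j) \<noteq> 0"
      using x(1)[OF D] kernel_eq_iff by blast
    have "(\<Sum>C\<in>F. l C * rep D (x C) $$ (i, j)) = (\<Sum>C\<in>F. \<Sum>g\<in>G. \<tau> (co (x C) g) * l C * rep D g $$ (i, j))"
    proof (rule sum.cong[OF refl])
      fix C
      have "rep D (x C) $$ (i, j) = rep D (\<Sum>g\<in>G. of_center (co (x C) g) * g) $$ (i, j)"
        using co[of "x C"] by (rule arg_cong)
      also have "\<dots> = (\<Sum>g\<in>G. \<tau> (co (x C) g) * rep D g $$ (i, j))"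
        using ij by (simp add: center_lincomb_entry[OF G(1)] \<tau>[OF D])
      finally show "l C * rep D (x C) $$ (i, j) = (\<Sum>g\<in>G. \<tau> (co (x C) g) * l C * rep D g $$ (i, j))"
        by (simp add: sum_distrib_left ac_simps)
    qed
    also have "\<dots> = (\<Sum>g\<in>G. (\<Sum>C\<in>F. \<tau> (co (x C) g) * l C) * rep D g $$ (i, j))"
      by (subst sum.swap) (simp add: sum_distrib_right)
    also have "\<dots> = 0" using l(2) by simp
    finally have "(\<Sum>C\<in>F. l C * rep D (x C) $$ (i, j)) = 0" .
    moreover have "(\<Sum>C\<in>F. l C * rep D (x C) $$ (i, j)) = (\<Sum>C\<in>F. if C = D then l D * rep D (x D) $$ (i, j) else 0)"
      using x(2)[OF _ D] ij by (intro sum.cong) auto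
    ultimately show ?thesis using ij(3) D F(1) by simp
  qed
  with l(1) show False by blast
qed

text \<open>Where a character is nonzero at \<open>a\<close> and \<open>b\<close> it is nonzero at
  \<open>a * b\<close>, so the generating sets are closed under finite intersections and form a
  basis.\<close>

lemma zariski_basis:
  assumes "openin (zariski \<iota>) T" "\<phi> \<in> T"
  shows "\<exists>a. \<phi> a \<noteq> 0 \<and> {\<psi> \<in> center_homs \<iota>. \<psi> a \<noteq> 0} \<subseteq> T"
proof -
  have "generate_topology_on {{\<phi> \<in> center_homs \<iota>. \<phi> c \<noteq> 0} |c. True} T"
    using assms(1) unfolding zariski_def by (simp add: openin_topology_generated_by_iff)
  from this assms(2) show ?thesis
  proof (induction arbitrary: \<phi> rule: generate_topology_on.induct)
    case Empty
    then show ?case by simp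
  next
    case (Int S T)
    then obtain a b where ab: "\<phi> a \<noteq> 0" "{\<psi> \<in> center_homs \<iota>. \<psi> a \<noteq> 0} \<subseteq> S"
      "\<phi> b \<noteq> 0" "{\<psi> \<in> center_homs \<iota>. \<psi> b \<noteq> 0} \<subseteq> T" by (meson IntE)
    have mult: "\<psi> (a * b) = \<psi> a * \<psi> b" if "\<psi> \<in> center_homs \<iota>" for \<psi>
    proof -
      interpret comm_ring_hom \<psi> using that by (simp add: center_homs_def)
      show ?thesis by (rule hom_mult)
    qed
    have "openin (zariski \<iota>) S" unfolding zariski_def openin_topology_generated_by_iff by (rule Int.hyps(1))
    then have "\<phi> \<in> center_homs \<iota>" using Int.prems openin_subset topspace_zariski by fastforce
    then have "\<phi> (a * b) \<noteq> 0" using mult[of \<phi>] ab by simp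
    moreover have "{\<psi> \<in> center_homs \<iota>. \<psi> (a * b) \<noteq> 0} \<subseteq> S \<inter> T"
    proof
      fix \<psi> assume \<psi>: "\<psi> \<in> {\<psi> \<in> center_homs \<iota>. \<psi> (a * b) \<noteq> 0}"
      then have "\<psi> a \<noteq> 0" "\<psi> b \<noteq> 0" using mult[of \<psi>] by auto
      with \<psi> ab show "\<psi> \<in> S \<inter> T" by blast
    qed
    ultimately show ?case by blast
  next
    case (UN K)
    then obtain S where S: "S \<in> K" "\<phi> \<in> S" by blast
    from UN.IH[OF this] S(1) show ?case by blast
  next
    case (Basis S)
    then show ?case by blast
  qed
qed

theorem theorem1:
  fixes \<iota> :: "'k::alg_closed_field \<Rightarrow> 'r::prime_ring center"
    and G :: "'r set" and r :: nat
  assumes affine: "affine_algebra \<iota>"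
    and gen: "finite G" "card G = r" "center_module.span G = UNIV"
  shows "central_character_map \<iota> ` Irrep \<iota> = center_homs \<iota> \<and>
    (\<exists>V N. openin (zariski \<iota>) V \<and> zariski \<iota> closure_of V = topspace (zariski \<iota>) \<and>
           N\<^sup>2 = center_rank TYPE('r) \<and>
           (\<forall>\<tau>\<in>V. (\<exists>!C. C \<in> Irrep \<iota> \<and> central_character_map \<iota> C = \<tau>) \<and>
              (\<forall>C\<in>Irrep \<iota>. central_character_map \<iota> C = \<tau> \<longrightarrow> (\<forall>\<rho>\<in>C. rep_dim \<rho> = N))) \<and>
           (\<forall>\<tau>\<in>center_homs \<iota> - V.
              finite {C \<in> Irrep \<iota>. central_character_map \<iota> C = \<tau>} \<and>
              card {C \<in> Irrep \<iota>. central_character_map \<iota> C = \<tau>} \<le> r \<and>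
              (\<forall>C\<in>Irrep \<iota>. central_character_map \<iota> C = \<tau> \<longrightarrow> (\<forall>\<rho>\<in>C. rep_dim \<rho> \<le> N))))"
proof -
  have \<iota>: "comm_ring_hom \<iota>" using affine by (simp add: affine_algebra_def)
  have irr: "alg_closed_irrep \<iota> (rep_dim \<rho>) \<rho>" and char: "central_character_map \<iota> C = central_character \<iota> \<rho>"
    if "C \<in> Irrep \<iota>" "\<rho> \<in> C" for C \<rho>
    using that by (auto intro: alg_closed_irrepI Irrep_class(2) central_character_map_eq)
  have ex_rep: "\<exists>\<rho>. \<rho> \<in> C" if "C \<in> Irrep \<iota>" for C using Irrep_class(1)[OF that] by blast
  have onto: "\<exists>C\<in>Irrep \<iota>. central_character_map \<iota> C = \<tau>" if \<tau>: "\<tau> \<in> center_homs \<iota>" for \<tau>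
  proof -
    interpret \<iota>: comm_ring_hom \<iota> by fact
    \<comment> \<open>With the whole center as subring, the representation obtained has
      \<open>\<tau>\<close> itself as central character.\<close>
    have sub: "subring_over \<iota> UNIV" by unfold_locales simp_all
    interpret \<tau>: comm_ring_hom \<tau> using \<tau> by (simp add: center_homs_def)
    have hom: "hom_on \<iota> UNIV \<tau>" using \<tau> by (simp add: hom_on_def center_homs_def \<tau>.hom_add \<tau>.hom_mult)
    have "\<exists>c. (\<forall>g\<in>G. c g \<in> UNIV) \<and> x = (\<Sum>g\<in>G. of_center (c g) * g)" for x
      using gen center_module.span_finite[OF gen(1)] unfolding center_scale_def by blast
    from irreducible_rep_over_character[OF sub gen(1) this hom] obtain \<rho> where
      \<rho>: "irreducible_rep \<iota> \<rho>" "\<And>z. \<rho> (of_center z) = \<tau> z \<cdot>\<^sub>m 1\<^sub>m (rep_dim \<rho>)" by blast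
    have "rep_equiv \<iota> `` {\<rho>} \<in> Irrep \<iota>" unfolding Irrep_def using \<rho>(1) by (intro quotientI) simp
    moreover have "\<rho> \<in> rep_equiv \<iota> `` {\<rho>}"
      using equiv_class_self[OF equiv_rep_equiv] \<rho>(1) by blast
    ultimately show ?thesis
      using char alg_closed_irrep.central_character_eqI(2)[OF alg_closed_irrepI[OF \<rho>(1)] \<rho>(2)] by metis
  qed
  have surj: "central_character_map \<iota> ` Irrep \<iota> = center_homs \<iota>"
  proof
    show "central_character_map \<iota> ` Irrep \<iota> \<subseteq> center_homs \<iota>"
      using ex_rep char alg_closed_irrep.central_character(1)[OF irr] by fastforce
    show "center_homs \<iota> \<subseteq> central_character_map \<iota> ` Irrep \<iota>" using onto by blast
  qed
  from central_frame_exists[OF gen(1,3)] obtain X :: "'r set" and c where "central_frame X c" by blast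
  then interpret central_frame X c .
  obtain d where d: "d \<noteq> 0" and
    locus: "\<And>(\<iota> :: 'k \<Rightarrow> 'r center) n \<rho>. alg_closed_irrep \<iota> n \<rho> \<Longrightarrow> central_character \<iota> \<rho> d \<noteq> 0 \<Longrightarrow>
      n * n = card X \<and> (\<forall>m \<sigma>. alg_closed_irrep \<iota> m \<sigma> \<longrightarrow>
        central_character \<iota> \<sigma> = central_character \<iota> \<rho> \<longrightarrow> (\<rho>, \<sigma>) \<in> rep_equiv \<iota>)"
    using azumaya_locus by blast
  define V where "V = {\<tau> \<in> center_homs \<iota>. \<tau> d \<noteq> 0}"
  \<comment> \<open>The center is a domain, so a character that is nonzero at \<open>a * d\<close>
    exists; it lies in \<open>V\<close> and in the principal open set of \<open>a\<close>. This is
    density.\<close>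
  have meet: "\<exists>\<tau>\<in>V. \<tau> a \<noteq> 0" if "a \<noteq> 0" for a
  proof -
    have "a * d \<noteq> 0" using that d by simp
    from center_homs_separate[OF affine gen(1,3) this] obtain \<tau> where
      \<tau>: "\<tau> \<in> center_homs \<iota>" "\<tau> (a * d) \<noteq> 0" by blast
    interpret comm_ring_hom \<tau> using \<tau>(1) by (simp add: center_homs_def)
    show ?thesis using \<tau> by (intro bexI[of _ \<tau>]) (auto simp: V_def hom_mult)
  qed
  \<comment> \<open>Nonemptiness of \<open>V\<close> supplies the representation whose dimension is
    \<open>N\<close>; this is where the rank is seen to be a square.\<close>
  obtain \<tau>0 where \<tau>0: "\<tau>0 \<in> V" using meet[of 1] by auto
  obtain C0 \<rho>0 where C0: "C0 \<in> Irrep \<iota>" "central_character_map \<iota> C0 = \<tau>0" "\<rho>0 \<in> C0"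
    using onto[of \<tau>0] \<tau>0 ex_rep unfolding V_def by blast
  define N where "N = rep_dim \<rho>0"
  have generic: "rep_dim \<rho> * rep_dim \<rho> = card X"
      "\<And>D \<sigma>. D \<in> Irrep \<iota> \<Longrightarrow> \<sigma> \<in> D \<Longrightarrow>
        central_character_map \<iota> D = central_character_map \<iota> C \<Longrightarrow> (\<rho>, \<sigma>) \<in> rep_equiv \<iota>"
    if "C \<in> Irrep \<iota>" "\<rho> \<in> C" "central_character_map \<iota> C \<in> V" for C \<rho>
  proof -
    have "central_character \<iota> \<rho> d \<noteq> 0" using that(3) char[OF that(1,2)] by (simp add: V_def)
    note * = locus[OF irr[OF that(1,2)] this]
    show "rep_dim \<rho> * rep_dim \<rho> = card X" using * by blast
    show "(\<rho>, \<sigma>) \<in> rep_equiv \<iota>" if "D \<in> Irrep \<iota>" "\<sigma> \<in> D"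
      "central_character_map \<iota> D = central_character_map \<iota> C" for D \<sigma>
    proof -
      have "central_character \<iota> \<sigma> = central_character \<iota> \<rho>"
        using that(3) char[OF that(1,2)] char[OF \<open>C \<in> Irrep \<iota>\<close> \<open>\<rho> \<in> C\<close>] by simp
      with * irr[OF that(1,2)] show ?thesis by blast
    qed
  qed
  have N: "N * N = card X" using generic(1)[OF C0(1,3)] C0(2) \<tau>0 by (simp add: N_def)
  have dim_le: "rep_dim \<rho> \<le> N" if "C \<in> Irrep \<iota>" "\<rho> \<in> C" for C \<rho>
  proof -
    have "rep_dim \<rho> * rep_dim \<rho> \<le> N * N" using dim_squared_le[OF irr[OF that]] N by simp
    then show ?thesis by (rule power2_le_imp_le[OF _ zero_le, unfolded power2_eq_square])
  qed
  have opn: "openin (zariski \<iota>) V"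
    unfolding zariski_def V_def by (rule topology_generated_by_Basis) blast
  have dense: "zariski \<iota> closure_of V = topspace (zariski \<iota>)"
    unfolding dense_intersects_open
  proof (intro allI impI, elim conjE)
    fix T assume T: "openin (zariski \<iota>) T" "T \<noteq> {}"
    then obtain \<phi> where \<phi>: "\<phi> \<in> T" by blast
    from zariski_basis[OF T(1) \<phi>] obtain a where
      a: "\<phi> a \<noteq> 0" "{\<psi> \<in> center_homs \<iota>. \<psi> a \<noteq> 0} \<subseteq> T" by blast
    have "\<phi> \<in> center_homs \<iota>" using openin_subset[OF T(1)] \<phi> by (auto simp: topspace_zariski)
    then interpret comm_ring_hom \<phi> by (simp add: center_homs_def)
    have "a \<noteq> 0" using a(1) by auto
    from meet[OF this] a(2) show "V \<inter> T \<noteq> {}" unfolding V_def by blast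
  qed
  have rank: "N\<^sup>2 = center_rank TYPE('r)"
    using N center_rank_eq by (simp add: power2_eq_square)
  have inside: "(\<exists>!C. C \<in> Irrep \<iota> \<and> central_character_map \<iota> C = \<tau>) \<and>
      (\<forall>C\<in>Irrep \<iota>. central_character_map \<iota> C = \<tau> \<longrightarrow> (\<forall>\<rho>\<in>C. rep_dim \<rho> = N))" if \<tau>: "\<tau> \<in> V" for \<tau>
  proof (intro conjI ballI impI)
    obtain C where C: "C \<in> Irrep \<iota>" "central_character_map \<iota> C = \<tau>" using onto[of \<tau>] \<tau> unfolding V_def by blast
    show "\<exists>!C. C \<in> Irrep \<iota> \<and> central_character_map \<iota> C = \<tau>"
    proof (rule ex1I[of _ C])
      fix D assume D: "D \<in> Irrep \<iota> \<and> central_character_map \<iota> D = \<tau>"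
      obtain \<rho> \<sigma> where "\<rho> \<in> C" "\<sigma> \<in> D" using ex_rep C D by blast
      with generic(2)[of C \<rho> D \<sigma>] Irrep_class(3)[of C \<iota> \<rho> D \<sigma>] C D \<tau> show "D = C" by auto
    qed (use C in simp)
    fix D \<rho> assume "D \<in> Irrep \<iota>" "central_character_map \<iota> D = \<tau>" "\<rho> \<in> D"
    then have "rep_dim \<rho> * rep_dim \<rho> = N * N" using generic(1)[of D \<rho>] \<tau> N by simp
    then show "rep_dim \<rho> = N" by (simp flip: power2_eq_square)
  qed
  \<comment> \<open>Finiteness is obtained along with the bound, since a bound on
    \<open>card\<close> alone says nothing about an infinite fiber.\<close>
  have fibers: "finite {C \<in> Irrep \<iota>. central_character_map \<iota> C = \<tau>} \<and>
      card {C \<in> Irrep \<iota>. central_character_map \<iota> C = \<tau>} \<le> r" for \<tau>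
    by (rule finite_if_finite_subsets_card_bdd) (use card_fiber_le[OF gen(1,3)] gen(2) in blast)
  show ?thesis
  proof (intro conjI exI[of _ V] exI[of _ N] ballI impI)
    show "\<exists>!C. C \<in> Irrep \<iota> \<and> central_character_map \<iota> C = \<tau>" if "\<tau> \<in> V" for \<tau>
      using inside[OF that] by (rule conjunct1)
    show "rep_dim \<rho> = N" if "\<tau> \<in> V" "C \<in> Irrep \<iota>" "central_character_map \<iota> C = \<tau>" "\<rho> \<in> C" for \<tau> C \<rho>
      using inside[OF that(1)] that(2-4) by blast
    show "finite {C \<in> Irrep \<iota>. central_character_map \<iota> C = \<tau>}"
      "card {C \<in> Irrep \<iota>. central_character_map \<iota> C = \<tau>} \<le> r" for \<tau>
      using fibers[of \<tau>] by simp_all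
    show "rep_dim \<rho> \<le> N" if "C \<in> Irrep \<iota>" "\<rho> \<in> C" for C \<rho>
      using that by (rule dim_le)
  qed (fact surj opn dense rank)+
qed

end
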